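(* Let $G$ be a $\sigma$-compact locally compact abelian group, $\mathcal A$ a van Hove sequence in $G$ and $\nu$ a translation bounded measure on $G$. Then $\langle\!\langle\mu,\nu\rangle\!\rangle_{\mathcal A}=0$ (meaning that it exists and vanishes) for all Besicovitch almost periodic measures $\mu$ on $G$ if and only if all Fourier–Bohr coefficients $a_\xi^{\mathcal A}(\nu)$, $\xi\in\widehat G$, of $\nu$ exist and vanish.
   Context: $G$ is written additively with neutral element $0$; a Haar measure is fixed, $|A|$ is the Haar measure of $A$. $\widehat G$ is the group of continuous homomorphisms $\xi:G\to\mathbb T$ ($\mathbb T$ = unit circle). $C_c(G)$ is the space of compactly supported continuous complex functions. A measure on $G$ is a linear functional $\mu:C_c(G)\to\mathbb C$ such that for each compact $K\subseteq G$ there is $C_K\ge0$ with $|\mu(\varphi)|\le C_K\|\varphi\|_\infty$ for all $\varphi\in C_c(G)$ supported in $K$; $|\mu|$ is its total variation, $\mu|_A$ its restriction to a Borel set $A$. $\mu$ is translation bounded if $\sup_{t\in G}|\mu|(t+V)<\infty$ for one (equivalently every) nonempty open $V$ with compact closure. $\tilde\varphi(x)=\overline{\varphi(-x)}$, $\tilde\mu(\varphi)=\overline{\mu(\tilde\varphi)}$. For finite measures, $(\mu*\nu)(\varphi)=\int\int\varphi(s+t)\,d\mu(s)\,d\nu(t)$. For $\varphi\in C_c(G)$, $(\mu*\varphi)(t)=\int_G\varphi(t-s)\,d\mu(s)$; this is bounded and uniformly continuous if $\mu$ is translation bounded. For compact $K$, $\partial^KA:=(\overline{A+K}\setminus A)\cup(((G\setminus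 A)-K)\cap\overline A)$. A van Hove sequence is a sequence $\mathcal A=(A_n)$ of open subsets of $G$ with compact closure (with $|A_n|>0$) such that $\lim_n|\partial^KA_n|/|A_n|=0$ for every compact $K\subseteq G$. $\langle\!\langle\mu,\nu\rangle\!\rangle_{\mathcal A}$ denotes the vague limit (pointwise on $C_c(G)$) of $\frac1{|A_n|}\,\mu|_{A_n}*\widetilde{\nu|_{A_n}}$, if it exists. The Fourier–Bohr coefficient is $a_\xi^{\mathcal A}(\nu)=\lim_n\frac1{|A_n|}\int_{A_n}\overline{\xi(t)}\,d\nu(t)$, if the limit exists. A translation bounded measure $\mu$ is Besicovitch almost periodic if for every $\varphi\in C_c(G)$ the function $\mu*\varphi$ is a Besicovitch 2-almost periodic function with respect to $\mathcal A$, i.e. for every $\varepsilon>0$ there is a finite linear combination $P$ of elements of $\widehat G$ with $\limsup_n\frac1{|A_n|}\int_{A_n}|\mu*\varphi(t)-P(t)|^2\,dt<\varepsilon$. *)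

theory Defs
  imports "HOL-Analysis.Analysis"
begin

text \<open>
  The group is the whole of a type of class \<open>{t2_space, topological_ab_group_add}\<close>; local
  compactness and sigma-compactness are properties of its topology.
\<close>

definition sigma_compact_lca :: "'a::{t2_space, topological_ab_group_add} itself \<Rightarrow> bool" where
  "sigma_compact_lca _ \<longleftrightarrow>
     locally_compact_space (euclidean :: 'a topology) \<and>
     (\<exists>C :: nat \<Rightarrow> 'a set. (\<forall>n. compact (C n)) \<and> (\<Union>n. C n) = UNIV)"

text \<open>
  Haar measures are Radon measures. The group need not be second countable, so the regularity
  conditions do not follow from finiteness on compact sets.
\<close>

definition haar_measure :: "'a::{t2_space, topological_ab_group_add} measure \<Rightarrow> bool" where
  "haar_measure m \<longleftrightarrow>
     sets m = sets borel \<and>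
     emeasure m UNIV \<noteq> 0 \<and>
     (\<forall>t. \<forall>B\<in>sets borel. emeasure m ((+) t ` B) = emeasure m B) \<and>
     (\<forall>K. compact K \<longrightarrow> emeasure m K < \<infinity>) \<and>
     (\<forall>B\<in>sets borel. emeasure m B = (INF U\<in>{U. open U \<and> B \<subseteq> U}. emeasure m U)) \<and>
     (\<forall>U. open U \<longrightarrow> emeasure m U = (SUP K\<in>{K. compact K \<and> K \<subseteq> U}. emeasure m K))"

definition dual_group :: "('a::{t2_space, topological_ab_group_add} \<Rightarrow> complex) set" where
  "dual_group = {\<xi>. continuous_on UNIV \<xi> \<and> (\<forall>x. norm (\<xi> x) = 1) \<and>
                     (\<forall>x y. \<xi> (x + y) = \<xi> x * \<xi> y)}"

definition Cc :: "('a::topological_space \<Rightarrow> complex) set" where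
  "Cc = {\<phi>. continuous_on UNIV \<phi> \<and> compact (closure {x. \<phi> x \<noteq> 0})}"


section \<open>Measures as linear functionals\<close>

text \<open>
  A measure is a linear functional on \<^const>\<open>Cc\<close>, represented by a HOL function on all functions
  \<open>'a \<Rightarrow> complex\<close> whose values outside \<^const>\<open>Cc\<close> are irrelevant.
\<close>

definition radon_measure :: "(('a::topological_space \<Rightarrow> complex) \<Rightarrow> complex) \<Rightarrow> bool" where
  "radon_measure \<mu> \<longleftrightarrow>
     (\<forall>\<phi>\<in>Cc. \<forall>\<psi>\<in>Cc. \<mu> (\<lambda>x. \<phi> x + \<psi> x) = \<mu> \<phi> + \<mu> \<psi>) \<and>
     (\<forall>c. \<forall>\<phi>\<in>Cc. \<mu> (\<lambda>x. c * \<phi> x) = c * \<mu> \<phi>) \<and>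
     (\<forall>K. compact K \<longrightarrow>
        (\<exists>C\<ge>0. \<forall>\<phi>\<in>Cc. {x. \<phi> x \<noteq> 0} \<subseteq> K \<longrightarrow> norm (\<mu> \<phi>) \<le> C * (SUP x. norm (\<phi> x))))"

text \<open>
  The total variation of a functional, as a Borel measure: on an open set it is the supremum of
  the values on the unit ball of functions supported there, and it is extended to Borel sets by
  outer regularity.
\<close>

definition variation_open ::
    "(('a::topological_space \<Rightarrow> complex) \<Rightarrow> complex) \<Rightarrow> 'a set \<Rightarrow> ennreal" where
  "variation_open \<mu> U =
     (SUP \<psi>\<in>{\<psi>\<in>Cc. closure {x. \<psi> x \<noteq> 0} \<subseteq> U \<and> (\<forall>x. norm (\<psi> x) \<le> 1)}. ennreal (norm (\<mu> \<psi>)))"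

definition total_variation ::
    "(('a::topological_space \<Rightarrow> complex) \<Rightarrow> complex) \<Rightarrow> 'a measure" where
  "total_variation \<mu> =
     measure_of UNIV (sets borel) (\<lambda>B. INF U\<in>{U. open U \<and> B \<subseteq> U}. variation_open \<mu> U)"

definition translation_bounded ::
    "(('a::{t2_space, topological_ab_group_add} \<Rightarrow> complex) \<Rightarrow> complex) \<Rightarrow> bool" where
  "translation_bounded \<mu> \<longleftrightarrow>
     radon_measure \<mu> \<and>
     (\<exists>V. open V \<and> V \<noteq> {} \<and> compact (closure V) \<and>
          (SUP t. emeasure (total_variation \<mu>) ((+) t ` V)) < \<infinity>)"

text \<open>
  Integration of Borel functions against \<open>\<mu>\<close> is the unique extension of \<open>\<mu>\<close> from \<^const>\<open>Cc\<close> to a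
  functional continuous for the \<open>L\<^sup>1\<close>-seminorm of the total variation.
\<close>

definition has_radon_integral ::
    "(('a::topological_space \<Rightarrow> complex) \<Rightarrow> complex) \<Rightarrow> ('a \<Rightarrow> complex) \<Rightarrow> complex \<Rightarrow> bool" where
  "has_radon_integral \<mu> f c \<longleftrightarrow>
     f \<in> borel_measurable borel \<and>
     (\<forall>\<epsilon>>0. \<exists>\<phi>\<in>Cc. (\<integral>\<^sup>+ x. ennreal (norm (f x - \<phi> x)) \<partial>total_variation \<mu>) < ennreal \<epsilon> \<and>
                    norm (\<mu> \<phi> - c) < \<epsilon>)"

definition radon_integral ::
    "(('a::topological_space \<Rightarrow> complex) \<Rightarrow> complex) \<Rightarrow> ('a \<Rightarrow> complex) \<Rightarrow> complex" where
  "radon_integral \<mu> f = (THE c. has_radon_integral \<mu> f c)"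

definition restrict_radon ::
    "(('a::topological_space \<Rightarrow> complex) \<Rightarrow> complex) \<Rightarrow> 'a set \<Rightarrow> ('a \<Rightarrow> complex) \<Rightarrow> complex" where
  "restrict_radon \<mu> B = (\<lambda>\<phi>. radon_integral \<mu> (\<lambda>x. indicator B x * \<phi> x))"

definition tilde_fun :: "('a::group_add \<Rightarrow> complex) \<Rightarrow> 'a \<Rightarrow> complex" where
  "tilde_fun \<phi> = (\<lambda>x. cnj (\<phi> (- x)))"

definition tilde_radon ::
    "(('a::group_add \<Rightarrow> complex) \<Rightarrow> complex) \<Rightarrow> ('a \<Rightarrow> complex) \<Rightarrow> complex" where
  "tilde_radon \<mu> = (\<lambda>\<phi>. cnj (\<mu> (tilde_fun \<phi>)))"

text \<open>
  For \<open>\<phi>\<close> in \<^const>\<open>Cc\<close> the functions \<open>\<lambda>s. \<phi> (s + t)\<close> and \<open>\<lambda>s. \<phi> (t - s)\<close> are again in \<^const>\<open>Cc\<close>,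
  so integrating them is applying \<open>\<mu>\<close>.
\<close>

definition conv_radon ::
    "(('a::{t2_space, topological_ab_group_add} \<Rightarrow> complex) \<Rightarrow> complex) \<Rightarrow>
     (('a \<Rightarrow> complex) \<Rightarrow> complex) \<Rightarrow> ('a \<Rightarrow> complex) \<Rightarrow> complex" where
  "conv_radon \<mu> \<nu> = (\<lambda>\<phi>. radon_integral \<nu> (\<lambda>t. \<mu> (\<lambda>s. \<phi> (s + t))))"

definition conv_fun ::
    "(('a::{t2_space, topological_ab_group_add} \<Rightarrow> complex) \<Rightarrow> complex) \<Rightarrow>
     ('a \<Rightarrow> complex) \<Rightarrow> 'a \<Rightarrow> complex" where
  "conv_fun \<mu> \<phi> = (\<lambda>t. \<mu> (\<lambda>s. \<phi> (t - s)))"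


section \<open>Averages along van Hove sequences\<close>

definition van_Hove_boundary ::
    "'a::{t2_space, topological_ab_group_add} set \<Rightarrow> 'a set \<Rightarrow> 'a set" where
  "van_Hove_boundary K A =
     (closure {a + k | a k. a \<in> A \<and> k \<in> K} - A) \<union>
     ({x - k | x k. x \<notin> A \<and> k \<in> K} \<inter> closure A)"

definition van_Hove ::
    "'a::{t2_space, topological_ab_group_add} measure \<Rightarrow> (nat \<Rightarrow> 'a set) \<Rightarrow> bool" where
  "van_Hove m A \<longleftrightarrow>
     (\<forall>n. open (A n) \<and> compact (closure (A n)) \<and> measure m (A n) > 0) \<and>
     (\<forall>K. compact K \<longrightarrow>
        (\<lambda>n. measure m (van_Hove_boundary K (A n)) / measure m (A n)) \<longlonglongrightarrow> 0)"

text \<open>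
  The Eberlein convolution of \<open>\<mu>\<close> and \<open>\<nu>\<close> along \<open>A\<close> exists and equals \<open>\<theta>\<close>, as a vague limit.
\<close>

definition has_eberlein_convolution ::
    "'a::{t2_space, topological_ab_group_add} measure \<Rightarrow> (nat \<Rightarrow> 'a set) \<Rightarrow>
     (('a \<Rightarrow> complex) \<Rightarrow> complex) \<Rightarrow> (('a \<Rightarrow> complex) \<Rightarrow> complex) \<Rightarrow>
     (('a \<Rightarrow> complex) \<Rightarrow> complex) \<Rightarrow> bool" where
  "has_eberlein_convolution m A \<mu> \<nu> \<theta> \<longleftrightarrow>
     (\<forall>\<phi>\<in>Cc. (\<lambda>n. complex_of_real (1 / measure m (A n)) *
                conv_radon (restrict_radon \<mu> (A n)) (tilde_radon (restrict_radon \<nu> (A n))) \<phi>)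
             \<longlonglongrightarrow> \<theta> \<phi>)"

definition has_fourier_bohr_coeff ::
    "'a::{t2_space, topological_ab_group_add} measure \<Rightarrow> (nat \<Rightarrow> 'a set) \<Rightarrow>
     (('a \<Rightarrow> complex) \<Rightarrow> complex) \<Rightarrow> ('a \<Rightarrow> complex) \<Rightarrow> complex \<Rightarrow> bool" where
  "has_fourier_bohr_coeff m A \<nu> \<xi> a \<longleftrightarrow>
     (\<lambda>n. complex_of_real (1 / measure m (A n)) *
          radon_integral \<nu> (\<lambda>t. indicator (A n) t * cnj (\<xi> t))) \<longlonglongrightarrow> a"

definition besicovitch_2_ap_fun ::
    "'a::{t2_space, topological_ab_group_add} measure \<Rightarrow> (nat \<Rightarrow> 'a set) \<Rightarrow>
     ('a \<Rightarrow> complex) \<Rightarrow> bool" where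
  "besicovitch_2_ap_fun m A f \<longleftrightarrow>
     (\<forall>\<epsilon>>0. \<exists>F c. finite F \<and> F \<subseteq> dual_group \<and>
        limsup (\<lambda>n. ereal (1 / measure m (A n) *
                     (LINT t:A n|m. (norm (f t - (\<Sum>\<xi>\<in>F. c \<xi> * \<xi> t)))\<^sup>2))) < ereal \<epsilon>)"

definition besicovitch_ap_measure ::
    "'a::{t2_space, topological_ab_group_add} measure \<Rightarrow> (nat \<Rightarrow> 'a set) \<Rightarrow>
     (('a \<Rightarrow> complex) \<Rightarrow> complex) \<Rightarrow> bool" where
  "besicovitch_ap_measure m A \<mu> \<longleftrightarrow>
     translation_bounded \<mu> \<and> (\<forall>\<phi>\<in>Cc. besicovitch_2_ap_fun m A (conv_fun \<mu> \<phi>))"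

end

theory Submission
  imports Defs
begin

text \<open>
  Put \<open>F(t) = \<integral> \<phi>(s - t) d\<mu>(s)\<close>. Restricting \<open>\<mu>\<close> to \<open>A\<^sub>n\<close> changes \<open>F\<close> only near the
  boundary of \<open>A\<^sub>n\<close>, whose \<open>\<nu>\<close>-mass is negligible by translation boundedness. Hence the Eberlein
  convolution vanishes iff the \<open>\<nu>\<close>-means of the conjugates of all these \<open>F\<close> do. For \<open>\<mu> = \<xi> \<cdot> haar\<close> the
  function \<open>F\<close> is a multiple of \<open>\<xi>\<close>, which gives one direction. Conversely, \<open>F\<close> is uniformly
  continuous, so averaging it over a small neighbourhood \<open>U\<close> of \<open>0\<close> moves it little; averaging an
  approximating trigonometric polynomial \<open>P\<close> over \<open>U\<close> yields another one, with vanishing \<open>\<nu>\<close>-mean; and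
  the \<open>|\<nu>|\<close>-mean of the \<open>U\<close>-average of \<open>|F - P|\<close> is at most a constant times its Haar mean, because \<open>\<nu>\<close>
  is translation bounded.
\<close>

section \<open>Functions of compact support\<close>

text \<open>The functionals are given on \<open>Cc\<close> only, while restrictions to
  \<open>A n\<close> and Fourier-Bohr means integrate \<open>indicator (A n)\<close> times a
  continuous function. \<open>total_variation\<close> is a \<open>measure_of\<close> and
  \<open>radon_integral\<close> a \<open>THE\<close>; neither yields a usable value until the outer
  variation is known to be countably additive on Borel sets and \<open>norm (\<mu> \<phi>)\<close>
  is known to be at most the integral of \<open>norm (\<phi> x)\<close> against the total variation.
  Without second countability, Borel sets of the product group need not belong to the product
  sigma-algebra, which obstructs exchanging integrals against |\<nu>| and Haar measure. A packing
  argument gives an inequality instead (\<open>TV_estimate\<close>), with a constant that depends on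
  \<nu> and a neighbourhood \<open>U\<close> but not on the set integrated over. With a constant
  integrand it controls the |\<nu>|-mass of \<open>A n\<close> and of its boundary; with the
  integrand |F - P| it controls the smoothed difference. The approximation is given in quadratic
  mean and is weakened to a mean of |F - P|, the form this inequality accepts.\<close>

lemma Cc_I:
  fixes \<phi> :: "'a::t2_space \<Rightarrow> complex"
  assumes "continuous_on UNIV \<phi>" "compact K" "\<And>x. \<phi> x \<noteq> 0 \<Longrightarrow> x \<in> K"
  shows "\<phi> \<in> Cc"
proof -
  have "closure {x. \<phi> x \<noteq> 0} \<subseteq> K"
    using assms by (intro closure_minimal) (auto intro: compact_imp_closed)
  then have "compact (closure {x. \<phi> x \<noteq> 0})"
    by (metis assms(2) closed_closure compact_Int_closed inf.absorb2)
  then show ?thesis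
    using assms(1) by (simp add: Cc_def)
qed

lemma Cc_continuous: "\<phi> \<in> Cc \<Longrightarrow> continuous_on UNIV \<phi>"
  by (simp add: Cc_def)

lemma Cc_support: "\<phi> \<in> Cc \<Longrightarrow> compact (closure {x. \<phi> x \<noteq> 0})"
  by (simp add: Cc_def)

lemma Cc_in_support: "\<phi> x \<noteq> 0 \<Longrightarrow> x \<in> closure {x. \<phi> x \<noteq> 0}"
  by (rule subsetD[OF closure_subset]) simp

lemma Cc_zero: "(\<lambda>x::'a::t2_space. 0) \<in> Cc"
  by (rule Cc_I[where K="{}"]) auto

lemma Cc_add:
  fixes \<phi> :: "'a::t2_space \<Rightarrow> complex"
  assumes "\<phi> \<in> Cc" "\<psi> \<in> Cc"
  shows "(\<lambda>x. \<phi> x + \<psi> x) \<in> Cc"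
proof (rule Cc_I[OF _ compact_Un[OF assms[THEN Cc_support]]])
  show "continuous_on UNIV (\<lambda>x. \<phi> x + \<psi> x)"
    by (intro continuous_intros assms[THEN Cc_continuous])
  show "x \<in> closure {x. \<phi> x \<noteq> 0} \<union> closure {x. \<psi> x \<noteq> 0}" if "\<phi> x + \<psi> x \<noteq> 0" for x
    using that Cc_in_support[of \<phi> x] Cc_in_support[of \<psi> x] by (cases "\<phi> x = 0") auto
qed

lemma Cc_mult_right:
  fixes \<phi> :: "'a::t2_space \<Rightarrow> complex"
  assumes "\<phi> \<in> Cc" "continuous_on UNIV g"
  shows "(\<lambda>x. \<phi> x * g x) \<in> Cc"
proof (rule Cc_I[OF _ assms(1)[THEN Cc_support]])
  show "continuous_on UNIV (\<lambda>x. \<phi> x * g x)"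
    by (intro continuous_intros assms(1)[THEN Cc_continuous] assms)
  show "x \<in> closure {x. \<phi> x \<noteq> 0}" if "\<phi> x * g x \<noteq> 0" for x
    using that Cc_in_support[of \<phi> x] by simp
qed

lemma Cc_mult_left:
  fixes \<phi> :: "'a::t2_space \<Rightarrow> complex"
  assumes "\<phi> \<in> Cc" "continuous_on UNIV g"
  shows "(\<lambda>x. g x * \<phi> x) \<in> Cc"
  using Cc_mult_right[OF assms] by (simp add: mult.commute)

lemma Cc_scale: "\<phi> \<in> Cc \<Longrightarrow> (\<lambda>x::'a::t2_space. c * \<phi> x) \<in> Cc"
  using Cc_mult_left[of \<phi> "\<lambda>_. c"] by simp

lemma Cc_diff:
  fixes \<phi> :: "'a::t2_space \<Rightarrow> complex"
  assumes "\<phi> \<in> Cc" "\<psi> \<in> Cc"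
  shows "(\<lambda>x. \<phi> x - \<psi> x) \<in> Cc"
  using Cc_add[OF assms(1) Cc_scale[OF assms(2), of "-1"]] by simp

lemma Cc_sum:
  fixes \<phi> :: "'i \<Rightarrow> 'a::t2_space \<Rightarrow> complex"
  assumes "\<And>i. i \<in> I \<Longrightarrow> \<phi> i \<in> Cc"
  shows "(\<lambda>x. \<Sum>i\<in>I. \<phi> i x) \<in> Cc"
  using assms
proof (induction I rule: infinite_finite_induct)
  case (insert i I)
  then show ?case using Cc_add[of "\<phi> i" "\<lambda>x. \<Sum>i\<in>I. \<phi> i x"] by simp
qed (simp_all add: Cc_zero)

lemma Cc_bounded:
  fixes \<phi> :: "'a::t2_space \<Rightarrow> complex"
  assumes "\<phi> \<in> Cc"
  shows "\<exists>B>0. \<forall>x. norm (\<phi> x) \<le> B"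
proof -
  have "compact (\<phi> ` closure {x. \<phi> x \<noteq> 0})"
    by (rule compact_continuous_image[OF continuous_on_subset[OF Cc_continuous[OF assms]]])
      (use assms Cc_support in auto)
  then obtain B where B: "0 < B" "\<forall>y\<in>\<phi> ` closure {x. \<phi> x \<noteq> 0}. norm y \<le> B"
    using bounded_pos compact_imp_bounded by metis
  have "norm (\<phi> x) \<le> B" for x
    using B Cc_in_support[of \<phi> x] by (cases "\<phi> x = 0") auto
  with B show ?thesis by blast
qed

text \<open>The supremum norm is dominated by any pointwise bound \<open>B\<close>, so the estimate
  can be applied without evaluating a \<open>SUP\<close>.\<close>

lemma radon_measure_bound:
  fixes \<mu> :: "('a::t2_space \<Rightarrow> complex) \<Rightarrow> complex"
  assumes "radon_measure \<mu>" "compact K"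
  shows "\<exists>C\<ge>0. \<forall>\<phi>\<in>Cc. \<forall>B. (\<forall>x. \<phi> x \<noteq> 0 \<longrightarrow> x \<in> K) \<longrightarrow> (\<forall>x. norm (\<phi> x) \<le> B) \<longrightarrow> norm (\<mu> \<phi>) \<le> C * B"
proof -
  obtain C where C: "0 \<le> C"
    "\<forall>\<phi>\<in>Cc. {x. \<phi> x \<noteq> 0} \<subseteq> K \<longrightarrow> norm (\<mu> \<phi>) \<le> C * (SUP x. norm (\<phi> x))"
    using assms unfolding radon_measure_def by meson
  have "norm (\<mu> \<phi>) \<le> C * B"
    if "\<phi> \<in> Cc" "\<forall>x. \<phi> x \<noteq> 0 \<longrightarrow> x \<in> K" "\<forall>x. norm (\<phi> x) \<le> B" for \<phi> B
  proof -
    have "norm (\<mu> \<phi>) \<le> C * (SUP x. norm (\<phi> x))"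
      using that by (intro C(2)[rule_format]) auto
    also have "\<dots> \<le> C * B"
      using C(1) that(3) by (intro mult_left_mono cSUP_least) auto
    finally show ?thesis .
  qed
  with C(1) show ?thesis by (intro exI[of _ C]) simp
qed

section \<open>Compact neighbourhoods and cutoff functions\<close>

lemma Hausdorff_space_euclidean_t2: "Hausdorff_space (euclidean :: 'a::t2_space topology)"
  unfolding Hausdorff_space_def by (simp add: disjnt_def) (metis hausdorff)

text \<open>Each point of \<open>K\<close> has a neighbourhood inside a compact subset of
  \<open>U\<close>. Finitely many of these neighbourhoods cover \<open>K\<close>, and the finite
  union of the compact sets is closed, so it contains the closure of their union.\<close>

lemma lc_compact_between:
  fixes K U :: "'a::t2_space set"
  assumes "locally_compact_space (euclidean :: 'a topology)" "compact K" "open U" "K \<subseteq> U"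
  obtains V where "open V" "K \<subseteq> V" "compact (closure V)" "closure V \<subseteq> U"
proof -
  have "neighbourhood_base_of (\<lambda>C. compactin euclidean C \<and> closedin euclidean C) (euclidean :: 'a topology)"
    using locally_compact_space_neighbourhood_base_closedin[of "euclidean :: 'a topology"] assms(1)
    by (simp add: Hausdorff_space_euclidean_t2)
  then have nb: "\<forall>W x. openin euclidean W \<and> x \<in> W \<longrightarrow> (\<exists>V C. openin euclidean V \<and>
      (compactin euclidean C \<and> closedin euclidean C) \<and> x \<in> V \<and> V \<subseteq> C \<and> C \<subseteq> (W :: 'a set))"
    unfolding neighbourhood_base_of .
  have "\<exists>V C. open V \<and> compact C \<and> x \<in> V \<and> V \<subseteq> C \<and> C \<subseteq> U" if xU: "x \<in> U" for x
  proof -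
    obtain V C where "open V" "compact C" "x \<in> V" "V \<subseteq> C" "C \<subseteq> U"
      using nb[rule_format, of U x] xU \<open>open U\<close> by auto
    then show ?thesis by blast
  qed
  then obtain V C where VC: "\<And>x. x \<in> U \<Longrightarrow> open (V x) \<and> compact (C x) \<and> x \<in> V x \<and> V x \<subseteq> C x \<and> C x \<subseteq> U"
    by metis
  obtain F where F: "F \<subseteq> K" "finite F" "K \<subseteq> (\<Union>x\<in>F. V x)"
    by (rule compactE_image[OF \<open>compact K\<close>, of K V]) (use VC \<open>K \<subseteq> U\<close> in blast)+
  have comp: "compact (\<Union>x\<in>F. C x)"
    using F VC \<open>K \<subseteq> U\<close> by (intro compact_UN) auto
  have clos: "closure (\<Union>x\<in>F. V x) \<subseteq> (\<Union>x\<in>F. C x)"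
    using F VC \<open>K \<subseteq> U\<close> by (intro closure_minimal compact_imp_closed comp) fastforce
  show ?thesis
  proof
    show "open (\<Union>x\<in>F. V x)" using F VC \<open>K \<subseteq> U\<close> by (intro open_UN) blast
    show "compact (closure (\<Union>x\<in>F. V x))"
      by (metis clos closed_closure comp compact_Int_closed inf.absorb2)
    show "closure (\<Union>x\<in>F. V x) \<subseteq> U"
      using clos F VC \<open>K \<subseteq> U\<close> by blast
  qed fact
qed

text \<open>Complete regularity gives functions vanishing off \<open>V\<close> that exceed 1/2 near
  a given point of \<open>K\<close>; twice a finite sum of their positive parts, capped at 1, is the
  cutoff. It equals 1 on an open \<open>W\<close> and not just on \<open>K\<close>, so that
  \<open>1 - h\<close> vanishes near \<open>K\<close> and the closed support of a product with
  \<open>1 - h\<close> stays away from \<open>K\<close>.\<close>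

lemma lc_bump:
  fixes K U :: "'a::t2_space set"
  assumes lc: "locally_compact_space (euclidean :: 'a topology)" and "compact K" "open U" "K \<subseteq> U"
  obtains h :: "'a \<Rightarrow> real" and W where "continuous_on UNIV h" "\<And>x. 0 \<le> h x" "\<And>x. h x \<le> 1"
    "open W" "K \<subseteq> W" "\<And>x. x \<in> W \<Longrightarrow> h x = 1"
    "compact (closure {x. h x \<noteq> 0})" "closure {x. h x \<noteq> 0} \<subseteq> U"
proof -
  obtain V where V: "open V" "K \<subseteq> V" "compact (closure V)" "closure V \<subseteq> U"
    using lc_compact_between[OF assms] .
  have "completely_regular_space (euclidean :: 'a topology)"
    by (rule locally_compact_regular_imp_completely_regular_space[OF lc]) (simp add: Hausdorff_space_euclidean_t2)
  then have cr: "\<forall>S x. openin euclidean S \<longrightarrow> x \<in> S \<longrightarrow> (\<exists>f::'a \<Rightarrow> real.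
      continuous_map euclidean euclidean f \<and> f x = 1 \<and> f ` (topspace euclidean - S) \<subseteq> {0})"
    by (subst (asm) completely_regular_space_gen_alt'[of "1::real" 0]) simp_all
  have "\<exists>f::'a \<Rightarrow> real. continuous_on UNIV f \<and> f x = 1 \<and> f ` (UNIV - V) \<subseteq> {0}" if "x \<in> K" for x
    using cr[rule_format, of V x] V that by auto
  then obtain f where f: "\<And>x. x \<in> K \<Longrightarrow> continuous_on UNIV (f x) \<and> f x x = (1::real) \<and> f x ` (UNIV - V) \<subseteq> {0}"
    by metis
  have op: "open {y. f x y > 1/2}" if "x \<in> K" for x
    using f[OF that] by (intro open_Collect_less) auto
  obtain F where F: "F \<subseteq> K" "finite F" "K \<subseteq> (\<Union>x\<in>F. {y. f x y > 1/2})"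
  proof (rule compactE_image[OF \<open>compact K\<close>, of K "\<lambda>x. {y. f x y > 1/2}"])
    show "K \<subseteq> (\<Union>x\<in>K. {y. f x y > 1/2})" using f by force
  qed (use op in auto)
  define W where "W = (\<Union>x\<in>F. {y. f x y > 1/2})"
  define h where "h = (\<lambda>y. min 1 (2 * (\<Sum>x\<in>F. max 0 (f x y))))"
  have cont: "continuous_on UNIV h"
    unfolding h_def using f F by (intro continuous_intros) auto
  have h0: "0 \<le> h y" for y unfolding h_def by (auto intro!: sum_nonneg)
  have h1: "h y \<le> 1" for y unfolding h_def by simp
  have W: "h y = 1" if yW: "y \<in> W" for y
  proof -
    obtain x where x: "x \<in> F" "f x y > 1/2" using yW unfolding W_def by blast
    have "1/2 \<le> max 0 (f x y)" using x by auto
    also have "\<dots> \<le> (\<Sum>x\<in>F. max 0 (f x y))"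
      using F x by (intro member_le_sum) auto
    finally show ?thesis unfolding h_def by simp
  qed
  have hV: "y \<in> V" if "h y \<noteq> 0" for y
  proof (rule ccontr)
    assume "y \<notin> V"
    then have "f x y = 0" if "x \<in> F" for x using f F that by blast
    then have "h y = 0" unfolding h_def by simp
    with that show False by simp
  qed
  have sub: "closure {x. h x \<noteq> 0} \<subseteq> closure V"
    using hV by (intro closure_mono) auto
  show ?thesis
  proof (rule that[of h W])
    show "open W" unfolding W_def using op F by auto
    show "K \<subseteq> W" using F by (simp add: W_def)
    show "compact (closure {x. h x \<noteq> 0})"
      by (metis V(3) closed_closure compact_Int_closed inf.absorb2 sub)
  qed (use cont h0 h1 W sub V in auto)
qed

section \<open>The total variation is a measure\<close>

locale lc_radon =
  fixes \<mu> :: "('a::t2_space \<Rightarrow> complex) \<Rightarrow> complex"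
  assumes lc: "locally_compact_space (euclidean :: 'a topology)"
    and radon: "radon_measure \<mu>"
begin

lemma \<mu>_add: "\<phi> \<in> Cc \<Longrightarrow> \<psi> \<in> Cc \<Longrightarrow> \<mu> (\<lambda>x. \<phi> x + \<psi> x) = \<mu> \<phi> + \<mu> \<psi>"
  using radon unfolding radon_measure_def by simp

lemma \<mu>_scale: "\<phi> \<in> Cc \<Longrightarrow> \<mu> (\<lambda>x. c * \<phi> x) = c * \<mu> \<phi>"
  using radon unfolding radon_measure_def by simp

lemma \<mu>_zero: "\<mu> (\<lambda>x. 0) = 0"
  using \<mu>_scale[OF Cc_zero, of 0] by simp

lemma \<mu>_diff: "\<phi> \<in> Cc \<Longrightarrow> \<psi> \<in> Cc \<Longrightarrow> \<mu> (\<lambda>x. \<phi> x - \<psi> x) = \<mu> \<phi> - \<mu> \<psi>"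
  using \<mu>_add[of \<phi> "\<lambda>x. -1 * \<psi> x"] \<mu>_scale[of \<psi> "-1"] Cc_scale[of \<psi> "-1"] by simp

lemma \<mu>_sum: "(\<And>i. i \<in> I \<Longrightarrow> \<phi> i \<in> Cc) \<Longrightarrow> \<mu> (\<lambda>x. \<Sum>i\<in>I. \<phi> i x) = (\<Sum>i\<in>I. \<mu> (\<phi> i))"
  by (induction I rule: infinite_finite_induct) (auto simp: \<mu>_zero \<mu>_add Cc_sum)

section \<open>The variation of open sets\<close>

lemma variation_open_upper:
  assumes "\<psi> \<in> Cc" "closure {x. \<psi> x \<noteq> 0} \<subseteq> U" "\<And>x. norm (\<psi> x) \<le> 1"
  shows "ennreal (norm (\<mu> \<psi>)) \<le> variation_open \<mu> U"
  unfolding variation_open_def by (rule SUP_upper) (use assms in auto)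

lemma variation_open_upper_scaled:
  assumes "\<psi> \<in> Cc" "closure {x. \<psi> x \<noteq> 0} \<subseteq> U" "\<And>x. norm (\<psi> x) \<le> r" "0 < r"
  shows "ennreal (norm (\<mu> \<psi>)) \<le> ennreal r * variation_open \<mu> U"
proof -
  let ?\<psi> = "\<lambda>x. complex_of_real (1/r) * \<psi> x"
  have "ennreal (norm (\<mu> ?\<psi>)) \<le> variation_open \<mu> U"
    using assms by (intro variation_open_upper Cc_scale) (auto simp: norm_mult norm_divide)
  moreover have "norm (\<mu> \<psi>) = r * norm (\<mu> ?\<psi>)"
    using assms by (subst \<mu>_scale) (auto simp: norm_mult norm_divide)
  ultimately show ?thesis
    using assms by (simp add: ennreal_mult mult_left_mono)
qed

lemma variation_open_mono: "U \<subseteq> V \<Longrightarrow> variation_open \<mu> U \<le> variation_open \<mu> V"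
  unfolding variation_open_def by (rule SUP_subset_mono) auto

lemma variation_open_empty: "variation_open \<mu> {} = 0"
proof -
  have "\<mu> \<psi> = 0" if "\<psi> \<in> Cc" "closure {x. \<psi> x \<noteq> 0} \<subseteq> {}" for \<psi>
  proof -
    have "\<psi> = (\<lambda>x. 0)" using that by auto
    then show ?thesis using \<mu>_zero by simp
  qed
  then show ?thesis unfolding variation_open_def
    by (intro antisym SUP_least) auto
qed

lemma variation_open_finite:
  assumes "compact (closure U)"
  shows "variation_open \<mu> U < \<infinity>"
proof -
  obtain C where C: "0 \<le> C" "\<forall>\<phi>\<in>Cc. \<forall>B. (\<forall>x. \<phi> x \<noteq> 0 \<longrightarrow> x \<in> closure U) \<longrightarrow>
      (\<forall>x. norm (\<phi> x) \<le> B) \<longrightarrow> norm (\<mu> \<phi>) \<le> C * B"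
    using radon_measure_bound[OF radon assms] by meson
  have "variation_open \<mu> U \<le> ennreal (C * 1)"
    unfolding variation_open_def
  proof (intro SUP_least ennreal_leI C(2)[rule_format])
    fix \<psi> x assume "\<psi> \<in> {\<psi> \<in> Cc. closure {x. \<psi> x \<noteq> 0} \<subseteq> U \<and> (\<forall>x. norm (\<psi> x) \<le> 1)}"
      and "\<psi> x \<noteq> 0"
    then show "x \<in> closure U"
      using closure_subset[of U] Cc_in_support[of \<psi> x] by blast
  qed auto
  also have "\<dots> < \<infinity>" by simp
  finally show ?thesis .
qed

text \<open>A cutoff equal to 1 near the part of the support outside \<open>V\<close> splits a test
  function into a piece supported in \<open>U\<close> and a piece supported in \<open>V\<close>,
  both still bounded by 1.\<close>

lemma variation_open_Un:
  assumes "open U" "open V"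
  shows "variation_open \<mu> (U \<union> V) \<le> variation_open \<mu> U + variation_open \<mu> V"
  unfolding variation_open_def[of \<mu> "U \<union> V"]
proof (rule SUP_least, clarsimp)
  fix \<psi> assume \<psi>: "\<psi> \<in> Cc" "closure {x. \<psi> x \<noteq> 0} \<subseteq> U \<union> V" "\<forall>x. norm (\<psi> x) \<le> 1"
  let ?K = "closure {x. \<psi> x \<noteq> 0}"
  have K: "compact (?K - V)" "?K - V \<subseteq> U"
    using \<psi> \<open>open V\<close> by (auto simp: Cc_def intro: compact_diff)
  obtain h :: "'a \<Rightarrow> real" and W where h: "continuous_on UNIV h" "\<And>x. 0 \<le> h x" "\<And>x. h x \<le> 1"
    "open W" "?K - V \<subseteq> W" "\<And>x. x \<in> W \<Longrightarrow> h x = 1"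
    "compact (closure {x. h x \<noteq> 0})" "closure {x. h x \<noteq> 0} \<subseteq> U"
    using lc_bump[OF lc K(1) \<open>open U\<close> K(2)] by metis
  define \<psi>1 where "\<psi>1 = (\<lambda>x. \<psi> x * complex_of_real (h x))"
  define \<psi>2 where "\<psi>2 = (\<lambda>x. \<psi> x * complex_of_real (1 - h x))"
  have c: "\<psi>1 \<in> Cc" "\<psi>2 \<in> Cc"
    unfolding \<psi>1_def \<psi>2_def using \<psi> h by (auto intro!: Cc_mult_right continuous_intros)
  have "\<psi> = (\<lambda>x. \<psi>1 x + \<psi>2 x)"
    unfolding \<psi>1_def \<psi>2_def by (auto simp: algebra_simps)
  then have "norm (\<mu> \<psi>) \<le> norm (\<mu> \<psi>1) + norm (\<mu> \<psi>2)"
    using \<mu>_add[OF c] norm_triangle_ineq by metis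
  then have "ennreal (norm (\<mu> \<psi>)) \<le> ennreal (norm (\<mu> \<psi>1)) + ennreal (norm (\<mu> \<psi>2))"
    by (metis ennreal_leI ennreal_plus norm_ge_zero)
  also have "ennreal (norm (\<mu> \<psi>1)) \<le> variation_open \<mu> U"
  proof (rule variation_open_upper[OF c(1)])
    have "closure {x. \<psi>1 x \<noteq> 0} \<subseteq> closure {x. h x \<noteq> 0}"
      unfolding \<psi>1_def by (rule closure_mono) auto
    then show "closure {x. \<psi>1 x \<noteq> 0} \<subseteq> U" using h by blast
    show "norm (\<psi>1 x) \<le> 1" for x
      unfolding \<psi>1_def using h(2,3)[of x] \<psi>(3) by (auto simp: norm_mult intro: mult_le_one)
  qed
  also have "ennreal (norm (\<mu> \<psi>2)) \<le> variation_open \<mu> V"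
  proof (rule variation_open_upper[OF c(2)])
    have "closure {x. \<psi>2 x \<noteq> 0} \<subseteq> ?K - W"
    proof (rule closure_minimal)
      show "closed (?K - W)" using h by (auto intro: closed_Diff)
      show "{x. \<psi>2 x \<noteq> 0} \<subseteq> ?K - W"
        unfolding \<psi>2_def using h(6) Cc_in_support[of \<psi>] by auto
    qed
    then show "closure {x. \<psi>2 x \<noteq> 0} \<subseteq> V" using h by blast
    show "norm (\<psi>2 x) \<le> 1" for x
    proof -
      have "norm (complex_of_real (1 - h x)) \<le> 1"
        unfolding norm_of_real using h(2,3)[of x] by simp
      then show ?thesis
        unfolding \<psi>2_def norm_mult using \<psi>(3) by (intro mult_le_one) auto
    qed
  qed
  finally show "ennreal (norm (\<mu> \<psi>)) \<le> variation_open \<mu> U + variation_open \<mu> V"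
    by (simp add: add_mono)
qed

lemma variation_open_UN_finite:
  assumes "finite I" "\<And>i. i \<in> I \<Longrightarrow> open (U i)"
  shows "variation_open \<mu> (\<Union>i\<in>I. U i) \<le> (\<Sum>i\<in>I. variation_open \<mu> (U i))"
  using assms
proof (induction I rule: finite_induct)
  case empty
  then show ?case by (simp add: variation_open_empty)
next
  case (insert i I)
  have "variation_open \<mu> (\<Union>i\<in>insert i I. U i) \<le> variation_open \<mu> (U i) + variation_open \<mu> (\<Union>i\<in>I. U i)"
    using insert variation_open_Un[of "U i" "\<Union>i\<in>I. U i"] by auto
  also have "\<dots> \<le> variation_open \<mu> (U i) + (\<Sum>i\<in>I. variation_open \<mu> (U i))"
    using insert by (intro add_left_mono) auto
  finally show ?case using insert by simp
qed

text \<open>The support of a test function is compact, so finitely many of the \<open>U i\<close>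
  cover it and finite subadditivity suffices.\<close>

lemma variation_open_UN:
  fixes U :: "nat \<Rightarrow> 'a set"
  assumes "\<And>i. open (U i)"
  shows "variation_open \<mu> (\<Union>i. U i) \<le> (\<Sum>i. variation_open \<mu> (U i))"
  unfolding variation_open_def[of \<mu> "\<Union>i. U i"]
proof (rule SUP_least, clarsimp)
  fix \<psi> assume \<psi>: "\<psi> \<in> Cc" "closure {x. \<psi> x \<noteq> 0} \<subseteq> (\<Union>i. U i)" "\<forall>x. norm (\<psi> x) \<le> 1"
  obtain I where I: "finite I" "closure {x. \<psi> x \<noteq> 0} \<subseteq> (\<Union>i\<in>I. U i)"
    using compactE_image[OF Cc_support[OF \<psi>(1)], of UNIV U] assms \<psi>(2) by auto
  have "ennreal (norm (\<mu> \<psi>)) \<le> variation_open \<mu> (\<Union>i\<in>I. U i)"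
    using \<psi> I by (intro variation_open_upper) auto
  also have "\<dots> \<le> (\<Sum>i\<in>I. variation_open \<mu> (U i))"
    using I assms by (intro variation_open_UN_finite) auto
  also have "\<dots> \<le> (\<Sum>i. variation_open \<mu> (U i))"
    using I by (intro sum_le_suminf) auto
  finally show "ennreal (norm (\<mu> \<psi>)) \<le> (\<Sum>i. variation_open \<mu> (U i))" .
qed

text \<open>This is the set function handed to \<open>measure_of\<close> in
  \<open>total_variation\<close>, named on all subsets so that Caratheodory's construction can be
  applied to it.\<close>

definition outer_variation :: "'a set \<Rightarrow> ennreal" where
  "outer_variation B = (INF U\<in>{U. open U \<and> B \<subseteq> U}. variation_open \<mu> U)"

lemma outer_variation_open: "open U \<Longrightarrow> outer_variation U = variation_open \<mu> U"
  unfolding outer_variation_def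
  by (intro antisym INF_lower INF_greatest) (auto intro: variation_open_mono)

lemma outer_variation_mono: "B \<subseteq> C \<Longrightarrow> outer_variation B \<le> outer_variation C"
  unfolding outer_variation_def by (rule INF_superset_mono) auto

text \<open>Each \<open>B n\<close> has an open superset whose variation is within
  \<open>e * (1/2)^Suc n\<close> of its outer variation; these errors add up to
  \<open>e\<close>.\<close>

lemma outer_variation_UN:
  fixes B :: "nat \<Rightarrow> 'a set"
  shows "outer_variation (\<Union>i. B i) \<le> (\<Sum>i. outer_variation (B i))"
proof (rule ennreal_le_epsilon)
  fix e :: real assume "0 < e" "(\<Sum>n. outer_variation (B n)) < top"
  then have "outer_variation (B n) < outer_variation (B n) + e * (1/2)^Suc n" for n
    by (auto simp add: less_top dest!: ennreal_suminf_lessD)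
  then have "(INF U\<in>{U. open U \<and> B n \<subseteq> U}. variation_open \<mu> U) < outer_variation (B n) + e * (1/2)^Suc n" for n
    by (simp add: outer_variation_def)
  then have "\<exists>U. open U \<and> B n \<subseteq> U \<and> variation_open \<mu> U \<le> outer_variation (B n) + e * (1/2)^Suc n" for n
    unfolding INF_less_iff by (blast intro: less_imp_le)
  then obtain U where U: "\<And>n. open (U n)" "\<And>n. B n \<subseteq> U n"
    "\<And>n. variation_open \<mu> (U n) \<le> outer_variation (B n) + e * (1/2)^Suc n"
    by metis
  have "outer_variation (\<Union>i. B i) \<le> variation_open \<mu> (\<Union>i. U i)"
    unfolding outer_variation_def using U by (intro INF_lower) auto
  also have "\<dots> \<le> (\<Sum>i. variation_open \<mu> (U i))"
    using U by (intro variation_open_UN) auto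
  also have "\<dots> \<le> (\<Sum>n. outer_variation (B n) + e * (1/2) ^ Suc n)"
    using U by (intro suminf_le) auto
  also have "\<dots> = (\<Sum>n. outer_variation (B n)) + (\<Sum>n. ennreal e * ennreal ((1/2) ^ Suc n))"
    using \<open>0 < e\<close> by (subst suminf_add[symmetric])
      (auto simp del: ennreal_suminf_cmult simp add: ennreal_mult[symmetric])
  also have "\<dots> = (\<Sum>n. outer_variation (B n)) + e"
    unfolding ennreal_suminf_cmult
    by (subst suminf_ennreal_eq[OF zero_le_power power_half_series]) auto
  finally show "outer_variation (\<Union>i. B i) \<le> (\<Sum>i. outer_variation (B i)) + ennreal e" .
qed

lemma outer_measure_space_outer_variation: "outer_measure_space (Pow UNIV) outer_variation"
  unfolding outer_measure_space_def
proof (intro conjI)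
  show "positive (Pow UNIV) outer_variation"
    by (simp add: positive_def outer_variation_open variation_open_empty)
  show "increasing (Pow UNIV) outer_variation"
    by (simp add: increasing_def outer_variation_mono)
  show "countably_subadditive (Pow UNIV) outer_variation"
    by (simp add: countably_subadditive_def outer_variation_UN)
qed

text \<open>A function supported in \<open>W \<inter> U\<close> leaves room in \<open>W\<close> for functions supported off its support;
  since the two supports are disjoint, rotating phases makes the two values add up.\<close>

lemma variation_open_split:
  assumes "open W" "open U"
  shows "variation_open \<mu> (W \<inter> U) + outer_variation (W - U) \<le> variation_open \<mu> W"
proof -
  let ?S = "{\<psi>\<in>Cc. closure {x. \<psi> x \<noteq> 0} \<subseteq> W \<inter> U \<and> (\<forall>x. norm (\<psi> x) \<le> 1)}"
  have "(\<lambda>x. 0) \<in> ?S" using Cc_zero by simp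
  then have ne: "?S \<noteq> {}" by blast
  have *: "ennreal (norm (\<mu> \<psi>)) + outer_variation (W - U) \<le> variation_open \<mu> W" if "\<psi> \<in> ?S" for \<psi>
  proof -
    define W' where "W' = W - closure {x. \<psi> x \<noteq> 0}"
    let ?S' = "{\<psi>\<in>Cc. closure {x. \<psi> x \<noteq> 0} \<subseteq> W' \<and> (\<forall>x. norm (\<psi> x) \<le> 1)}"
    have "(\<lambda>x. 0) \<in> ?S'" using Cc_zero by simp
    then have ne': "?S' \<noteq> {}" by blast
    have "open W'" unfolding W'_def using \<open>open W\<close> by (intro open_Diff) auto
    have "outer_variation (W - U) \<le> outer_variation W'"
      using that by (intro outer_variation_mono) (auto simp: W'_def)
    also have "\<dots> = variation_open \<mu> W'" using \<open>open W'\<close> by (rule outer_variation_open)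
    finally have 1: "ennreal (norm (\<mu> \<psi>)) + outer_variation (W - U)
        \<le> ennreal (norm (\<mu> \<psi>)) + variation_open \<mu> W'" by (rule add_left_mono)
    also have "\<dots> = (SUP \<psi>'\<in>?S'. ennreal (norm (\<mu> \<psi>)) + ennreal (norm (\<mu> \<psi>')))"
      unfolding variation_open_def[of \<mu> W'] by (rule ennreal_SUP_add_right[OF ne'])
    also have "\<dots> \<le> variation_open \<mu> W"
    proof (rule SUP_least)
      fix \<psi>' assume \<psi>': "\<psi>' \<in> ?S'"
      \<comment> \<open>The default 1 keeps the phase unimodular when the value is 0, where
        \<open>sgn\<close> vanishes.\<close>
      define a where "a = (if \<mu> \<psi> = 0 then 1 else cnj (sgn (\<mu> \<psi>)))"
      define b where "b = (if \<mu> \<psi>' = 0 then 1 else cnj (sgn (\<mu> \<psi>')))"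
      have rot: "cnj (sgn z) * z = complex_of_real (norm z)" for z
        by (cases "z = 0") (auto simp: sgn_eq complex_norm_square[symmetric] power2_eq_square mult.commute)
      have a: "norm a = 1" "a * \<mu> \<psi> = complex_of_real (norm (\<mu> \<psi>))"
        by (auto simp: a_def norm_sgn rot)
      have b: "norm b = 1" "b * \<mu> \<psi>' = complex_of_real (norm (\<mu> \<psi>'))"
        by (auto simp: b_def norm_sgn rot)
      let ?\<phi> = "\<lambda>x. a * \<psi> x + b * \<psi>' x"
      have c: "\<psi> \<in> Cc" "\<psi>' \<in> Cc" using that \<psi>' by auto
      have "\<mu> ?\<phi> = complex_of_real (norm (\<mu> \<psi>) + norm (\<mu> \<psi>'))"
        using c a b by (simp add: \<mu>_add \<mu>_scale Cc_scale)
      then have "norm (\<mu> ?\<phi>) = norm (\<mu> \<psi>) + norm (\<mu> \<psi>')"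
        by (simp only: norm_of_real) simp
      then have "ennreal (norm (\<mu> \<psi>)) + ennreal (norm (\<mu> \<psi>')) = ennreal (norm (\<mu> ?\<phi>))"
        by (simp add: ennreal_plus)
      also have "\<dots> \<le> variation_open \<mu> W"
      proof (rule variation_open_upper)
        show "?\<phi> \<in> Cc" using c by (intro Cc_add Cc_scale)
        have "{x. ?\<phi> x \<noteq> 0} \<subseteq> {x. \<psi> x \<noteq> 0} \<union> {x. \<psi>' x \<noteq> 0}" by auto
        then have "closure {x. ?\<phi> x \<noteq> 0} \<subseteq> closure {x. \<psi> x \<noteq> 0} \<union> closure {x. \<psi>' x \<noteq> 0}"
          unfolding closure_Un[symmetric] by (rule closure_mono)
        then show "closure {x. ?\<phi> x \<noteq> 0} \<subseteq> W"
          using that \<psi>' unfolding W'_def by blast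
        show "norm (?\<phi> x) \<le> 1" for x
        proof (cases "\<psi> x = 0")
          case True
          then show ?thesis using \<psi>' b by (simp add: norm_mult)
        next
          case False
          then have "\<psi>' x = 0"
            using \<psi>' Cc_in_support[of \<psi> x] Cc_in_support[of \<psi>' x] unfolding W'_def by blast
          then show ?thesis using that a by (simp add: norm_mult)
        qed
      qed
      finally show "ennreal (norm (\<mu> \<psi>)) + ennreal (norm (\<mu> \<psi>')) \<le> variation_open \<mu> W" .
    qed
    finally show ?thesis .
  qed
  have "variation_open \<mu> (W \<inter> U) + outer_variation (W - U)
      = (SUP \<psi>\<in>?S. ennreal (norm (\<mu> \<psi>)) + outer_variation (W - U))"
    unfolding variation_open_def[of \<mu> "W \<inter> U"] by (rule ennreal_SUP_add_left[OF ne, symmetric])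
  also have "\<dots> \<le> variation_open \<mu> W" by (rule SUP_least) (rule *)
  finally show ?thesis .
qed

text \<open>Caratheodory's condition has to be tested against arbitrary sets \<open>E\<close>;
  passing to open \<open>W\<close> containing \<open>E\<close> reduces the nontrivial inequality to
  \<open>variation_open_split\<close>. The other inequality is subadditivity.\<close>

lemma open_in_lambda_system:
  assumes "open U"
  shows "U \<in> lambda_system UNIV (Pow UNIV) outer_variation"
proof -
  have "outer_variation (U \<inter> E) + outer_variation ((UNIV - U) \<inter> E) = outer_variation E" for E
  proof (rule antisym)
    show "outer_variation (U \<inter> E) + outer_variation ((UNIV - U) \<inter> E) \<le> outer_variation E"
      unfolding outer_variation_def[of E]
    proof (rule INF_greatest)
      fix W assume "W \<in> {W. open W \<and> E \<subseteq> W}"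
      then have W: "open W" "E \<subseteq> W" by auto
      have "outer_variation (U \<inter> E) \<le> outer_variation (W \<inter> U)"
        using W by (intro outer_variation_mono) auto
      also have "\<dots> = variation_open \<mu> (W \<inter> U)"
        using W assms by (intro outer_variation_open) auto
      finally have 1: "outer_variation (U \<inter> E) \<le> variation_open \<mu> (W \<inter> U)" .
      have 2: "outer_variation ((UNIV - U) \<inter> E) \<le> outer_variation (W - U)"
        using W by (intro outer_variation_mono) auto
      show "outer_variation (U \<inter> E) + outer_variation ((UNIV - U) \<inter> E) \<le> variation_open \<mu> W"
        using add_mono[OF 1 2] variation_open_split[OF W(1) assms] by (rule order_trans)
    qed
    have "subadditive (Pow UNIV) outer_variation"
      using outer_measure_space_outer_variation unfolding outer_measure_space_def
      by (intro ring_of_sets.countably_subadditive_subadditive[OF ring_of_sets_Pow]) simp_all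
    then have "outer_variation ((U \<inter> E) \<union> ((UNIV - U) \<inter> E))
        \<le> outer_variation (U \<inter> E) + outer_variation ((UNIV - U) \<inter> E)"
      unfolding subadditive_def by (simp add: disjoint_iff)
    moreover have "(U \<inter> E) \<union> ((UNIV - U) \<inter> E) = E" by auto
    ultimately show "outer_variation E \<le> outer_variation (U \<inter> E) + outer_variation ((UNIV - U) \<inter> E)"
      by simp
  qed
  then show ?thesis unfolding lambda_system_def by auto
qed

text \<open>Caratheodory's measurable sets form a sigma-algebra that contains the open sets, hence
  all Borel sets.\<close>

lemma measure_space_outer_variation: "measure_space UNIV (sets borel) outer_variation"
proof -
  interpret P: sigma_algebra UNIV "Pow UNIV :: 'a set set" by (rule sigma_algebra_Pow)
  let ?L = "lambda_system UNIV (Pow UNIV) outer_variation"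
  have L: "measure_space UNIV ?L outer_variation"
    by (rule P.caratheodory_lemma[OF outer_measure_space_outer_variation])
  then interpret L: sigma_algebra UNIV ?L by (simp add: measure_space_def)
  have "sets (borel :: 'a measure) = sigma_sets UNIV {S. open S}"
    by (simp add: borel_def)
  also have "\<dots> \<subseteq> ?L"
    by (rule L.sigma_sets_subset) (use open_in_lambda_system in blast)
  finally show ?thesis
    using measure_down[OF L] sets.sigma_algebra_axioms[of borel] by simp
qed

section \<open>The total variation as a Borel measure\<close>

lemma sets_total_variation [simp, measurable_cong]: "sets (total_variation \<mu>) = sets borel"
  unfolding total_variation_def by (metis sets.sigma_sets_eq sets_measure_of space_borel subset_UNIV Pow_UNIV)

lemma space_total_variation [simp]: "space (total_variation \<mu>) = UNIV"
  by (metis sets_eq_imp_space_eq sets_total_variation space_borel)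

lemma emeasure_total_variation:
  assumes "B \<in> sets borel"
  shows "emeasure (total_variation \<mu>) B = outer_variation B"
  unfolding total_variation_def outer_variation_def[symmetric]
  by (rule emeasure_measure_of_sigma) (use measure_space_outer_variation assms in \<open>auto simp: measure_space_def\<close>)

lemma emeasure_total_variation_open: "open U \<Longrightarrow> emeasure (total_variation \<mu>) U = variation_open \<mu> U"
  by (simp add: emeasure_total_variation outer_variation_open)

lemma emeasure_total_variation_compact:
  assumes "compact K"
  shows "emeasure (total_variation \<mu>) K < \<infinity>"
proof -
  obtain V where V: "open V" "K \<subseteq> V" "compact (closure V)" "closure V \<subseteq> UNIV"
    by (rule lc_compact_between[OF lc assms, of UNIV]) auto
  have "emeasure (total_variation \<mu>) K \<le> emeasure (total_variation \<mu>) V"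
    using V by (intro emeasure_mono) auto
  also have "\<dots> < \<infinity>"
    using V variation_open_finite[of V] by (simp add: emeasure_total_variation_open)
  finally show ?thesis .
qed

end

section \<open>Integration against a functional\<close>

text \<open>For positive \<open>s\<close> this is the radial retraction of the plane onto the closed
  disc of radius \<open>s\<close>. Dividing by a maximum instead of distinguishing whether
  \<open>z\<close> lies in the disc makes continuity immediate.\<close>

definition radial_trunc :: "real \<Rightarrow> complex \<Rightarrow> complex" where
  "radial_trunc s z = (if s \<le> 0 then 0 else z / complex_of_real (max 1 (norm z / s)))"

text \<open>Both truncations are nonnegative multiples of \<open>z\<close>, so the norm of their
  difference is the difference of their norms.\<close>

lemma radial_trunc_diff:
  assumes "0 \<le> s" "s \<le> t"
  shows "norm (radial_trunc t z - radial_trunc s z) = min (norm z) t - min (norm z) s"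
proof -
  define p where "p = (\<lambda>s. if s \<le> 0 then 0 else 1 / max 1 (norm z / s))"
  have rt: "radial_trunc s z = z * complex_of_real (p s)" for s
    by (simp add: radial_trunc_def p_def)
  have np: "norm z * p s = min (norm z) s" if "0 \<le> s" for s
    using that by (cases "s = 0") (auto simp: p_def max_def min_def field_simps)
  have "norm (radial_trunc t z - radial_trunc s z) = norm (z * complex_of_real (p t - p s))"
    by (simp add: rt algebra_simps)
  also have "\<dots> = \<bar>norm z * (p t - p s)\<bar>"
    unfolding norm_mult norm_of_real by (simp add: abs_mult)
  also have "norm z * (p t - p s) = min (norm z) t - min (norm z) s"
    using np[of t] np[of s] assms by (simp add: algebra_simps)
  finally show ?thesis using assms by auto
qed

lemma radial_trunc_id:
  assumes "norm z \<le> s"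
  shows "radial_trunc s z = z"
proof (cases "s \<le> 0")
  case True
  then have "norm z = 0" using assms norm_ge_zero[of z] by linarith
  then show ?thesis using True by (simp add: radial_trunc_def)
next
  case False
  then have "max 1 (norm z / s) = 1" using assms by simp
  then show ?thesis using False by (simp add: radial_trunc_def)
qed

lemma continuous_radial_trunc:
  assumes "continuous_on UNIV \<phi>"
  shows "continuous_on UNIV (\<lambda>x. radial_trunc s (\<phi> x))"
proof (cases "s \<le> 0")
  case False
  then have "continuous_on UNIV (\<lambda>x. \<phi> x / complex_of_real (max 1 (norm (\<phi> x) / s)))"
    using assms by (intro continuous_intros) (auto simp: max_def)
  then show ?thesis using False by (simp add: radial_trunc_def)
qed (simp add: radial_trunc_def)

text \<open>At most \<open>r / \<epsilon> + 1\<close> of the levels \<open>j * \<epsilon>\<close>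
  lie below a positive \<open>r\<close>. The extra \<epsilon> is the rounding error of the
  discretised layer-cake formula.\<close>

lemma sum_levels_le:
  fixes r \<epsilon> :: real
  assumes "0 \<le> r" "0 \<le> \<epsilon>"
  shows "(\<Sum>j<M. if real j * \<epsilon> < r then \<epsilon> else 0) \<le> (if 0 < r then r + \<epsilon> else 0)"
proof -
  \<comment> \<open>The second argument of \<open>min\<close> carries the induction: a new summand
    appears only if \<open>M * \<epsilon> < r\<close>, and then
    \<open>M * \<epsilon> + \<epsilon>\<close> is still at most
    \<open>r + \<epsilon>\<close>.\<close>
  have "(\<Sum>j<M. if real j * \<epsilon> < r then \<epsilon> else 0) \<le> min (r + \<epsilon>) (real M * \<epsilon>)"
    by (induction M) (use assms in \<open>auto simp: algebra_simps min_def split: if_splits\<close>)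
  moreover have "(\<Sum>j<M. if real j * \<epsilon> < r then \<epsilon> else 0) = 0" if "\<not> 0 < r"
  proof -
    have "\<not> real j * \<epsilon> < r" for j
      using that assms mult_nonneg_nonneg[of "real j" \<epsilon>] by linarith
    then show ?thesis by simp
  qed
  ultimately show ?thesis by auto
qed

context lc_radon
begin

lemma borel_measurable_TV: "(f \<in> borel_measurable (total_variation \<mu>)) = (f \<in> borel_measurable borel)"
  by (simp cong: measurable_cong_sets)

text \<open>Cut \<open>\<phi>\<close> into radial layers of thickness \<open>\<epsilon>\<close>; the \<open>k\<close>-th layer lives on \<open>{|\<phi>| \<ge> k\<epsilon>}\<close>, so its
  value is at most \<open>\<epsilon>\<close> times the variation of \<open>{|\<phi>| > (k - 1)\<epsilon>}\<close>.\<close>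

lemma norm_\<mu>_le_layers:
  assumes \<phi>: "\<phi> \<in> Cc" and W: "open W" "closure {x. \<phi> x \<noteq> 0} \<subseteq> W" and \<epsilon>: "0 < \<epsilon>"
  shows "ennreal (norm (\<mu> \<phi>)) \<le> (\<integral>\<^sup>+x. ennreal (norm (\<phi> x)) \<partial>total_variation \<mu>) +
    ennreal (2 * \<epsilon>) * emeasure (total_variation \<mu>) W"
proof -
  let ?V = "total_variation \<mu>"
  obtain B where B: "0 < B" "\<forall>x. norm (\<phi> x) \<le> B" using Cc_bounded[OF \<phi>] by blast
  obtain N0 where N0: "B < real N0 * \<epsilon>"
    using reals_Archimedean3[OF \<epsilon>, rule_format, of B] by blast
  \<comment> \<open>A successor, so that the lowest layer can be split off: no level set precedes
    it, and it is estimated by the variation of \<open>W\<close>. This accounts for one of the two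
    error terms \<open>\<epsilon> * |\<mu>|(W)\<close>; the other is the rounding error of
    \<open>sum_levels_le\<close>.\<close>
  define N where "N = Suc N0"
  have N: "B \<le> real N * \<epsilon>" using N0 \<epsilon> by (simp add: N_def algebra_simps)
  define T where "T = (\<lambda>k x. radial_trunc (real k * \<epsilon>) (\<phi> x))"
  define \<phi>' where "\<phi>' = (\<lambda>k x. T (Suc k) x - T k x)"
  define E where "E = (\<lambda>k. {x. real k * \<epsilon> < norm (\<phi> x)})"
  have cont: "continuous_on UNIV \<phi>" using \<phi> by (rule Cc_continuous)
  have E_open: "open (E k)" for k
    unfolding E_def using cont by (intro open_Collect_less continuous_intros)
  have norm\<phi>': "norm (\<phi>' k x) = min (norm (\<phi> x)) (real (Suc k) * \<epsilon>) - min (norm (\<phi> x)) (real k * \<epsilon>)" for k x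
    unfolding \<phi>'_def T_def using \<epsilon> by (intro radial_trunc_diff) auto
  have le: "norm (\<phi>' k x) \<le> \<epsilon>" for k x
    unfolding norm\<phi>' using \<epsilon> by (auto simp: min_def algebra_simps)
  have supp: "real k * \<epsilon> \<le> norm (\<phi> x)" "\<phi> x \<noteq> 0" if "\<phi>' k x \<noteq> 0" for k x
  proof -
    have "0 < norm (\<phi>' k x)" using that by simp
    moreover have "0 \<le> real k * \<epsilon>" "real k * \<epsilon> \<le> real (Suc k) * \<epsilon>"
      using \<epsilon> by (auto simp: algebra_simps)
    ultimately show "real k * \<epsilon> \<le> norm (\<phi> x)" "\<phi> x \<noteq> 0"
      unfolding norm\<phi>' by (auto simp: min_def simp del: of_nat_Suc split: if_splits)
  qed
  have Cc': "\<phi>' k \<in> Cc" for k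
  proof (rule Cc_I[OF _ Cc_support[OF \<phi>]])
    show "continuous_on UNIV (\<phi>' k)"
      unfolding \<phi>'_def T_def by (intro continuous_on_diff continuous_radial_trunc cont)
    show "x \<in> closure {x. \<phi> x \<noteq> 0}" if "\<phi>' k x \<noteq> 0" for x
      using supp(2)[OF that] by (rule Cc_in_support)
  qed
  have "T N x = \<phi> x" for x
    unfolding T_def using B(2)[rule_format, of x] N by (intro radial_trunc_id) auto
  moreover have "T 0 x = 0" for x unfolding T_def radial_trunc_def by simp
  ultimately have "\<phi> x = (\<Sum>k<N. \<phi>' k x)" for x
    unfolding \<phi>'_def by (subst sum_lessThan_telescope) simp
  then have "\<mu> \<phi> = \<mu> (\<lambda>x. \<Sum>k<N. \<phi>' k x)" by presburger
  also have "\<dots> = (\<Sum>k<N. \<mu> (\<phi>' k))" by (rule \<mu>_sum) (rule Cc')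
  finally have "norm (\<mu> \<phi>) \<le> (\<Sum>k<N. norm (\<mu> (\<phi>' k)))" by (simp add: norm_sum)
  then have "ennreal (norm (\<mu> \<phi>)) \<le> (\<Sum>k<N. ennreal (norm (\<mu> (\<phi>' k))))"
    by (simp add: sum_ennreal ennreal_leI)
  also have "\<dots> = ennreal (norm (\<mu> (\<phi>' 0))) + (\<Sum>k<N0. ennreal (norm (\<mu> (\<phi>' (Suc k)))))"
    unfolding N_def by (rule sum.lessThan_Suc_shift)
  also have "\<dots> \<le> ennreal \<epsilon> * emeasure ?V W + (\<Sum>k<N0. ennreal \<epsilon> * emeasure ?V (E k))"
  proof (intro add_mono sum_mono)
    have "{x. \<phi>' 0 x \<noteq> 0} \<subseteq> {x. \<phi> x \<noteq> 0}" using supp(2) by auto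
    then have "closure {x. \<phi>' 0 x \<noteq> 0} \<subseteq> W"
      using closure_mono W by (meson order_trans)
    then show "ennreal (norm (\<mu> (\<phi>' 0))) \<le> ennreal \<epsilon> * emeasure ?V W"
      using W \<epsilon> by (auto simp: emeasure_total_variation_open intro!: variation_open_upper_scaled Cc' le)
    fix k
    have "closure {x. \<phi>' (Suc k) x \<noteq> 0} \<subseteq> {x. real (Suc k) * \<epsilon> \<le> norm (\<phi> x)}"
      using supp(1)[of "Suc k"] cont by (intro closure_minimal closed_Collect_le continuous_intros) auto
    also have "\<dots> \<subseteq> E k" unfolding E_def using \<epsilon> by (auto simp: algebra_simps)
    finally show "ennreal (norm (\<mu> (\<phi>' (Suc k)))) \<le> ennreal \<epsilon> * emeasure ?V (E k)"
      using E_open \<epsilon> by (auto simp: emeasure_total_variation_open intro!: variation_open_upper_scaled Cc' le)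
  qed
  also have "(\<Sum>k<N0. ennreal \<epsilon> * emeasure ?V (E k)) = (\<integral>\<^sup>+x. (\<Sum>k<N0. ennreal \<epsilon> * indicator (E k) x) \<partial>?V)"
    using E_open by (subst nn_integral_sum) (auto simp: nn_integral_cmult_indicator borel_measurable_TV)
  also have "\<dots> \<le> (\<integral>\<^sup>+x. ennreal (norm (\<phi> x)) + ennreal \<epsilon> * indicator W x \<partial>?V)"
  proof (rule nn_integral_mono)
    fix x
    have "(\<Sum>k<N0. ennreal \<epsilon> * indicator (E k) x) = (\<Sum>k<N0. ennreal (if real k * \<epsilon> < norm (\<phi> x) then \<epsilon> else 0))"
      unfolding E_def by (intro sum.cong) (auto simp: indicator_def)
    also have "\<dots> = ennreal (\<Sum>k<N0. if real k * \<epsilon> < norm (\<phi> x) then \<epsilon> else 0)"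
      using \<epsilon> by (intro sum_ennreal) auto
    also have "\<dots> \<le> ennreal (if 0 < norm (\<phi> x) then norm (\<phi> x) + \<epsilon> else 0)"
      using \<epsilon> by (intro ennreal_leI sum_levels_le) auto
    also have "\<dots> \<le> ennreal (norm (\<phi> x)) + ennreal \<epsilon> * indicator W x"
    proof (cases "\<phi> x = 0")
      case False
      then have "x \<in> W" using W Cc_in_support[of \<phi> x] by blast
      then show ?thesis using False \<epsilon> by simp
    qed simp
    finally show "(\<Sum>k<N0. ennreal \<epsilon> * indicator (E k) x) \<le> ennreal (norm (\<phi> x)) + ennreal \<epsilon> * indicator W x" .
  qed
  also have "\<dots> = (\<integral>\<^sup>+x. ennreal (norm (\<phi> x)) \<partial>?V) + ennreal \<epsilon> * emeasure ?V W"
    using W borel_measurable_continuous_onI[OF cont]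
    by (subst nn_integral_add) (auto simp: nn_integral_cmult_indicator borel_measurable_TV)
  finally have "ennreal (norm (\<mu> \<phi>)) \<le> ennreal \<epsilon> * emeasure ?V W +
    ((\<integral>\<^sup>+x. ennreal (norm (\<phi> x)) \<partial>?V) + ennreal \<epsilon> * emeasure ?V W)" by (simp add: add_left_mono)
  also have "\<dots> = (\<integral>\<^sup>+x. ennreal (norm (\<phi> x)) \<partial>?V) + ennreal (2 * \<epsilon>) * emeasure ?V W"
  proof -
    have "ennreal (2 * \<epsilon>) = ennreal \<epsilon> + ennreal \<epsilon>" 
      using \<epsilon> by (simp add: ennreal_plus[symmetric] del: ennreal_plus)
    then show ?thesis by (simp add: distrib_right add_ac)
  qed
  finally show ?thesis .
qed

text \<open>With a fixed \<open>W\<close> of finite variation the error in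
  \<open>norm_\<mu>_le_layers\<close> tends to 0 with the layer thickness. This is the continuity of
  \<mu> for the L1-seminorm on which the extension of \<mu> beyond \<open>Cc\<close> rests.\<close>

lemma norm_\<mu>_le:
  assumes \<phi>: "\<phi> \<in> Cc"
  shows "ennreal (norm (\<mu> \<phi>)) \<le> (\<integral>\<^sup>+x. ennreal (norm (\<phi> x)) \<partial>total_variation \<mu>)"
proof (rule ennreal_le_epsilon)
  fix e :: real assume e: "0 < e"
  obtain W where W: "open W" "closure {x. \<phi> x \<noteq> 0} \<subseteq> W" "compact (closure W)"
    by (rule lc_compact_between[OF lc Cc_support[OF \<phi>], of UNIV]) auto
  have fin: "emeasure (total_variation \<mu>) W < \<infinity>"
    using variation_open_finite[OF W(3)] W(1) by (simp add: emeasure_total_variation_open)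
  then obtain v where v: "0 \<le> v" "emeasure (total_variation \<mu>) W = ennreal v"
    by (cases "emeasure (total_variation \<mu>) W" rule: ennreal_cases) auto
  define \<epsilon> where "\<epsilon> = e / (2 * (v + 1))"
  have \<epsilon>: "0 < \<epsilon>" using e v by (simp add: \<epsilon>_def)
  have "2 * \<epsilon> * v \<le> e" using e v by (simp add: \<epsilon>_def field_simps)
  then have "ennreal (2 * \<epsilon>) * emeasure (total_variation \<mu>) W \<le> ennreal e"
    using v \<epsilon> by (simp add: ennreal_mult[symmetric] ennreal_leI del: ennreal_mult)
  then show "ennreal (norm (\<mu> \<phi>)) \<le> (\<integral>\<^sup>+x. ennreal (norm (\<phi> x)) \<partial>total_variation \<mu>) + ennreal e"
    using norm_\<mu>_le_layers[OF \<phi> W(1,2) \<epsilon>] by (meson add_left_mono order_trans)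
qed

lemma nn_integral_norm_triangle:
  assumes "f \<in> borel_measurable borel" "g \<in> borel_measurable borel" "h \<in> borel_measurable borel"
  shows "(\<integral>\<^sup>+x. ennreal (norm (f x - h x :: complex)) \<partial>total_variation \<mu>) \<le>
    (\<integral>\<^sup>+x. ennreal (norm (f x - g x)) \<partial>total_variation \<mu>) +
    (\<integral>\<^sup>+x. ennreal (norm (g x - h x)) \<partial>total_variation \<mu>)"
proof -
  have "(\<integral>\<^sup>+x. ennreal (norm (f x - h x)) \<partial>total_variation \<mu>) \<le>
    (\<integral>\<^sup>+x. ennreal (norm (f x - g x)) + ennreal (norm (g x - h x)) \<partial>total_variation \<mu>)"
  proof (rule nn_integral_mono)
    fix x
    have "norm (f x - h x) \<le> norm (f x - g x) + norm (g x - h x)"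
      using norm_triangle_ineq[of "f x - g x" "g x - h x"] by simp
    then show "ennreal (norm (f x - h x)) \<le> ennreal (norm (f x - g x)) + ennreal (norm (g x - h x))"
      by (simp add: ennreal_plus[symmetric] ennreal_leI del: ennreal_plus)
  qed
  also have "\<dots> = (\<integral>\<^sup>+x. ennreal (norm (f x - g x)) \<partial>total_variation \<mu>) +
    (\<integral>\<^sup>+x. ennreal (norm (g x - h x)) \<partial>total_variation \<mu>)"
    using assms by (intro nn_integral_add) (auto simp: borel_measurable_TV)
  finally show ?thesis .
qed

section \<open>Linearity, continuity and existence of the extended integral\<close>

lemma Cc_measurable: "\<phi> \<in> Cc \<Longrightarrow> \<phi> \<in> borel_measurable borel"
  by (rule borel_measurable_continuous_onI) (rule Cc_continuous)

lemma has_radon_integral_measurable: "has_radon_integral \<mu> f c \<Longrightarrow> f \<in> borel_measurable borel"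
  by (simp add: has_radon_integral_def)

lemma has_radon_integral_Cc: "\<phi> \<in> Cc \<Longrightarrow> has_radon_integral \<mu> \<phi> (\<mu> \<phi>)"
  unfolding has_radon_integral_def using Cc_measurable by (auto intro!: bexI[of _ \<phi>])

lemma has_radon_integral_cong:
  "has_radon_integral \<mu> f c \<Longrightarrow> (\<And>x. f x = g x) \<Longrightarrow> has_radon_integral \<mu> g c"
  by (metis ext)

lemma has_radon_integral_add:
  assumes "has_radon_integral \<mu> f c" "has_radon_integral \<mu> g d"
  shows "has_radon_integral \<mu> (\<lambda>x. f x + g x) (c + d)"
  unfolding has_radon_integral_def
proof (intro conjI allI impI)
  have m: "f \<in> borel_measurable borel" "g \<in> borel_measurable borel"
    using assms by (auto dest: has_radon_integral_measurable)
  then show "(\<lambda>x. f x + g x) \<in> borel_measurable borel" by simp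
  fix \<epsilon> :: real assume "0 < \<epsilon>"
  then have e: "0 < \<epsilon>/2" by simp
  obtain \<phi> where \<phi>: "\<phi> \<in> Cc" "(\<integral>\<^sup>+ x. ennreal (norm (f x - \<phi> x)) \<partial>total_variation \<mu>) < ennreal (\<epsilon>/2)"
      "norm (\<mu> \<phi> - c) < \<epsilon>/2"
    using assms(1) e unfolding has_radon_integral_def by meson
  obtain \<psi> where \<psi>: "\<psi> \<in> Cc" "(\<integral>\<^sup>+ x. ennreal (norm (g x - \<psi> x)) \<partial>total_variation \<mu>) < ennreal (\<epsilon>/2)"
      "norm (\<mu> \<psi> - d) < \<epsilon>/2"
    using assms(2) e unfolding has_radon_integral_def by meson
  have "(\<integral>\<^sup>+ x. ennreal (norm (f x + g x - (\<phi> x + \<psi> x))) \<partial>total_variation \<mu>) \<le>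
      (\<integral>\<^sup>+ x. ennreal (norm (f x + g x - (\<phi> x + g x))) \<partial>total_variation \<mu>) +
      (\<integral>\<^sup>+ x. ennreal (norm (\<phi> x + g x - (\<phi> x + \<psi> x))) \<partial>total_variation \<mu>)"
    using m \<phi>(1)[THEN Cc_measurable] \<psi>(1)[THEN Cc_measurable] by (intro nn_integral_norm_triangle) auto
  also have "\<dots> < ennreal (\<epsilon>/2) + ennreal (\<epsilon>/2)"
    using \<phi> \<psi> by (intro add_strict_mono) auto
  also have "\<dots> = ennreal \<epsilon>" using \<open>0 < \<epsilon>\<close> by (simp add: ennreal_plus[symmetric] del: ennreal_plus)
  finally have 1: "(\<integral>\<^sup>+ x. ennreal (norm (f x + g x - (\<phi> x + \<psi> x))) \<partial>total_variation \<mu>) < ennreal \<epsilon>" .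
  have "norm (\<mu> (\<lambda>x. \<phi> x + \<psi> x) - (c + d)) = norm ((\<mu> \<phi> - c) + (\<mu> \<psi> - d))"
    using \<phi>(1) \<psi>(1) by (simp add: \<mu>_add algebra_simps)
  also have "\<dots> \<le> norm (\<mu> \<phi> - c) + norm (\<mu> \<psi> - d)" by (rule norm_triangle_ineq)
  also have "\<dots> < \<epsilon>" using \<phi> \<psi> by simp
  finally have 2: "norm (\<mu> (\<lambda>x. \<phi> x + \<psi> x) - (c + d)) < \<epsilon>" .
  show "\<exists>\<phi>\<in>Cc. (\<integral>\<^sup>+ x. ennreal (norm (f x + g x - \<phi> x)) \<partial>total_variation \<mu>) < ennreal \<epsilon> \<and>
      norm (\<mu> \<phi> - (c + d)) < \<epsilon>"
    by (rule bexI[of _ "\<lambda>x. \<phi> x + \<psi> x"]) (use 1 2 \<phi> \<psi> Cc_add in auto)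
qed

lemma has_radon_integral_scale:
  assumes "has_radon_integral \<mu> f c"
  shows "has_radon_integral \<mu> (\<lambda>x. a * f x) (a * c)"
proof (cases "a = 0")
  case True
  then show ?thesis using has_radon_integral_Cc[OF Cc_zero] by (simp add: \<mu>_zero)
next
  case False
  show ?thesis
    unfolding has_radon_integral_def
  proof (intro conjI allI impI)
    have m: "f \<in> borel_measurable borel"
      using assms by (auto dest: has_radon_integral_measurable)
    then show "(\<lambda>x. a * f x) \<in> borel_measurable borel" by simp
    fix \<epsilon> :: real assume "0 < \<epsilon>"
    then have e: "0 < \<epsilon> / norm a" using False by simp
    obtain \<phi> where \<phi>: "\<phi> \<in> Cc" "(\<integral>\<^sup>+ x. ennreal (norm (f x - \<phi> x)) \<partial>total_variation \<mu>) < ennreal (\<epsilon> / norm a)"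
        "norm (\<mu> \<phi> - c) < \<epsilon> / norm a"
      using assms(1) e unfolding has_radon_integral_def by meson
    have "(\<integral>\<^sup>+ x. ennreal (norm (a * f x - a * \<phi> x)) \<partial>total_variation \<mu>) =
        (\<integral>\<^sup>+ x. ennreal (norm a) * ennreal (norm (f x - \<phi> x)) \<partial>total_variation \<mu>)"
      by (simp add: right_diff_distrib[symmetric] norm_mult ennreal_mult)
    also have "\<dots> = ennreal (norm a) * (\<integral>\<^sup>+ x. ennreal (norm (f x - \<phi> x)) \<partial>total_variation \<mu>)"
      using m \<phi>(1)[THEN Cc_measurable] by (intro nn_integral_cmult) (auto simp: borel_measurable_TV)
    also have "\<dots> < ennreal (norm a) * ennreal (\<epsilon> / norm a)"
      using \<phi> False by (intro ennreal_mult_strict_left_mono) auto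
    also have "\<dots> = ennreal \<epsilon>" using False \<open>0 < \<epsilon>\<close> by (simp add: ennreal_mult[symmetric])
    finally have 1: "(\<integral>\<^sup>+ x. ennreal (norm (a * f x - a * \<phi> x)) \<partial>total_variation \<mu>) < ennreal \<epsilon>" .
    have "norm (\<mu> (\<lambda>x. a * \<phi> x) - a * c) = norm a * norm (\<mu> \<phi> - c)"
      using \<phi> by (simp add: \<mu>_scale right_diff_distrib[symmetric] norm_mult)
    also have "\<dots> < \<epsilon>" using \<phi>(3) False by (simp add: field_simps)
    finally have 2: "norm (\<mu> (\<lambda>x. a * \<phi> x) - a * c) < \<epsilon>" .
    show "\<exists>\<phi>\<in>Cc. (\<integral>\<^sup>+ x. ennreal (norm (a * f x - \<phi> x)) \<partial>total_variation \<mu>) < ennreal \<epsilon> \<and>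
        norm (\<mu> \<phi> - a * c) < \<epsilon>"
      by (rule bexI[of _ "\<lambda>x. a * \<phi> x"]) (use 1 2 \<phi> Cc_scale in auto)
  qed
qed

lemma has_radon_integral_diff:
  assumes "has_radon_integral \<mu> f c" "has_radon_integral \<mu> g d"
  shows "has_radon_integral \<mu> (\<lambda>x. f x - g x) (c - d)"
  using has_radon_integral_add[OF assms(1) has_radon_integral_scale[OF assms(2), of "-1"]] by simp

lemma has_radon_integral_sum:
  assumes "\<And>i. i \<in> I \<Longrightarrow> has_radon_integral \<mu> (f i) (c i)"
  shows "has_radon_integral \<mu> (\<lambda>x. \<Sum>i\<in>I. f i x) (\<Sum>i\<in>I. c i)"
  using assms
proof (induction I rule: infinite_finite_induct)
  case (insert i I)
  then show ?case
    using has_radon_integral_add[of "f i" "c i" "\<lambda>x. \<Sum>i\<in>I. f i x" "\<Sum>i\<in>I. c i"] by simp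
qed (use has_radon_integral_Cc[OF Cc_zero] in \<open>simp_all add: \<mu>_zero\<close>)

text \<open>L1-approximation carries \<open>norm_\<mu>_le\<close> from \<open>Cc\<close> to every
  function that has an integral.\<close>

lemma has_radon_integral_bound:
  assumes "has_radon_integral \<mu> f c"
  shows "ennreal (norm c) \<le> (\<integral>\<^sup>+ x. ennreal (norm (f x)) \<partial>total_variation \<mu>)"
proof (rule ennreal_le_epsilon)
  fix e :: real assume "0 < e"
  then have e: "0 < e/2" by simp
  obtain \<phi> where \<phi>: "\<phi> \<in> Cc" "(\<integral>\<^sup>+ x. ennreal (norm (f x - \<phi> x)) \<partial>total_variation \<mu>) < ennreal (e/2)"
      "norm (\<mu> \<phi> - c) < e/2"
    using assms(1) e unfolding has_radon_integral_def by meson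
  have m: "f \<in> borel_measurable borel" "\<phi> \<in> borel_measurable borel"
    using assms \<phi> by (auto dest: has_radon_integral_measurable Cc_measurable)
  have "norm c \<le> norm (\<mu> \<phi>) + e/2"
    using norm_triangle_ineq2[of c "\<mu> \<phi>"] \<phi>(3) by (simp add: norm_minus_commute)
  then have "ennreal (norm c) \<le> ennreal (norm (\<mu> \<phi>)) + ennreal (e/2)"
    using e by (simp add: ennreal_plus[symmetric] ennreal_leI del: ennreal_plus)
  also have "ennreal (norm (\<mu> \<phi>)) \<le> (\<integral>\<^sup>+ x. ennreal (norm (\<phi> x - 0)) \<partial>total_variation \<mu>)"
    using norm_\<mu>_le[OF \<phi>(1)] by simp
  also have "\<dots> \<le> (\<integral>\<^sup>+ x. ennreal (norm (\<phi> x - f x)) \<partial>total_variation \<mu>) +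
      (\<integral>\<^sup>+ x. ennreal (norm (f x - 0)) \<partial>total_variation \<mu>)"
    using m by (intro nn_integral_norm_triangle) auto
  also have "(\<integral>\<^sup>+ x. ennreal (norm (\<phi> x - f x)) \<partial>total_variation \<mu>) \<le> ennreal (e/2)"
    using \<phi>(2) by (simp add: norm_minus_commute)
  finally have "ennreal (norm c) \<le> ennreal (e/2) + (\<integral>\<^sup>+ x. ennreal (norm (f x - 0)) \<partial>total_variation \<mu>) + ennreal (e/2)"
    by (simp add: add_right_mono)
  also have "\<dots> = (\<integral>\<^sup>+ x. ennreal (norm (f x)) \<partial>total_variation \<mu>) + ennreal e"
  proof -
    have "ennreal e = ennreal (e/2) + ennreal (e/2)"
      using e by (simp add: ennreal_plus[symmetric] del: ennreal_plus)
    then show ?thesis by (simp add: add_ac)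
  qed
  finally show "ennreal (norm c) \<le> (\<integral>\<^sup>+ x. ennreal (norm (f x)) \<partial>total_variation \<mu>) + ennreal e" .
qed

text \<open>The difference of the two values is an integral of the zero function, which the bound
  forces to be 0.\<close>

lemma has_radon_integral_unique:
  assumes "has_radon_integral \<mu> f c" "has_radon_integral \<mu> f d"
  shows "c = d"
  using has_radon_integral_bound[OF has_radon_integral_diff[OF assms]] by simp

lemma radon_integral_eqI: "has_radon_integral \<mu> f c \<Longrightarrow> radon_integral \<mu> f = c"
  unfolding radon_integral_def by (rule the_equality) (auto intro: has_radon_integral_unique)

lemma radon_integral_Cc: "\<phi> \<in> Cc \<Longrightarrow> radon_integral \<mu> \<phi> = \<mu> \<phi>"
  by (intro radon_integral_eqI has_radon_integral_Cc)

text \<open>By \<open>norm_\<mu>_le\<close>, an approximating sequence for the L1-seminorm is mapped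
  by \<mu> to a Cauchy sequence; its limit is the integral.\<close>

lemma has_radon_integral_exists:
  assumes f: "f \<in> borel_measurable borel"
    and "\<And>\<epsilon>. 0 < \<epsilon> \<Longrightarrow> \<exists>\<phi>\<in>Cc. (\<integral>\<^sup>+ x. ennreal (norm (f x - \<phi> x)) \<partial>total_variation \<mu>) < ennreal \<epsilon>"
  shows "\<exists>c. has_radon_integral \<mu> f c"
proof -
  have "\<exists>\<phi>. \<phi> \<in> Cc \<and> (\<integral>\<^sup>+ x. ennreal (norm (f x - \<phi> x)) \<partial>total_variation \<mu>) < ennreal (inverse (real (Suc n)))" for n
    using assms(2)[of "inverse (real (Suc n))"] by auto
  then obtain \<phi> where \<phi>: "\<And>n. \<phi> n \<in> Cc"
    "\<And>n. (\<integral>\<^sup>+ x. ennreal (norm (f x - \<phi> n x)) \<partial>total_variation \<mu>) < ennreal (inverse (real (Suc n)))"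
    by metis
  have near: "norm (\<mu> (\<phi> m) - \<mu> (\<phi> n)) \<le> inverse (real (Suc m)) + inverse (real (Suc n))" for m n
  proof -
    have "ennreal (norm (\<mu> (\<phi> m) - \<mu> (\<phi> n))) = ennreal (norm (\<mu> (\<lambda>x. \<phi> m x - \<phi> n x)))"
      using \<phi> by (simp add: \<mu>_diff)
    also have "\<dots> \<le> (\<integral>\<^sup>+ x. ennreal (norm (\<phi> m x - \<phi> n x)) \<partial>total_variation \<mu>)"
      using \<phi> by (intro norm_\<mu>_le Cc_diff)
    also have "\<dots> \<le> (\<integral>\<^sup>+ x. ennreal (norm (\<phi> m x - f x)) \<partial>total_variation \<mu>) +
        (\<integral>\<^sup>+ x. ennreal (norm (f x - \<phi> n x)) \<partial>total_variation \<mu>)"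
      using f \<phi>(1)[THEN Cc_measurable] by (intro nn_integral_norm_triangle) auto
    also have "\<dots> \<le> ennreal (inverse (real (Suc m))) + ennreal (inverse (real (Suc n)))"
      using \<phi>(2)[of m] \<phi>(2)[of n] by (intro add_mono) (simp_all add: norm_minus_commute)
    also have "\<dots> = ennreal (inverse (real (Suc m)) + inverse (real (Suc n)))"
      by (rule ennreal_plus[symmetric]) auto
    finally show ?thesis by (subst (asm) ennreal_le_iff) auto
  qed
  have "Cauchy (\<lambda>n. \<mu> (\<phi> n))"
  proof (rule metric_CauchyI)
    fix e :: real assume "0 < e"
    then obtain M where M: "inverse (real (Suc M)) < e/2"
      using reals_Archimedean[of "e/2"] by auto
    show "\<exists>M. \<forall>m\<ge>M. \<forall>n\<ge>M. dist (\<mu> (\<phi> m)) (\<mu> (\<phi> n)) < e"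
    proof (intro exI[of _ M] allI impI)
      fix m n assume mn: "M \<le> m" "M \<le> n"
      have "inverse (real (Suc m)) \<le> inverse (real (Suc M))" "inverse (real (Suc n)) \<le> inverse (real (Suc M))"
        using mn by (auto intro!: le_imp_inverse_le)
      with near[of m n] M show "dist (\<mu> (\<phi> m)) (\<mu> (\<phi> n)) < e"
        unfolding dist_norm by linarith
    qed
  qed
  then obtain c where c: "(\<lambda>n. \<mu> (\<phi> n)) \<longlonglongrightarrow> c"
    using Cauchy_convergent_iff convergent_def by blast
  have "has_radon_integral \<mu> f c"
    unfolding has_radon_integral_def
  proof (intro conjI allI impI f)
    fix e :: real assume "0 < e"
    have "\<forall>\<^sub>F n in sequentially. norm (\<mu> (\<phi> n) - c) < e"
      using tendstoD[OF c \<open>0 < e\<close>] by (simp add: dist_norm)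
    moreover have "\<forall>\<^sub>F n in sequentially. inverse (real (Suc n)) < e"
      using order_tendstoD(2)[OF LIMSEQ_inverse_real_of_nat \<open>0 < e\<close>] .
    ultimately have "\<forall>\<^sub>F n in sequentially. norm (\<mu> (\<phi> n) - c) < e \<and> inverse (real (Suc n)) < e"
      by (rule eventually_conj)
    then obtain n where n: "norm (\<mu> (\<phi> n) - c) < e" "inverse (real (Suc n)) < e"
      using eventually_happens'[OF sequentially_bot] by blast
    have "(\<integral>\<^sup>+ x. ennreal (norm (f x - \<phi> n x)) \<partial>total_variation \<mu>) < ennreal (inverse (real (Suc n)))"
      by (rule \<phi>)
    also have "\<dots> \<le> ennreal e" using n by (intro ennreal_leI) simp
    finally show "\<exists>\<phi>\<in>Cc. (\<integral>\<^sup>+ x. ennreal (norm (f x - \<phi> x)) \<partial>total_variation \<mu>) < ennreal e \<and> norm (\<mu> \<phi> - c) < e"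
      using n \<phi>(1) by blast
  qed
  then show ?thesis by blast
qed

text \<open>Inner regularity on \<open>A\<close> read off from the definition as a supremum: the
  compact support of a nearly optimal test function carries all of the variation of \<open>A\<close>
  up to \<open>e\<close>, and a cutoff inside \<open>A\<close> equals 1 there.\<close>

lemma inner_bump:
  assumes A: "open A" "compact (closure A)" and e: "0 < e"
  shows "\<exists>\<eta>\<in>Cc. (\<forall>x. x \<notin> A \<longrightarrow> \<eta> x = 0) \<and> (\<forall>x. norm (1 - \<eta> x) \<le> 1) \<and>
    emeasure (total_variation \<mu>) {x\<in>A. \<eta> x \<noteq> 1} < ennreal e"
proof -
  let ?V = "total_variation \<mu>"
  let ?S = "{\<psi>\<in>Cc. closure {x. \<psi> x \<noteq> 0} \<subseteq> A \<and> (\<forall>x. norm (\<psi> x) \<le> 1)}"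
  have ne: "?S \<noteq> {}"
  proof -
    have "(\<lambda>x. 0) \<in> ?S" using Cc_zero by simp
    then show ?thesis by blast
  qed
  have finA: "variation_open \<mu> A < \<infinity>" by (rule variation_open_finite[OF A(2)])
  then have "\<exists>\<psi>\<in>?S. variation_open \<mu> A < ennreal (norm (\<mu> \<psi>)) + ennreal e"
    using e by (intro SUP_approx_ennreal[OF _ ne variation_open_def]) auto
  then obtain \<psi> where \<psi>: "\<psi> \<in> Cc" "closure {x. \<psi> x \<noteq> 0} \<subseteq> A" "\<forall>x. norm (\<psi> x) \<le> 1"
    "variation_open \<mu> A < ennreal (norm (\<mu> \<psi>)) + ennreal e" by blast
  let ?K = "closure {x. \<psi> x \<noteq> 0}"
  have K: "compact ?K" using \<psi>(1) by (rule Cc_support)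
  have Kb: "?K \<in> sets borel" by (intro borel_closed) simp
  \<comment> \<open>Every open set containing the support of \<psi> admits \<psi> as a competitor,
    so the support itself already carries the mass \<open>norm (\<mu> \<psi>)\<close>.\<close>
  have "ennreal (norm (\<mu> \<psi>)) \<le> outer_variation ?K"
    unfolding outer_variation_def using \<psi> by (intro INF_greatest variation_open_upper) auto
  then have muK: "ennreal (norm (\<mu> \<psi>)) \<le> emeasure ?V ?K"
    by (simp add: emeasure_total_variation[OF Kb])
  obtain h :: "'a \<Rightarrow> real" and W where h: "continuous_on UNIV h" "\<And>x. 0 \<le> h x" "\<And>x. h x \<le> 1"
    "open W" "?K \<subseteq> W" "\<And>x. x \<in> W \<Longrightarrow> h x = 1"
    "compact (closure {x. h x \<noteq> 0})" "closure {x. h x \<noteq> 0} \<subseteq> A"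
    by (rule lc_bump[OF lc K A(1) \<psi>(2)]) blast
  define \<eta> where "\<eta> = (\<lambda>x. complex_of_real (h x))"
  have hA: "h x = 0" if "x \<notin> A" for x
    using that h(8) closure_subset[of "{x. h x \<noteq> 0}"] by blast
  show ?thesis
  proof (intro bexI[of _ \<eta>] conjI allI impI)
    show "\<eta> \<in> Cc"
      unfolding \<eta>_def Cc_def using h by (auto intro: continuous_intros)
    show "\<eta> x = 0" if "x \<notin> A" for x using hA[OF that] by (simp add: \<eta>_def)
    show "norm (1 - \<eta> x) \<le> 1" for x
    proof -
      have "1 - \<eta> x = complex_of_real (1 - h x)" by (simp add: \<eta>_def)
      then show ?thesis unfolding \<open>1 - \<eta> x = _\<close> norm_of_real using h(2,3)[of x] by simp
    qed
    have "{x\<in>A. \<eta> x \<noteq> 1} \<subseteq> A - ?K" using h(5,6) by (auto simp: \<eta>_def)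
    then have "emeasure ?V {x\<in>A. \<eta> x \<noteq> 1} \<le> emeasure ?V (A - ?K)"
      using A Kb by (intro emeasure_mono) auto
    also have "\<dots> = emeasure ?V A - emeasure ?V ?K"
      using A Kb \<psi>(2) emeasure_total_variation_compact[OF K]
      by (intro emeasure_Diff) auto
    also have "\<dots> < ennreal e"
    proof -
      have VA: "emeasure ?V A = variation_open \<mu> A" using A by (simp add: emeasure_total_variation_open)
      have "emeasure ?V A < emeasure ?V ?K + ennreal e"
        using \<psi>(4) muK unfolding VA by (meson add_right_mono less_le_trans)
      moreover obtain a where "0 \<le> a" "emeasure ?V A = ennreal a"
        using finA VA by (cases "emeasure ?V A" rule: ennreal_cases) auto
      moreover obtain k where "0 \<le> k" "emeasure ?V ?K = ennreal k"
        using emeasure_total_variation_compact[OF K] by (cases "emeasure ?V ?K" rule: ennreal_cases) auto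
      ultimately show ?thesis
        using e by (cases "k \<le> a")
          (simp_all add: ennreal_minus ennreal_plus[symmetric] ennreal_less_iff ennreal_neg del: ennreal_plus)
    qed
    finally show "emeasure ?V {x\<in>A. \<eta> x \<noteq> 1} < ennreal e" .
  qed
qed

text \<open>With \<eta> from \<open>inner_bump\<close>, the function \<open>\<eta> x * g x\<close>
  is in \<open>Cc\<close> and differs from the integrand only on a subset of \<open>A\<close> of
  small variation, by at most the maximum of \<open>norm (g x)\<close> over the compact closure.
  Naming \<open>radon_integral\<close> as the value says that the integral exists, which covers
  restrictions to \<open>A n\<close> and Fourier-Bohr integrals.\<close>

lemma has_radon_integral_open:
  assumes A: "open A" "compact (closure A)" and g: "continuous_on UNIV g"
  shows "has_radon_integral \<mu> (\<lambda>x. indicator A x * g x) (radon_integral \<mu> (\<lambda>x. indicator A x * g x))"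
proof -
  let ?V = "total_variation \<mu>"
  have gm: "g \<in> borel_measurable borel" using g by (rule borel_measurable_continuous_onI)
  have "compact (g ` closure A)"
    using g A by (intro compact_continuous_image) (auto intro: continuous_on_subset)
  then obtain B where B: "0 < B" "\<forall>y\<in>g ` closure A. norm y \<le> B"
    using bounded_pos compact_imp_bounded by metis
  have "\<exists>c. has_radon_integral \<mu> (\<lambda>x. indicator A x * g x) c"
  proof (rule has_radon_integral_exists)
    show "(\<lambda>x. indicator A x * g x) \<in> borel_measurable borel"
      using gm A by (intro borel_measurable_times borel_measurable_indicator) auto
    fix \<epsilon> :: real assume \<epsilon>: "0 < \<epsilon>"
    then have "0 < \<epsilon> / B" using B by simp
    from inner_bump[OF A this] obtain \<eta> :: "'a \<Rightarrow> complex" where \<eta>: "\<eta> \<in> Cc" "\<forall>x. x \<notin> A \<longrightarrow> \<eta> x = 0"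
      "\<forall>x. norm (1 - \<eta> x) \<le> 1" "emeasure ?V {x\<in>A. \<eta> x \<noteq> 1} < ennreal (\<epsilon> / B)"
      by blast
    have D: "{x\<in>A. \<eta> x \<noteq> 1} \<in> sets borel"
    proof -
      have "open (A \<inter> {x. \<eta> x \<noteq> 1})"
        using A(1) Cc_continuous[OF \<eta>(1)] by (intro open_Int open_Collect_neq) auto
      moreover have "A \<inter> {x. \<eta> x \<noteq> 1} = {x\<in>A. \<eta> x \<noteq> 1}" by auto
      ultimately show ?thesis by auto
    qed
    have "(\<integral>\<^sup>+ x. ennreal (norm (indicator A x * g x - \<eta> x * g x)) \<partial>?V) \<le>
        (\<integral>\<^sup>+ x. ennreal B * indicator {x\<in>A. \<eta> x \<noteq> 1} x \<partial>?V)"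
    proof (rule nn_integral_mono)
      fix x
      show "ennreal (norm (indicator A x * g x - \<eta> x * g x)) \<le> ennreal B * indicator {x\<in>A. \<eta> x \<noteq> 1} x"
      proof (cases "x \<in> A \<and> \<eta> x \<noteq> 1")
        case True
        then have "norm (g x) \<le> B" using B closure_subset[of A] by blast
        have "indicator A x * g x - \<eta> x * g x = (1 - \<eta> x) * g x"
          using True by (simp add: algebra_simps)
        then have "norm (indicator A x * g x - \<eta> x * g x) \<le> 1 * B"
          unfolding \<open>_ = (1 - \<eta> x) * g x\<close> norm_mult using \<eta>(3) \<open>norm (g x) \<le> B\<close> by (intro mult_mono) auto
        then show ?thesis using True by (simp add: ennreal_leI)
      next
        case False
        then show ?thesis using \<eta>(2)[rule_format, of x] by (cases "x \<in> A") auto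
      qed
    qed
    also have "\<dots> = ennreal B * emeasure ?V {x\<in>A. \<eta> x \<noteq> 1}"
      using D by (simp add: nn_integral_cmult_indicator)
    also have "\<dots> < ennreal B * ennreal (\<epsilon> / B)"
      using \<eta>(4) B by (intro ennreal_mult_strict_left_mono) auto
    also have "\<dots> = ennreal \<epsilon>" using B \<epsilon> by (simp add: ennreal_mult[symmetric])
    finally show "\<exists>\<phi>\<in>Cc. (\<integral>\<^sup>+ x. ennreal (norm (indicator A x * g x - \<phi> x)) \<partial>?V) < ennreal \<epsilon>"
      using Cc_mult_right[OF \<eta>(1) g] by (intro bexI[of _ "\<lambda>x. \<eta> x * g x"]) auto
  qed
  then show ?thesis using radon_integral_eqI by blast
qed

section \<open>Restriction to a relatively compact open set\<close>

lemma emeasure_TV_open_finite: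
  "open A \<Longrightarrow> compact (closure A) \<Longrightarrow> emeasure (total_variation \<mu>) A < \<infinity>"
  using variation_open_finite[of A] by (simp add: emeasure_total_variation_open)

text \<open>The finite number |\<mu>|(A) serves as the constant for every compact
  \<open>K\<close>.\<close>

lemma radon_measure_restrict:
  assumes A: "open A" "compact (closure A)"
  shows "radon_measure (restrict_radon \<mu> A)"
  unfolding radon_measure_def
proof (intro conjI ballI allI impI)
  note H = has_radon_integral_open[OF A Cc_continuous]
  show "restrict_radon \<mu> A (\<lambda>x. \<phi> x + \<psi> x) = restrict_radon \<mu> A \<phi> + restrict_radon \<mu> A \<psi>"
    if "\<phi> \<in> Cc" "\<psi> \<in> Cc" for \<phi> \<psi>
    unfolding restrict_radon_def
    by (rule radon_integral_eqI, rule has_radon_integral_cong[OF has_radon_integral_add[OF H[OF that(1)] H[OF that(2)]]])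
      (simp add: algebra_simps)
  show "restrict_radon \<mu> A (\<lambda>x. c * \<phi> x) = c * restrict_radon \<mu> A \<phi>" if "\<phi> \<in> Cc" for c \<phi>
    unfolding restrict_radon_def
    by (rule radon_integral_eqI, rule has_radon_integral_cong[OF has_radon_integral_scale[OF H[OF that]]])
      (simp add: algebra_simps)
  fix K :: "'a set"
  obtain v where v: "0 \<le> v" "emeasure (total_variation \<mu>) A = ennreal v"
    using emeasure_TV_open_finite[OF A] by (cases "emeasure (total_variation \<mu>) A" rule: ennreal_cases) auto
  have "norm (restrict_radon \<mu> A \<phi>) \<le> v * (SUP x. norm (\<phi> x))" if \<phi>: "\<phi> \<in> Cc" for \<phi>
  proof -
    obtain B where B: "0 < B" "\<forall>x. norm (\<phi> x) \<le> B" using Cc_bounded[OF \<phi>] by blast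
    define S where "S = (SUP x. norm (\<phi> x))"
    have S: "norm (\<phi> x) \<le> S" for x
      unfolding S_def using B(2) by (intro cSUP_upper) (auto intro!: bdd_aboveI)
    have S0: "0 \<le> S" using S norm_ge_zero order_trans by blast
    have "ennreal (norm (restrict_radon \<mu> A \<phi>)) \<le> (\<integral>\<^sup>+ x. ennreal (norm (indicator A x * \<phi> x)) \<partial>total_variation \<mu>)"
      unfolding restrict_radon_def by (rule has_radon_integral_bound[OF H[OF \<phi>]])
    also have "\<dots> \<le> (\<integral>\<^sup>+ x. ennreal S * indicator A x \<partial>total_variation \<mu>)"
      using S by (intro nn_integral_mono) (auto simp: indicator_def intro!: ennreal_leI)
    also have "\<dots> = ennreal (v * S)"
      using A v S0 by (simp add: nn_integral_cmult_indicator ennreal_mult[symmetric] mult.commute)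
    finally show ?thesis unfolding S_def[symmetric] using v S0 by (subst (asm) ennreal_le_iff) auto
  qed
  then show "\<exists>C\<ge>0. \<forall>\<phi>\<in>Cc. {x. \<phi> x \<noteq> 0} \<subseteq> K \<longrightarrow> norm (restrict_radon \<mu> A \<phi>) \<le> C * (SUP x. norm (\<phi> x))"
    using v by blast
qed

end

section \<open>Topological groups\<close>

lemma compact_sums_group:
  fixes K L :: "'a::{t2_space, topological_ab_group_add} set"
  assumes "compact K" "compact L"
  shows "compact {a + b | a b. a \<in> K \<and> b \<in> L}"
proof -
  have "compact ((\<lambda>p. fst p + snd p) ` (K \<times> L))"
    using assms by (intro compact_continuous_image compact_Times continuous_intros)
  moreover have "(\<lambda>p. fst p + snd p) ` (K \<times> L) = {a + b | a b. a \<in> K \<and> b \<in> L}" by force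
  ultimately show ?thesis by simp
qed

lemma compact_diffs_group:
  fixes K L :: "'a::{t2_space, topological_ab_group_add} set"
  assumes "compact K" "compact L"
  shows "compact {a - b | a b. a \<in> K \<and> b \<in> L}"
proof -
  have "compact ((\<lambda>p. fst p - snd p) ` (K \<times> L))"
    using assms by (intro compact_continuous_image compact_Times continuous_intros)
  moreover have "(\<lambda>p. fst p - snd p) ` (K \<times> L) = {a - b | a b. a \<in> K \<and> b \<in> L}" by force
  ultimately show ?thesis by simp
qed

lemma translate_eq_vimage: "(+) t ` B = {x. x - t \<in> (B :: 'a::ab_group_add set)}"
  by (force simp: image_iff algebra_simps)

lemma open_translate [simp]:
  fixes U :: "'a::{t2_space, topological_ab_group_add} set"
  assumes "open U"
  shows "open ((+) t ` U)"
proof -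
  have "open ((\<lambda>x. x - t) -` U)"
    using assms by (intro open_vimage) (auto intro!: continuous_intros)
  then show ?thesis by (simp add: translate_eq_vimage vimage_def)
qed

lemma compact_translate:
  fixes K :: "'a::{t2_space, topological_ab_group_add} set"
  assumes "compact K"
  shows "compact ((+) t ` K)"
  using assms by (intro compact_continuous_image continuous_intros) auto

text \<open>The tube lemma, with one factor reduced to a point.\<close>

lemma tube_nbhd:
  fixes x :: "'a::topological_space" and C :: "'b::topological_space set"
  assumes "compact C" "open W" "\<And>c. c \<in> C \<Longrightarrow> (x, c) \<in> W"
  shows "\<exists>U. open U \<and> x \<in> U \<and> (\<forall>u\<in>U. \<forall>c\<in>C. (u, c) \<in> W)"
proof -
  have "\<exists>U V. open U \<and> open V \<and> x \<in> U \<and> c \<in> V \<and> U \<times> V \<subseteq> W" if "c \<in> C" for c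
    using open_prod_elim[OF assms(2) assms(3)[OF that]] by (metis mem_Sigma_iff)
  then obtain U V where UV: "\<And>c. c \<in> C \<Longrightarrow> open (U c) \<and> open (V c) \<and> x \<in> U c \<and> c \<in> V c \<and> U c \<times> V c \<subseteq> W"
    by metis
  obtain F where F: "F \<subseteq> C" "finite F" "C \<subseteq> (\<Union>c\<in>F. V c)"
  proof (rule compactE_image[OF assms(1), of C V])
    show "C \<subseteq> (\<Union>c\<in>C. V c)" using UV by blast
  qed (use UV in auto)
  show ?thesis
  proof (intro exI[of _ "\<Inter>c\<in>F. U c"] conjI ballI)
    show "open (\<Inter>c\<in>F. U c)" using F UV by (intro open_INT) blast+
    show "x \<in> (\<Inter>c\<in>F. U c)" using F UV by blast
    show "(u, c) \<in> W" if "u \<in> (\<Inter>c\<in>F. U c)" "c \<in> C" for u c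
      using F UV that by blast
  qed
qed

text \<open>A point \<open>y\<close> lies outside iff \<open>y + k\<close> misses \<open>C\<close>
  for all \<open>k\<close> in \<open>K\<close>, and by the tube lemma this persists near
  \<open>y\<close>. Van Hove boundaries and inner boundaries become Borel sets through this
  fact.\<close>

lemma closed_diffs_compact:
  fixes C K :: "'a::{t2_space, topological_ab_group_add} set"
  assumes "closed C" "compact K"
  shows "closed {x - k | x k. x \<in> C \<and> k \<in> K}"
proof -
  have "open (- {x - k | x k. x \<in> C \<and> k \<in> K})"
  proof (subst open_subopen, intro ballI)
    fix y assume "y \<in> - {x - k | x k. x \<in> C \<and> k \<in> K}"
    then have y: "\<nexists>x k. y = x - k \<and> x \<in> C \<and> k \<in> K" by blast
    have "open ((\<lambda>p. fst p + snd p) -` (- C))"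
      using assms(1) by (intro open_vimage) (auto intro!: continuous_intros)
    then obtain U where U: "open U" "y \<in> U" "\<forall>u\<in>U. \<forall>k\<in>K. u + k \<notin> C"
      using tube_nbhd[OF assms(2), of "(\<lambda>p. fst p + snd p) -` (- C)" y] y
      by (force simp: algebra_simps)
    have "U \<subseteq> - {x - k | x k. x \<in> C \<and> k \<in> K}"
      using U(3) by (force simp: algebra_simps)
    then show "\<exists>T. open T \<and> y \<in> T \<and> T \<subseteq> - {x - k | x k. x \<in> C \<and> k \<in> K}"
      using U by blast
  qed
  then show ?thesis by (simp add: closed_def)
qed

text \<open>Uniform continuity for the translation uniformity, spelled out through neighbourhoods of
  0 because the group carries no metric.\<close>

definition ucont :: "('a::{t2_space, topological_ab_group_add} \<Rightarrow> complex) \<Rightarrow> bool" where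
  "ucont f \<longleftrightarrow> (\<forall>\<epsilon>>0. \<exists>U. open U \<and> 0 \<in> U \<and> (\<forall>x. \<forall>u\<in>U. norm (f (x + u) - f x) \<le> \<epsilon>))"

lemma ucont_continuous:
  assumes "ucont f"
  shows "continuous_on UNIV f"
  unfolding continuous_on_def
proof (intro ballI tendstoI)
  fix x :: 'a and e :: real assume "0 < e"
  then have "0 < e/2" by simp
  then obtain U where U: "open U" "0 \<in> U" "\<forall>x. \<forall>u\<in>U. norm (f (x + u) - f x) \<le> e/2"
    using assms unfolding ucont_def by blast
  have "((\<lambda>y. y - x) \<longlongrightarrow> x - x) (at x)" by (intro tendsto_intros)
  then have "\<forall>\<^sub>F y in at x. y - x \<in> U"
    using topological_tendstoD[of _ "x - x" "at x" U] U by simp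
  then show "\<forall>\<^sub>F y in at x within UNIV. dist (f y) (f x) < e"
  proof eventually_elim
    case (elim y)
    then have "norm (f (x + (y - x)) - f x) \<le> e/2" using U(3) by blast
    then show ?case using \<open>0 < e\<close> by (simp add: dist_norm)
  qed
qed

text \<open>The tube lemma over the compact support gives one neighbourhood of 0 for all base points
  in the support. Making it symmetric allows \<open>x\<close> and \<open>x + u\<close> to change
  roles when only \<open>x + u\<close> lies in the support.\<close>

lemma Cc_ucont:
  fixes \<phi> :: "'a::{t2_space, topological_ab_group_add} \<Rightarrow> complex"
  assumes "\<phi> \<in> Cc"
  shows "ucont \<phi>"
  unfolding ucont_def
proof (intro allI impI)
  fix e :: real assume "0 < e"
  let ?S = "closure {x. \<phi> x \<noteq> 0}"
  let ?W = "{p. norm (\<phi> (snd p + fst p) - \<phi> (snd p)) < e}"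
  have c: "continuous_on UNIV (\<lambda>p::'a \<times> 'a. \<phi> (g p))" if "continuous_on UNIV g" for g
    using continuous_on_compose2[OF Cc_continuous[OF assms] that] by simp
  have "open ?W"
    by (intro open_Collect_less continuous_on_norm continuous_on_diff continuous_on_const c)
      (auto intro!: continuous_intros)
  then obtain U where U: "open U" "0 \<in> U" "\<forall>u\<in>U. \<forall>x\<in>?S. (u, x) \<in> ?W"
    using tube_nbhd[OF Cc_support[OF assms], of ?W 0] \<open>0 < e\<close> by auto
  define U' where "U' = U \<inter> uminus -` U"
  have "open (uminus -` U)" using U by (intro open_vimage) (auto intro!: continuous_intros)
  then have "open U'" "0 \<in> U'" using U by (auto simp: U'_def)
  moreover have "norm (\<phi> (x + u) - \<phi> x) \<le> e" if "u \<in> U'" for x u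
  proof (cases "x \<in> ?S")
    case True
    then show ?thesis using U(3) that by (force simp: U'_def)
  next
    case False
    then have 0: "\<phi> x = 0" using Cc_in_support[of \<phi> x] by blast
    show ?thesis
    proof (cases "x + u \<in> ?S")
      case True
      then have "norm (\<phi> ((x + u) + - u) - \<phi> (x + u)) < e"
        using U(3) that by (force simp: U'_def)
      then show ?thesis using 0 by simp
    next
      case False
      then have "\<phi> (x + u) = 0" using Cc_in_support[of \<phi> "x + u"] by blast
      then show ?thesis using 0 \<open>0 < e\<close> by simp
    qed
  qed
  ultimately show "\<exists>U. open U \<and> 0 \<in> U \<and> (\<forall>x. \<forall>u\<in>U. norm (\<phi> (x + u) - \<phi> x) \<le> e)" by blast
qed

lemma Cc_compose_translate:
  fixes \<phi> :: "'a::{t2_space, topological_ab_group_add} \<Rightarrow> complex"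
  assumes "\<phi> \<in> Cc"
  shows "(\<lambda>s. \<phi> (s - t)) \<in> Cc"
proof (rule Cc_I[OF _ compact_translate[OF Cc_support[OF assms]], of _ t])
  show "continuous_on UNIV (\<lambda>s. \<phi> (s - t))"
    by (rule continuous_on_compose2[OF Cc_continuous[OF assms]]) (auto intro!: continuous_intros)
  show "s \<in> (+) t ` closure {x. \<phi> x \<noteq> 0}" if "\<phi> (s - t) \<noteq> 0" for s
    using Cc_in_support[of \<phi> "s - t"] that by (simp add: translate_eq_vimage)
qed

lemma Cc_compose_uminus:
  fixes \<phi> :: "'a::{t2_space, topological_ab_group_add} \<Rightarrow> complex"
  assumes "\<phi> \<in> Cc"
  shows "(\<lambda>s. \<phi> (- s)) \<in> Cc"
proof (rule Cc_I)
  show "continuous_on UNIV (\<lambda>s. \<phi> (- s))"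
    by (rule continuous_on_compose2[OF Cc_continuous[OF assms]]) (auto intro!: continuous_intros)
  show "compact (uminus ` closure {x. \<phi> x \<noteq> 0})"
    using Cc_support[OF assms] by (intro compact_continuous_image continuous_intros) auto
  show "s \<in> uminus ` closure {x. \<phi> x \<noteq> 0}" if "\<phi> (- s) \<noteq> 0" for s
    using Cc_in_support[of \<phi> "- s"] that by (intro image_eqI[of _ _ "- s"]) auto
qed

section \<open>Haar measure\<close>

locale lc_haar =
  fixes haar :: "'a::{t2_space, topological_ab_group_add} measure"
  assumes lc: "locally_compact_space (euclidean :: 'a topology)"
    and haar: "haar_measure haar"
begin

lemma sets_haar [simp, measurable_cong]: "sets haar = sets borel"
  using haar by (simp add: haar_measure_def)

lemma space_haar [simp]: "space haar = UNIV"
  by (metis sets_eq_imp_space_eq sets_haar space_borel)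

lemma emeasure_translate: "B \<in> sets borel \<Longrightarrow> emeasure haar ((+) t ` B) = emeasure haar B"
  using haar by (simp add: haar_measure_def)

lemma emeasure_compact: "compact K \<Longrightarrow> emeasure haar K < \<infinity>"
  using haar by (simp add: haar_measure_def)

lemma emeasure_rel_compact: "compact (closure U) \<Longrightarrow> emeasure haar U < \<infinity>"
  using emeasure_compact[of "closure U"] emeasure_mono[OF closure_subset[of U], of haar]
  by (simp add: le_less_trans)

lemma measurable_translate: "(\<lambda>x. t + x) \<in> measurable haar haar"
proof -
  have "(\<lambda>x::'a. t + x) \<in> borel_measurable borel"
    by (intro borel_measurable_continuous_onI continuous_intros)
  then show ?thesis by (simp cong: measurable_cong_sets)
qed

lemma distr_translate: "distr haar haar (\<lambda>x. t + x) = haar"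
proof (rule measure_eqI)
  fix B assume "B \<in> sets (distr haar haar (\<lambda>x. t + x))"
  then have B: "B \<in> sets borel" by simp
  have "(\<lambda>x. t + x) -` B = (+) (- t) ` B" by (force simp: translate_eq_vimage add.commute)
  then have "emeasure (distr haar haar (\<lambda>x. t + x)) B = emeasure haar ((+) (- t) ` B)"
    using B measurable_translate by (subst emeasure_distr) simp_all
  then show "emeasure (distr haar haar (\<lambda>x. t + x)) B = emeasure haar B"
    using B by (simp only: emeasure_translate)
qed simp

lemma nn_integral_translate:
  assumes "f \<in> borel_measurable borel"
  shows "(\<integral>\<^sup>+x. f (t + x) \<partial>haar) = (\<integral>\<^sup>+x. f x \<partial>haar)"
proof -
  have "f \<in> borel_measurable (distr haar haar (\<lambda>x. t + x))"
    using assms by (simp cong: measurable_cong_sets)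
  from nn_integral_distr[OF measurable_translate this] show ?thesis
    by (simp add: distr_translate)
qed

lemma integral_translate:
  fixes f :: "'a \<Rightarrow> 'b::{banach, second_countable_topology}"
  assumes "f \<in> borel_measurable borel"
  shows "(\<integral>x. f (t + x) \<partial>haar) = (\<integral>x. f x \<partial>haar)"
proof -
  have "f \<in> borel_measurable haar"
    using assms by (simp cong: measurable_cong_sets)
  from integral_distr[OF measurable_translate this] show ?thesis
    by (simp add: distr_translate)
qed

text \<open>A compact set is covered by finitely many translates of \<open>U\<close>. If
  \<open>U\<close> were null, all compact sets would be null, and inner regularity of the whole
  group would make the Haar measure vanish.\<close>

lemma emeasure_open_pos:
  assumes "open U" "U \<noteq> {}"
  shows "emeasure haar U \<noteq> 0"
proof
  assume 0: "emeasure haar U = 0"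
  have "emeasure haar UNIV = (SUP K\<in>{K. compact K \<and> K \<subseteq> UNIV}. emeasure haar K)"
    using haar open_UNIV unfolding haar_measure_def by blast
  moreover have "emeasure haar K = 0" if K: "compact K" for K
  proof -
    obtain u where u: "u \<in> U" using assms by blast
    obtain F where F: "F \<subseteq> K" "finite F" "K \<subseteq> (\<Union>t\<in>F. (+) (t - u) ` U)"
    proof (rule compactE_image[OF K, of K "\<lambda>t. (+) (t - u) ` U"])
      show "K \<subseteq> (\<Union>t\<in>K. (+) (t - u) ` U)" using u by (force simp: translate_eq_vimage)
    qed (use assms in simp_all)
    have "emeasure haar K \<le> emeasure haar (\<Union>t\<in>F. (+) (t - u) ` U)"
      using F assms by (intro emeasure_mono) auto
    also have "\<dots> \<le> (\<Sum>t\<in>F. emeasure haar ((+) (t - u) ` U))"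
      using F assms by (intro emeasure_subadditive_finite) auto
    also have "\<dots> = 0" using assms 0 by (simp add: emeasure_translate)
    finally show ?thesis by simp
  qed
  ultimately have "emeasure haar UNIV \<le> 0"
    by (simp only:) (rule SUP_least, simp)
  then show False using haar by (simp add: haar_measure_def)
qed

lemma packing:
  assumes U: "U \<in> sets borel" and X: "finite X" "disjoint_family_on (\<lambda>x. (+) x ` U) X"
    and tr: "\<And>x. (+) x ` U \<in> sets borel"
    and Z: "Z \<in> sets borel" "\<And>x. x \<in> X \<Longrightarrow> (+) x ` U \<subseteq> Z"
  shows "of_nat (card X) * emeasure haar U \<le> emeasure haar Z"
proof -
  have "of_nat (card X) * emeasure haar U = (\<Sum>x\<in>X. emeasure haar ((+) x ` U))"
    using U by (simp add: emeasure_translate)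
  also have "\<dots> = emeasure haar (\<Union>x\<in>X. (+) x ` U)"
    using X tr by (intro sum_emeasure) auto
  also have "\<dots> \<le> emeasure haar Z" using Z by (intro emeasure_mono) auto
  finally show ?thesis .
qed

text \<open>A packing by translates of \<open>U\<close> of maximal cardinality covers after enlarging \<open>U\<close> to \<open>U - U\<close>.\<close>

lemma ex_packing_cover:
  fixes U :: "'a set"
  assumes U: "open U" "0 \<in> U" "compact (closure U)" and B: "B \<subseteq> L" "compact L"
  shows "\<exists>X. finite X \<and> X \<subseteq> B \<and> disjoint_family_on (\<lambda>x. (+) x ` U) X \<and>
    B \<subseteq> (\<Union>x\<in>X. (+) x ` {u - v | u v. u \<in> U \<and> v \<in> U})"
proof -
  let ?Z = "{a + b | a b. a \<in> L \<and> b \<in> closure U}"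
  have Z: "compact ?Z" using B U by (intro compact_sums_group)
  obtain z where z: "0 \<le> z" "emeasure haar ?Z = ennreal z"
    using emeasure_compact[OF Z] by (cases "emeasure haar ?Z" rule: ennreal_cases) auto
  obtain u where u: "0 \<le> u" "emeasure haar U = ennreal u"
    using emeasure_rel_compact[OF U(3)] by (cases "emeasure haar U" rule: ennreal_cases) auto
  have u0: "0 < u" using emeasure_open_pos[of U] U u by (cases "u = 0") auto
  define P where "P = (\<lambda>X. finite X \<and> X \<subseteq> B \<and> disjoint_family_on (\<lambda>x. (+) x ` U) X)"
  \<comment> \<open>Disjoint translates of \<open>U\<close> based in \<open>B\<close> all lie in the
    compact set \<open>L + closure U\<close>, so at most \<open>z / u\<close> of them fit. Hence a
    packing of maximal cardinality exists.\<close>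
  have bound: "card X < nat \<lceil>z / u\<rceil> + 1" if "P X" for X
  proof -
    have "of_nat (card X) * emeasure haar U \<le> emeasure haar ?Z"
    proof (rule packing)
      show "(+) x ` U \<subseteq> ?Z" if "x \<in> X" for x
        using that \<open>P X\<close> B closure_subset[of U] unfolding P_def by blast
    qed (use that Z U in \<open>auto simp: P_def intro: borel_open borel_closed compact_imp_closed\<close>)
    then have "real (card X) * u \<le> z"
      unfolding u z ennreal_of_nat_eq_real_of_nat using u z
      by (simp add: ennreal_mult[symmetric])
    then have "real (card X) \<le> z / u" using u0 by (simp add: field_simps)
    then show ?thesis by linarith
  qed
  have "P {}" by (simp add: P_def disjoint_family_on_def)
  from ex_has_greatest_nat[of P, OF this, of card] bound
  obtain X where X: "P X" "\<And>Y. P Y \<Longrightarrow> card Y \<le> card X" by blast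
  have "B \<subseteq> (\<Union>x\<in>X. (+) x ` {u - v | u v. u \<in> U \<and> v \<in> U})"
  proof
    fix b assume b: "b \<in> B"
    have "\<exists>x\<in>X. (+) x ` U \<inter> (+) b ` U \<noteq> {}"
    proof (cases "b \<in> X")
      case True
      then show ?thesis using U(2) by blast
    next
      case False
      then have "\<not> P (insert b X)" using X(2)[of "insert b X"] X(1) by (auto simp: P_def)
      then show ?thesis using X(1) b False
        by (auto simp: P_def disjoint_family_on_insert)
    qed
    then obtain x u v where "x \<in> X" "u \<in> U" "v \<in> U" "x + u = b + v" by (auto 0 3)
    then have "b = x + (u - v)" by (simp add: algebra_simps)
    then show "b \<in> (\<Union>x\<in>X. (+) x ` {u - v | u v. u \<in> U \<and> v \<in> U})"
      using \<open>x \<in> X\<close> \<open>u \<in> U\<close> \<open>v \<in> U\<close> by blast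
  qed
  then show ?thesis using X(1) unfolding P_def by blast
qed

end

section \<open>Comparison of the total variation with Haar measure\<close>

locale tb_radon = lc_haar haar + lc_radon \<mu>
  for haar :: "'a::{t2_space, topological_ab_group_add} measure" and \<mu> :: "('a \<Rightarrow> complex) \<Rightarrow> complex" +
  assumes tb: "translation_bounded \<mu>"
begin

text \<open>Finitely many translates of the set \<open>V\<close> from the definition cover
  \<open>L\<close>, and the same number of them covers each translate of \<open>L\<close>.\<close>

lemma TV_translate_bound:
  assumes L: "compact L"
  shows "\<exists>C\<ge>0. \<forall>t. emeasure (total_variation \<mu>) ((+) t ` L) \<le> ennreal C"
proof -
  obtain V where V: "open V" "V \<noteq> {}" "(SUP t. emeasure (total_variation \<mu>) ((+) t ` V)) < \<infinity>"
    using tb unfolding translation_bounded_def by blast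
  define s where "s = (SUP t. emeasure (total_variation \<mu>) ((+) t ` V))"
  obtain r where r: "0 \<le> r" "s = ennreal r"
    using V(3) unfolding s_def[symmetric] by (cases s rule: ennreal_cases) auto
  obtain v where v: "v \<in> V" using V by blast
  obtain F where F: "F \<subseteq> L" "finite F" "L \<subseteq> (\<Union>x\<in>F. (+) (x - v) ` V)"
  proof (rule compactE_image[OF L, of L "\<lambda>x. (+) (x - v) ` V"])
    show "L \<subseteq> (\<Union>x\<in>L. (+) (x - v) ` V)" using v by (force simp: translate_eq_vimage)
  qed (use V in simp_all)
  have "emeasure (total_variation \<mu>) ((+) t ` L) \<le> ennreal (real (card F) * r)" for t
  proof -
    have "(+) t ` L \<subseteq> (\<Union>x\<in>F. (+) (t + (x - v)) ` V)"
      using F(3) by (force simp: translate_eq_vimage algebra_simps)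
    then have "emeasure (total_variation \<mu>) ((+) t ` L) \<le> emeasure (total_variation \<mu>) (\<Union>x\<in>F. (+) (t + (x - v)) ` V)"
      using F V by (intro emeasure_mono) auto
    also have "\<dots> \<le> (\<Sum>x\<in>F. emeasure (total_variation \<mu>) ((+) (t + (x - v)) ` V))"
      using F V by (intro emeasure_subadditive_finite) auto
    also have "\<dots> \<le> (\<Sum>x\<in>F. s)"
      unfolding s_def by (intro sum_mono SUP_upper) auto
    also have "\<dots> = ennreal (real (card F) * r)"
      using r by (simp add: ennreal_mult ennreal_of_nat_eq_real_of_nat)
    finally show ?thesis .
  qed
  then show ?thesis using r by (intro exI[of _ "real (card F) * r"]) auto
qed

text \<open>Packaged as a predicate to make visible that \<open>C\<close> and \<open>E\<close> are
  fixed before \<open>B\<close>, \<open>Z\<close>, \<open>f\<close>, \<open>H\<close> and \<delta>,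
  hence do not depend on the index of an averaging sequence. The case of constant \<open>f\<close>
  and \<delta> with \<open>H\<close> zero gives bounds for masses; the case \<delta> zero compares
  integrals. \<open>Z\<close> has to contain \<open>B + E\<close> because the covering sets protrude
  from \<open>B\<close>.\<close>

definition TV_estimate :: "'a set \<Rightarrow> real \<Rightarrow> 'a set \<Rightarrow> bool" where
  "TV_estimate U C E \<longleftrightarrow> (\<forall>B Z f H \<delta>. B \<in> sets borel \<longrightarrow> (\<exists>L. compact L \<and> B \<subseteq> L) \<longrightarrow>
    Z \<in> sets borel \<longrightarrow> (\<forall>b\<in>B. \<forall>e\<in>E. b + e \<in> Z) \<longrightarrow>
    f \<in> borel_measurable borel \<longrightarrow> H \<in> borel_measurable borel \<longrightarrow>
    (\<forall>t\<in>B. f t \<le> \<delta> + (\<integral>\<^sup>+x. H x * indicator ((+) t ` U) x \<partial>haar)) \<longrightarrow>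
    (\<integral>\<^sup>+t. f t * indicator B t \<partial>total_variation \<mu>) \<le>
      ennreal C * (\<delta> * emeasure haar Z + (\<integral>\<^sup>+x. H x * indicator Z x \<partial>haar)))"

lemma TV_estimateD:
  assumes "TV_estimate U C E" "B \<in> sets borel" "\<exists>L. compact L \<and> B \<subseteq> L" "Z \<in> sets borel"
    "\<forall>b\<in>B. \<forall>e\<in>E. b + e \<in> Z" "f \<in> borel_measurable borel" "H \<in> borel_measurable borel"
    "\<forall>t\<in>B. f t \<le> \<delta> + (\<integral>\<^sup>+x. H x * indicator ((+) t ` U) x \<partial>haar)"
  shows "(\<integral>\<^sup>+t. f t * indicator B t \<partial>total_variation \<mu>) \<le>
    ennreal C * (\<delta> * emeasure haar Z + (\<integral>\<^sup>+x. H x * indicator Z x \<partial>haar))"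
  using assms unfolding TV_estimate_def by simp

text \<open>Integrals against the total variation are compared with Haar integrals through a cover whose
  overlaps are bounded, so that Fubini's theorem for the two measures is not needed.\<close>

lemma TV_cover_estimate:
  assumes U: "open U" "0 \<in> U" "compact (closure U)"
  shows "\<exists>C\<ge>0. \<exists>E. compact E \<and> TV_estimate U C E"
proof -
  let ?V = "total_variation \<mu>"
  \<comment> \<open>The sets are chosen for three inclusions: translates of \<open>D\<close> at
    packing points cover; \<open>t\<close> in \<open>x + D\<close> gives \<open>t + U\<close> inside
    \<open>x + E\<close>; and \<open>y\<close> in \<open>x + E\<close> gives \<open>x + U\<close>
    inside \<open>y + G\<close>.\<close>
  define D where "D = {a - b | a b. a \<in> closure U \<and> b \<in> closure U}"
  define E where "E = {a + b | a b. a \<in> D \<and> b \<in> closure U}"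
  define G where "G = {a - b | a b. a \<in> closure U \<and> b \<in> E}"
  have D: "compact D" unfolding D_def using U by (intro compact_diffs_group)
  have E: "compact E" unfolding E_def using U D by (intro compact_sums_group)
  have G: "compact G" unfolding G_def using U E by (intro compact_diffs_group)
  have clU: "U \<subseteq> closure U" by (rule closure_subset)
  have D0: "0 \<in> D" using U(2) clU unfolding D_def by force
  \<comment> \<open>Places the packing translates \<open>x + U\<close> with \<open>x\<close> in
    \<open>B\<close> inside \<open>Z\<close>, so that \<open>Z\<close> bounds their number.\<close>
  have UE: "U \<subseteq> E" using clU D0 unfolding E_def by force
  obtain c where c: "0 \<le> c" "\<forall>t. emeasure ?V ((+) t ` D) \<le> ennreal c"
    using TV_translate_bound[OF D] by blast
  obtain u where u: "0 \<le> u" "emeasure haar U = ennreal u"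
    using emeasure_rel_compact[OF U(3)] by (cases "emeasure haar U" rule: ennreal_cases) auto
  have u0: "0 < u" using emeasure_open_pos[of U] U u by (cases "u = 0") auto
  obtain g where g: "0 \<le> g" "emeasure haar G = ennreal g"
    using emeasure_compact[OF G] by (cases "emeasure haar G" rule: ennreal_cases) auto
  \<comment> \<open>Here \<open>c\<close> bounds the variation of one covering set,
    \<open>1 / u\<close> is the number of packing points per unit of Haar measure of
    \<open>Z\<close>, and \<open>g / u\<close> bounds the overlap of the sets \<open>x + E\<close>.
    The sum \<open>1 + g\<close> serves both counts at once.\<close>
  define C where "C = c * ((1 + g) / u)"
  have bc: "K \<in> sets borel" if "compact K" for K :: "'a set"
    using that by (intro borel_closed compact_imp_closed)
  have card_le: "of_nat (card X) \<le> ennreal (1 / u) * emeasure haar Z"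
    if "finite X" "disjoint_family_on (\<lambda>x. (+) x ` U) X" "Z \<in> sets borel" "\<And>x. x \<in> X \<Longrightarrow> (+) x ` U \<subseteq> Z" for X Z
  proof -
    have "of_nat (card X) = ennreal (1 / u) * (of_nat (card X) * emeasure haar U)"
      unfolding u ennreal_of_nat_eq_real_of_nat using u0 by (simp add: ennreal_mult[symmetric])
    also have "\<dots> \<le> ennreal (1 / u) * emeasure haar Z"
      using that U by (intro mult_left_mono packing) auto
    finally show ?thesis .
  qed
  have main: "(\<integral>\<^sup>+t. f t * indicator B t \<partial>?V) \<le> ennreal C * (\<delta> * emeasure haar Z + (\<integral>\<^sup>+x. H x * indicator Z x \<partial>haar))"
    if B: "B \<in> sets borel" "\<exists>L. compact L \<and> B \<subseteq> L" and Z: "Z \<in> sets borel" "\<forall>b\<in>B. \<forall>e\<in>E. b + e \<in> Z"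
      and f: "f \<in> borel_measurable borel" and H: "H \<in> borel_measurable borel"
      and fH: "\<forall>t\<in>B. f t \<le> \<delta> + (\<integral>\<^sup>+x. H x * indicator ((+) t ` U) x \<partial>haar)" for B Z f H \<delta>
  proof -
    obtain L where "compact L" "B \<subseteq> L" using B by blast
    from ex_packing_cover[OF U this(2,1)] obtain X where X: "finite X" "X \<subseteq> B"
      "disjoint_family_on (\<lambda>x. (+) x ` U) X" "B \<subseteq> (\<Union>x\<in>X. (+) x ` {u - v | u v. u \<in> U \<and> v \<in> U})"
      by blast
    have BX: "B \<subseteq> (\<Union>x\<in>X. (+) x ` D)"
    proof -
      have "{u - v | u v. u \<in> U \<and> v \<in> U} \<subseteq> D" using clU unfolding D_def by blast
      then have "(\<Union>x\<in>X. (+) x ` {u - v | u v. u \<in> U \<and> v \<in> U}) \<subseteq> (\<Union>x\<in>X. (+) x ` D)"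
        by (intro UN_mono image_mono order_refl)
      with X(4) show ?thesis by (rule order_trans)
    qed
    define h where "h = (\<lambda>x. \<integral>\<^sup>+y. H y * indicator ((+) x ` E) y \<partial>haar)"
    have tD: "(+) x ` D \<in> sets borel" "(+) x ` E \<in> sets borel" for x
      using D E by (auto intro!: bc compact_translate)
    have loc: "f t \<le> \<delta> + h x" if "t \<in> B" "t \<in> (+) x ` D" for t x
    proof -
      have "(+) t ` U \<subseteq> (+) x ` E"
        using that(2) clU unfolding E_def by (force simp: add.assoc)
      then have "(\<integral>\<^sup>+y. H y * indicator ((+) t ` U) y \<partial>haar) \<le> h x"
        unfolding h_def by (intro nn_integral_mono mult_left_mono) (auto simp: indicator_def)
      then show ?thesis using fH that(1) by (meson add_left_mono order_trans)
    qed
    have "(\<integral>\<^sup>+t. f t * indicator B t \<partial>?V) \<le> (\<integral>\<^sup>+t. (\<Sum>x\<in>X. (\<delta> + h x) * indicator ((+) x ` D) t) \<partial>?V)"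
    proof (rule nn_integral_mono)
      fix t
      show "f t * indicator B t \<le> (\<Sum>x\<in>X. (\<delta> + h x) * indicator ((+) x ` D) t)"
      proof (cases "t \<in> B")
        case True
        then obtain x where x: "x \<in> X" "t \<in> (+) x ` D" using BX by blast
        have "f t * indicator B t \<le> (\<delta> + h x) * indicator ((+) x ` D) t"
          using loc[OF True x(2)] True x by simp
        also have "\<dots> \<le> (\<Sum>x\<in>X. (\<delta> + h x) * indicator ((+) x ` D) t)"
          using X x by (intro member_le_sum) auto
        finally show ?thesis .
      qed simp
    qed
    also have "\<dots> = (\<Sum>x\<in>X. (\<delta> + h x) * emeasure ?V ((+) x ` D))"
      using tD by (subst nn_integral_sum) (auto simp: nn_integral_cmult_indicator borel_measurable_TV)
    also have "\<dots> \<le> (\<Sum>x\<in>X. (\<delta> + h x) * ennreal c)"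
      using c by (intro sum_mono mult_left_mono) auto
    also have "\<dots> = ennreal c * (\<delta> * of_nat (card X) + (\<Sum>x\<in>X. h x))"
      by (subst sum_distrib_right[symmetric]) (simp add: sum.distrib mult_ac)
    also have "\<dots> \<le> ennreal c * (ennreal ((1 + g) / u) * (\<delta> * emeasure haar Z + (\<integral>\<^sup>+x. H x * indicator Z x \<partial>haar)))"
    proof (rule mult_left_mono)
      have "of_nat (card X) \<le> ennreal (1 / u) * emeasure haar Z"
        using X Z UE by (intro card_le) (auto dest!: subsetD)
      also have "\<dots> \<le> ennreal ((1 + g) / u) * emeasure haar Z"
        using u0 g by (intro mult_right_mono ennreal_leI divide_right_mono) auto
      finally have 1: "\<delta> * of_nat (card X) \<le> ennreal ((1 + g) / u) * (\<delta> * emeasure haar Z)"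
        by (metis mult.left_commute mult_left_mono zero_le)
      have "(\<Sum>x\<in>X. h x) = (\<integral>\<^sup>+y. (\<Sum>x\<in>X. H y * indicator ((+) x ` E) y) \<partial>haar)"
        unfolding h_def using H tD by (intro nn_integral_sum[symmetric]) (auto simp: cong: measurable_cong_sets)
      also have "\<dots> \<le> (\<integral>\<^sup>+y. ennreal ((1 + g) / u) * (H y * indicator Z y) \<partial>haar)"
      proof (rule nn_integral_mono)
        fix y
        \<comment> \<open>The overlap at \<open>y\<close>: for these \<open>x\<close> the disjoint
          sets \<open>x + U\<close> all lie in \<open>y + G\<close>, so there are at most
          \<open>g / u\<close> of them.\<close>
        define X' where "X' = {x\<in>X. y \<in> (+) x ` E}"
        have X': "finite X'" "X' \<subseteq> X" using X by (auto simp: X'_def)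
        have "(\<Sum>x\<in>X. H y * indicator ((+) x ` E) y) = H y * of_nat (card X')"
        proof -
          have "(\<Sum>x\<in>X. H y * indicator ((+) x ` E) y) = H y * (\<Sum>x\<in>X. indicator ((+) x ` E) y)"
            by (simp add: sum_distrib_left)
          also have "(\<Sum>x\<in>X. indicator ((+) x ` E) y) = (\<Sum>x\<in>X'. 1 :: ennreal)"
            using X by (intro sum.mono_neutral_cong_right) (auto simp: X'_def indicator_def)
          finally show ?thesis by simp
        qed
        also have "\<dots> \<le> H y * (ennreal ((1 + g) / u) * indicator Z y)"
        proof (cases "X' = {}")
          case False
          then obtain x where x: "x \<in> X" "y \<in> (+) x ` E" by (auto simp: X'_def)
          then have yZ: "y \<in> Z" using X Z by blast
          have "of_nat (card X') \<le> ennreal (1 / u) * emeasure haar ((+) y ` G)"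
          proof (rule card_le[OF X'(1)])
            show "disjoint_family_on (\<lambda>x. (+) x ` U) X'"
              using X(3) X'(2) by (rule disjoint_family_on_mono[rotated])
            show "(+) y ` G \<in> sets borel" using G by (intro bc compact_translate)
            fix x assume "x \<in> X'"
            then obtain e where e: "e \<in> E" "y = x + e" by (auto simp: X'_def)
            show "(+) x ` U \<subseteq> (+) y ` G"
            proof
              fix z assume "z \<in> (+) x ` U"
              then obtain w where w: "w \<in> U" "z = x + w" by blast
              then have "w - e \<in> G" using e clU unfolding G_def by blast
              moreover have "z = y + (w - e)" using w e by simp
              ultimately show "z \<in> (+) y ` G" by blast
            qed
          qed
          also have "\<dots> = ennreal (1 / u) * ennreal g"
            using G by (simp add: emeasure_translate bc g)
          also have "\<dots> = ennreal (g / u)" using u0 g by (simp add: ennreal_mult[symmetric])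
          also have "\<dots> \<le> ennreal ((1 + g) / u)"
            using u0 g by (intro ennreal_leI divide_right_mono) auto
          finally show ?thesis using yZ by (intro mult_left_mono) auto
        qed simp
        finally show "(\<Sum>x\<in>X. H y * indicator ((+) x ` E) y) \<le> ennreal ((1 + g) / u) * (H y * indicator Z y)"
          by (simp add: mult_ac)
      qed
      also have "\<dots> = ennreal ((1 + g) / u) * (\<integral>\<^sup>+y. H y * indicator Z y \<partial>haar)"
        using H Z by (intro nn_integral_cmult) (auto cong: measurable_cong_sets)
      finally show "\<delta> * of_nat (card X) + (\<Sum>x\<in>X. h x) \<le>
          ennreal ((1 + g) / u) * (\<delta> * emeasure haar Z + (\<integral>\<^sup>+x. H x * indicator Z x \<partial>haar))"
        using 1 by (simp add: distrib_left add_mono)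
    qed simp
    also have "\<dots> = ennreal C * (\<delta> * emeasure haar Z + (\<integral>\<^sup>+x. H x * indicator Z x \<partial>haar))"
      unfolding C_def using c(1) u0 g(1) by (subst ennreal_mult) (simp_all add: mult.assoc)
    finally show ?thesis .
  qed
  have "0 \<le> C" using c u0 g by (simp add: C_def)
  moreover have "TV_estimate U C E" unfolding TV_estimate_def using main by simp
  ultimately show ?thesis using E by blast
qed

end

section \<open>Averages along a van Hove sequence\<close>

lemma closure_subset_compact:
  fixes S K :: "'a::t2_space set"
  assumes "S \<subseteq> K" "compact K"
  shows "compact (closure S)"
proof -
  have "closure S \<subseteq> K" using assms by (intro closure_minimal compact_imp_closed)
  then show ?thesis using assms(2) by (metis closed_closure compact_Int_closed inf.absorb2)
qed

text \<open>Compactness supplies both Borel measurability and finite Haar measure; the latter makes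
  the real-valued \<open>measure\<close> in \<open>van_Hove\<close> agree with
  \<open>emeasure\<close>.\<close>

lemma compact_van_Hove_boundary:
  fixes A K :: "'a::{t2_space, topological_ab_group_add} set"
  assumes A: "open A" "compact (closure A)" and K: "compact K"
  shows "compact (van_Hove_boundary K A)"
proof -
  have "{a + k | a k. a \<in> A \<and> k \<in> K} \<subseteq> {a + k | a k. a \<in> closure A \<and> k \<in> K}"
    using closure_subset[of A] by blast
  then have 1: "compact (closure {a + k | a k. a \<in> A \<and> k \<in> K})"
    using compact_sums_group[OF A(2) K] by (rule closure_subset_compact)
  have "closed {x - k | x k. x \<in> - A \<and> k \<in> K}"
    using A K by (intro closed_diffs_compact) auto
  then have "closed {x - k | x k. x \<notin> A \<and> k \<in> K}" by simp
  then have 2: "compact ({x - k | x k. x \<notin> A \<and> k \<in> K} \<inter> closure A)"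
    using A by (intro closed_Int_compact)
  show ?thesis
    unfolding van_Hove_boundary_def using 1 2 A(1) by (intro compact_Un compact_diff)
qed

lemma van_Hove_boundary_add:
  assumes "a \<in> A" "e \<in> E"
  shows "a + e \<in> A \<union> van_Hove_boundary E A"
proof -
  have "a + e \<in> closure {a + k | a k. a \<in> A \<and> k \<in> E}"
    using assms by (intro subsetD[OF closure_subset]) blast
  then show ?thesis unfolding van_Hove_boundary_def by blast
qed

text \<open>A point \<open>b + e\<close> in \<open>A\<close> equals \<open>(b + k) - (k - e)\<close>
  with \<open>b + k\<close> outside \<open>A\<close>, hence belongs to the inner part of the
  boundary for \<open>K - E\<close>; a point \<open>b + e\<close> outside \<open>A\<close> belongs
  to the outer part for \<open>E\<close>. This explains the enlarged compact set.\<close>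

lemma van_Hove_boundary_inner_add:
  assumes "b \<in> A" "k \<in> K" "b + k \<notin> A" "e \<in> E"
  shows "b + e \<in> van_Hove_boundary ({k - e | k e. k \<in> K \<and> e \<in> E} \<union> E) A"
proof (cases "b + e \<in> A")
  case True
  have "b + e = (b + k) - (k - e)" by simp
  moreover have "k - e \<in> {k - e | k e. k \<in> K \<and> e \<in> E} \<union> E" using assms by blast
  moreover have "b + e \<in> closure A" using True closure_subset[of A] by blast
  ultimately show ?thesis unfolding van_Hove_boundary_def using assms(3) by blast
next
  case False
  have "b + e \<in> closure {a + k | a k. a \<in> A \<and> k \<in> {k - e | k e. k \<in> K \<and> e \<in> E} \<union> E}"
    using assms by (intro subsetD[OF closure_subset]) blast
  then show ?thesis unfolding van_Hove_boundary_def using False by blast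
qed

lemma (in lc_haar) tb_radonI: "translation_bounded \<mu> \<Longrightarrow> tb_radon haar \<mu>"
  by unfold_locales (simp_all add: lc haar translation_bounded_def)

lemma (in lc_haar) ex_nbhd:
  "\<exists>N :: 'a set. open N \<and> 0 \<in> N \<and> compact (closure N)"
proof -
  obtain N :: "'a set" where "open N" "{0} \<subseteq> N" "compact (closure N)" "closure N \<subseteq> UNIV"
    by (rule lc_compact_between[OF lc compact_sing open_UNIV subset_UNIV])
  then show ?thesis by blast
qed

locale vh = lc_haar haar for haar :: "'a::{t2_space, topological_ab_group_add} measure" +
  fixes A :: "nat \<Rightarrow> 'a set"
  assumes vH: "van_Hove haar A"
begin

abbreviation m :: "nat \<Rightarrow> real" where "m n \<equiv> measure haar (A n)"

lemma averaging_sets: "open (A n)" "compact (closure (A n))" "0 < m n"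
  using vH by (auto simp: van_Hove_def)

lemma emeasure_A: "emeasure haar (A n) = ennreal (m n)"
  using emeasure_rel_compact[OF averaging_sets(2)] by (simp add: emeasure_eq_ennreal_measure less_top)

lemma A_subset_compact: "\<exists>L. compact L \<and> A n \<subseteq> L"
  using averaging_sets(2) closure_subset by blast

lemma boundary_sets: "compact K \<Longrightarrow> van_Hove_boundary K (A n) \<in> sets borel"
  using compact_van_Hove_boundary[OF averaging_sets(1,2)] by (intro borel_closed compact_imp_closed)

lemma eventually_boundary:
  assumes K: "compact K" and "0 < \<eta>"
  shows "\<forall>\<^sub>F n in sequentially. emeasure haar (van_Hove_boundary K (A n)) \<le> ennreal (\<eta> * m n)"
proof -
  have "(\<lambda>n. measure haar (van_Hove_boundary K (A n)) / m n) \<longlonglongrightarrow> 0"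
    using vH K by (simp add: van_Hove_def)
  then have "\<forall>\<^sub>F n in sequentially. measure haar (van_Hove_boundary K (A n)) / m n < \<eta>"
    using order_tendstoD(2) \<open>0 < \<eta>\<close> by fastforce
  then show ?thesis
  proof eventually_elim
    case (elim n)
    have "emeasure haar (van_Hove_boundary K (A n)) = ennreal (measure haar (van_Hove_boundary K (A n)))"
      using emeasure_compact[OF compact_van_Hove_boundary[OF averaging_sets(1,2) K]]
      by (simp add: emeasure_eq_ennreal_measure less_top)
    then show ?case using elim averaging_sets(3)[of n] by (simp add: ennreal_leI field_simps)
  qed
qed

text \<open>Multiplying out the positive \<open>m n\<close> gives the form in which the mass
  estimates arise and can be added.\<close>

lemma average_tendsto_0_iff:
  fixes x :: "nat \<Rightarrow> complex"
  shows "(\<lambda>n. complex_of_real (1 / m n) * x n) \<longlonglongrightarrow> 0 \<longleftrightarrow>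
    (\<forall>\<epsilon>>0. \<forall>\<^sub>F n in sequentially. norm (x n) \<le> \<epsilon> * m n)"
proof -
  have eq: "norm (complex_of_real (1 / m n) * x n) = norm (x n) / m n" for n
    using averaging_sets(3)[of n] by (simp add: norm_mult norm_divide)
  show ?thesis
  proof
    assume "(\<lambda>n. complex_of_real (1 / m n) * x n) \<longlonglongrightarrow> 0"
    then have *: "\<forall>\<^sub>F n in sequentially. norm (x n) / m n < \<epsilon>" if "0 < \<epsilon>" for \<epsilon>
      using that unfolding tendsto_iff dist_norm diff_zero eq by blast
    show "\<forall>\<epsilon>>0. \<forall>\<^sub>F n in sequentially. norm (x n) \<le> \<epsilon> * m n"
    proof (intro allI impI)
      fix \<epsilon> :: real assume "0 < \<epsilon>"
      from *[OF this] show "\<forall>\<^sub>F n in sequentially. norm (x n) \<le> \<epsilon> * m n"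
      proof eventually_elim
        case (elim n)
        then show ?case using averaging_sets(3)[of n] by (simp add: field_simps)
      qed
    qed
  next
    assume *: "\<forall>\<epsilon>>0. \<forall>\<^sub>F n in sequentially. norm (x n) \<le> \<epsilon> * m n"
    show "(\<lambda>n. complex_of_real (1 / m n) * x n) \<longlonglongrightarrow> 0"
    proof (rule tendstoI)
      fix \<epsilon> :: real assume "0 < \<epsilon>"
      then have "\<forall>\<^sub>F n in sequentially. norm (x n) \<le> \<epsilon> / 2 * m n"
        using *[rule_format, of "\<epsilon> / 2"] by simp
      then show "\<forall>\<^sub>F n in sequentially. dist (complex_of_real (1 / m n) * x n) 0 < \<epsilon>"
      proof eventually_elim
        case (elim n)
        have "norm (x n) < \<epsilon> * m n"
          using elim averaging_sets(3)[of n] \<open>0 < \<epsilon>\<close> mult_pos_pos[of \<epsilon> "m n"] by linarith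
        then show ?case
          unfolding dist_norm diff_zero eq using averaging_sets(3)[of n] by (simp add: field_simps)
      qed
    qed
  qed
qed

end

locale vh_radon = vh haar A + tb_radon haar \<nu>
  for haar :: "'a::{t2_space, topological_ab_group_add} measure" and A and \<nu>
begin

text \<open>\<open>TV_estimate\<close> with \<open>f\<close> and \<delta> equal to 1 and
  \<open>H\<close> equal to 0 bounds the mass by a multiple of the Haar measure of
  \<open>A n\<close> together with its boundary; the boundary eventually contributes at most
  \<open>m n\<close>, whence the factor 2.\<close>

lemma TV_A_le: "\<exists>C\<ge>0. \<forall>\<^sub>F n in sequentially. emeasure (total_variation \<nu>) (A n) \<le> ennreal (C * m n)"
proof -
  obtain N :: "'a set" where "open N" "0 \<in> N" "compact (closure N)" using ex_nbhd by blast
  from TV_cover_estimate[OF this] obtain C E where C: "0 \<le> C" "compact E" and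
    "TV_estimate N C E" by blast
  note est = TV_estimateD[OF this(3)]
  have "\<forall>\<^sub>F n in sequentially. emeasure haar (van_Hove_boundary E (A n)) \<le> ennreal (1 * m n)"
    using C by (intro eventually_boundary) auto
  then have "\<forall>\<^sub>F n in sequentially. emeasure (total_variation \<nu>) (A n) \<le> ennreal ((2 * C) * m n)"
  proof eventually_elim
    case (elim n)
    let ?Z = "A n \<union> van_Hove_boundary E (A n)"
    have "emeasure (total_variation \<nu>) (A n) = (\<integral>\<^sup>+t. 1 * indicator (A n) t \<partial>total_variation \<nu>)"
      using averaging_sets(1)[of n] by simp
    also have "\<dots> \<le> ennreal C * (1 * emeasure haar ?Z + (\<integral>\<^sup>+x. 0 * indicator ?Z x \<partial>haar))"
      using averaging_sets(1)[of n] boundary_sets[OF C(2), of n] van_Hove_boundary_add[of _ "A n" _ E]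
      by (intro est A_subset_compact) auto
    also have "\<dots> = ennreal C * emeasure haar ?Z" by simp
    also have "\<dots> \<le> ennreal C * (emeasure haar (A n) + emeasure haar (van_Hove_boundary E (A n)))"
      using averaging_sets(1)[of n] boundary_sets[OF C(2), of n] by (intro mult_left_mono emeasure_subadditive) auto
    also have "\<dots> \<le> ennreal C * (ennreal (m n) + ennreal (m n))"
      using elim by (intro mult_left_mono add_mono) (auto simp: emeasure_A)
    also have "\<dots> = ennreal ((2 * C) * m n)"
      using C averaging_sets(3)[of n] by (simp add: ennreal_plus[symmetric] ennreal_mult[symmetric] algebra_simps del: ennreal_plus)
    finally show ?case .
  qed
  with C show ?thesis by (intro exI[of _ "2 * C"]) auto
qed

text \<open>If \<phi> is supported in \<open>K\<close>, these are the only points \<open>t\<close>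
  of \<open>A n\<close> at which restricting \<mu> to \<open>A n\<close> can change the integral of
  \<phi>(s - t).\<close>

definition inner_boundary :: "'a set \<Rightarrow> nat \<Rightarrow> 'a set" where
  "inner_boundary K n = {t\<in>A n. \<exists>k\<in>K. t + k \<notin> A n}"

lemma inner_boundary_sets: "compact K \<Longrightarrow> inner_boundary K n \<in> sets borel"
proof -
  assume K: "compact K"
  have "closed {x - k | x k. x \<in> - A n \<and> k \<in> K}"
    using averaging_sets(1)[of n] K by (intro closed_diffs_compact) auto
  then have "A n \<inter> {x - k | x k. x \<in> - A n \<and> k \<in> K} \<in> sets borel"
    using averaging_sets(1)[of n] by (intro sets.Int borel_open borel_closed) auto
  moreover have "inner_boundary K n = A n \<inter> {x - k | x k. x \<in> - A n \<and> k \<in> K}"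
    unfolding inner_boundary_def by (force simp: algebra_simps)
  ultimately show ?thesis by simp
qed

text \<open>By \<open>van_Hove_boundary_inner_add\<close>, the inner boundary enlarged by
  \<open>E\<close> stays inside a van Hove boundary of \<open>A n\<close> for a larger compact set.
  \<open>TV_estimate\<close> then turns the negligible Haar measure of that boundary into negligible
  |\<nu>|-mass.\<close>

lemma TV_inner_boundary:
  assumes K: "compact K" and "0 < \<eta>"
  shows "\<forall>\<^sub>F n in sequentially. emeasure (total_variation \<nu>) (inner_boundary K n) \<le> ennreal (\<eta> * m n)"
proof -
  obtain N :: "'a set" where "open N" "0 \<in> N" "compact (closure N)" using ex_nbhd by blast
  from TV_cover_estimate[OF this] obtain C E where C: "0 \<le> C" "compact E" and
    "TV_estimate N C E" by blast
  note est = TV_estimateD[OF this(3)]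
  define K' where "K' = {k - e | k e. k \<in> K \<and> e \<in> E} \<union> E"
  have K': "compact K'" unfolding K'_def using K C by (intro compact_Un compact_diffs_group)
  have "0 < \<eta> / (C + 1)" using C \<open>0 < \<eta>\<close> by simp
  from eventually_boundary[OF K' this] show ?thesis
  proof eventually_elim
    case (elim n)
    let ?Z = "van_Hove_boundary K' (A n)"
    have "emeasure (total_variation \<nu>) (inner_boundary K n) =
        (\<integral>\<^sup>+t. 1 * indicator (inner_boundary K n) t \<partial>total_variation \<nu>)"
      using inner_boundary_sets[OF K, of n] by simp
    also have "\<dots> \<le> ennreal C * (1 * emeasure haar ?Z + (\<integral>\<^sup>+x. 0 * indicator ?Z x \<partial>haar))"
    proof (rule est)
      show "\<exists>L. compact L \<and> inner_boundary K n \<subseteq> L"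
        using A_subset_compact[of n] unfolding inner_boundary_def by blast
      show "\<forall>b\<in>inner_boundary K n. \<forall>e\<in>E. b + e \<in> ?Z"
        unfolding inner_boundary_def K'_def using van_Hove_boundary_inner_add by blast
    qed (use inner_boundary_sets[OF K, of n] boundary_sets[OF K', of n] in auto)
    also have "\<dots> = ennreal C * emeasure haar ?Z" by simp
    also have "\<dots> \<le> ennreal C * ennreal (\<eta> / (C + 1) * m n)"
      using elim by (intro mult_left_mono) auto
    also have "\<dots> = ennreal (C * (\<eta> / (C + 1) * m n))"
      using C averaging_sets(3)[of n] \<open>0 < \<eta>\<close> by (intro ennreal_mult[symmetric]) auto
    also have "\<dots> \<le> ennreal (\<eta> * m n)"
    proof (rule ennreal_leI)
      have "C * (\<eta> / (C + 1)) \<le> \<eta>" using C \<open>0 < \<eta>\<close> by (simp add: field_simps)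
      then have "C * (\<eta> / (C + 1)) * m n \<le> \<eta> * m n"
        using averaging_sets(3)[of n] by (intro mult_right_mono) auto
      then show "C * (\<eta> / (C + 1) * m n) \<le> \<eta> * m n" by (simp add: mult.assoc)
    qed
    finally show ?case .
  qed
qed

text \<open>\<open>TV_estimate\<close> with \<delta> equal to 0. The bound \<open>S\<close> on
  \<open>H\<close> only serves to make the boundary contribution at most
  \<open>\<kappa> * m n\<close> eventually, so it does not enter the constant. \<open>C\<close> is
  fixed before \<kappa> and \<open>H\<close>, since the accuracy of the approximation is chosen in
  terms of \<open>C\<close>.\<close>

lemma TV_smoothed_average:
  assumes U: "open U" "0 \<in> U" "compact (closure U)"
  shows "\<exists>C\<ge>0. \<forall>h H S \<kappa>. h \<in> borel_measurable borel \<longrightarrow> H \<in> borel_measurable borel \<longrightarrow>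
    (\<forall>x. 0 \<le> H x \<and> H x \<le> S) \<longrightarrow> 0 < \<kappa> \<longrightarrow>
    (\<forall>t. ennreal (h t) \<le> (\<integral>\<^sup>+x. ennreal (H x) * indicator ((+) t ` U) x \<partial>haar)) \<longrightarrow>
    (\<forall>\<^sub>F n in sequentially. (\<integral>\<^sup>+x. ennreal (H x) * indicator (A n) x \<partial>haar) \<le> ennreal (\<kappa> * m n)) \<longrightarrow>
    (\<forall>\<^sub>F n in sequentially. (\<integral>\<^sup>+t. ennreal (h t) * indicator (A n) t \<partial>total_variation \<nu>) \<le> ennreal (C * \<kappa> * m n))"
proof -
  from TV_cover_estimate[OF U] obtain C E where C: "0 \<le> C" "compact E" and
    "TV_estimate U C E" by blast
  note est = TV_estimateD[OF this(3)]
  have "\<forall>\<^sub>F n in sequentially. (\<integral>\<^sup>+t. ennreal (h t) * indicator (A n) t \<partial>total_variation \<nu>) \<le> ennreal (2 * C * \<kappa> * m n)"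
    if h: "h \<in> borel_measurable borel" and H: "H \<in> borel_measurable borel" "\<forall>x. 0 \<le> H x \<and> H x \<le> S" and \<kappa>: "0 < \<kappa>"
      and hH: "\<forall>t. ennreal (h t) \<le> (\<integral>\<^sup>+x. ennreal (H x) * indicator ((+) t ` U) x \<partial>haar)"
      and avg: "\<forall>\<^sub>F n in sequentially. (\<integral>\<^sup>+x. ennreal (H x) * indicator (A n) x \<partial>haar) \<le> ennreal (\<kappa> * m n)"
    for h H :: "'a \<Rightarrow> real" and S \<kappa> :: real
  proof -
    have S: "0 \<le> S" using H(2) order_trans by blast
    have "0 < \<kappa> / (S + 1)" using S \<kappa> by simp
    from eventually_boundary[OF C(2) this] avg show ?thesis
    proof eventually_elim
      case (elim n)
      let ?b = "van_Hove_boundary E (A n)"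
      let ?Z = "A n \<union> ?b"
      have "(\<integral>\<^sup>+t. ennreal (h t) * indicator (A n) t \<partial>total_variation \<nu>) \<le>
          ennreal C * (0 * emeasure haar ?Z + (\<integral>\<^sup>+x. ennreal (H x) * indicator ?Z x \<partial>haar))"
        using averaging_sets(1)[of n] boundary_sets[OF C(2), of n] van_Hove_boundary_add[of _ "A n" _ E] h H hH
        by (intro est A_subset_compact) auto
      also have "\<dots> \<le> ennreal C * (\<integral>\<^sup>+x. ennreal (H x) * indicator (A n) x + ennreal S * indicator ?b x \<partial>haar)"
      proof -
        have "ennreal (H x) * indicator ?Z x \<le> ennreal (H x) * indicator (A n) x + ennreal S * indicator ?b x" for x
          using H(2)[rule_format, of x] by (auto simp: indicator_def intro: ennreal_leI)
        then show ?thesis by (simp add: mult_left_mono nn_integral_mono)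
      qed
      also have "(\<integral>\<^sup>+x. ennreal (H x) * indicator (A n) x + ennreal S * indicator ?b x \<partial>haar) =
          (\<integral>\<^sup>+x. ennreal (H x) * indicator (A n) x \<partial>haar) + ennreal S * emeasure haar ?b"
        using averaging_sets(1)[of n] H(1) boundary_sets[OF C(2), of n]
        by (subst nn_integral_add) (auto simp: nn_integral_cmult_indicator cong: measurable_cong_sets)
      also have "\<dots> \<le> ennreal (\<kappa> * m n) + ennreal S * ennreal (\<kappa> / (S + 1) * m n)"
        using elim by (intro add_mono mult_left_mono) auto
      also have "\<dots> = ennreal (\<kappa> * m n + S * (\<kappa> / (S + 1) * m n))"
        using S \<kappa> averaging_sets(3)[of n] by (subst ennreal_mult[symmetric], simp, simp, subst ennreal_plus) simp_all
      also have "ennreal C * \<dots> = ennreal (C * (\<kappa> * m n + S * (\<kappa> / (S + 1) * m n)))"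
        using C S \<kappa> averaging_sets(3)[of n] by (subst ennreal_mult) auto
      also have "\<dots> \<le> ennreal (2 * C * \<kappa> * m n)"
      proof (rule ennreal_leI)
        have "S * (\<kappa> / (S + 1)) \<le> \<kappa>" using S \<kappa> by (simp add: field_simps)
        then have "S * (\<kappa> / (S + 1)) * m n \<le> \<kappa> * m n"
          using averaging_sets(3)[of n] by (intro mult_right_mono) auto
        then have "C * (\<kappa> * m n + S * (\<kappa> / (S + 1) * m n)) \<le> C * (\<kappa> * m n + \<kappa> * m n)"
          using C by (intro mult_left_mono add_left_mono) (auto simp: mult.assoc)
        then show "C * (\<kappa> * m n + S * (\<kappa> / (S + 1) * m n)) \<le> 2 * C * \<kappa> * m n" by (simp add: algebra_simps)
      qed
      finally show ?case by (simp add: mult_left_mono)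
    qed
  qed
  then show ?thesis using C by (intro exI[of _ "2 * C"]) auto
qed

end

section \<open>Convolution with a translation bounded functional\<close>

lemma ucont_translates:
  assumes "ucont \<phi>" "0 < e"
  shows "\<exists>U. open U \<and> 0 \<in> U \<and> (\<forall>s t. \<forall>u\<in>U. norm (\<phi> (s - (t + u)) - \<phi> (s - t)) \<le> e)"
proof -
  obtain U where U: "open U" "0 \<in> U" "\<forall>x. \<forall>u\<in>U. norm (\<phi> (x + u) - \<phi> x) \<le> e"
    using assms unfolding ucont_def by blast
  show ?thesis
  proof (intro exI[of _ "uminus -` U"] conjI allI ballI)
    show "open (uminus -` U)" using U by (intro open_vimage) (auto intro!: continuous_intros)
    show "0 \<in> uminus -` U" using U by simp
    fix s t u assume "u \<in> uminus -` U"
    then have "norm (\<phi> ((s - t) + - u) - \<phi> (s - t)) \<le> e" using U(3) by blast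
    moreover have "(s - t) + - u = s - (t + u)" by simp
    ultimately show "norm (\<phi> (s - (t + u)) - \<phi> (s - t)) \<le> e" by metis
  qed
qed

lemma tilde_fun_Cc:
  fixes \<phi> :: "'a::{t2_space, topological_ab_group_add} \<Rightarrow> complex"
  assumes "\<phi> \<in> Cc"
  shows "tilde_fun \<phi> \<in> Cc"
proof -
  have \<phi>: "(\<lambda>s. \<phi> (- s)) \<in> Cc" using assms by (rule Cc_compose_uminus)
  show ?thesis unfolding tilde_fun_def
  proof (rule Cc_I[OF _ Cc_support[OF \<phi>]])
    show "continuous_on UNIV (\<lambda>x. cnj (\<phi> (- x)))"
      using Cc_continuous[OF \<phi>] by (intro continuous_intros)
    show "x \<in> closure {x. \<phi> (- x) \<noteq> 0}" if "cnj (\<phi> (- x)) \<noteq> 0" for x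
      using that Cc_in_support[of "\<lambda>s. \<phi> (- s)" x] by simp
  qed
qed

lemma radon_measure_tilde:
  fixes \<sigma> :: "('a::{t2_space, topological_ab_group_add} \<Rightarrow> complex) \<Rightarrow> complex"
  assumes "radon_measure \<sigma>"
  shows "radon_measure (tilde_radon \<sigma>)"
  unfolding radon_measure_def
proof (intro conjI ballI allI impI)
  have add: "\<sigma> (\<lambda>x. f x + g x) = \<sigma> f + \<sigma> g" and scale: "\<sigma> (\<lambda>x. c * f x) = c * \<sigma> f"
    if "f \<in> Cc" "g \<in> Cc" for f g c
    using assms that unfolding radon_measure_def by simp_all
  show "tilde_radon \<sigma> (\<lambda>x. \<phi> x + \<psi> x) = tilde_radon \<sigma> \<phi> + tilde_radon \<sigma> \<psi>" if "\<phi> \<in> Cc" "\<psi> \<in> Cc" for \<phi> \<psi>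
    using add[OF tilde_fun_Cc[OF that(1)] tilde_fun_Cc[OF that(2)]]
    by (simp add: tilde_radon_def tilde_fun_def)
  show "tilde_radon \<sigma> (\<lambda>x. c * \<phi> x) = c * tilde_radon \<sigma> \<phi>" if "\<phi> \<in> Cc" for c \<phi>
    using scale[OF tilde_fun_Cc[OF that] tilde_fun_Cc[OF that], of "cnj c"]
    by (simp add: tilde_radon_def tilde_fun_def)
  fix K :: "'a set" assume "compact K"
  then have "compact (uminus ` K)" by (intro compact_continuous_image continuous_intros) auto
  from radon_measure_bound[OF assms this] obtain C where C: "0 \<le> C"
    "\<forall>\<phi>\<in>Cc. \<forall>B. (\<forall>x. \<phi> x \<noteq> 0 \<longrightarrow> x \<in> uminus ` K) \<longrightarrow> (\<forall>x. norm (\<phi> x) \<le> B) \<longrightarrow> norm (\<sigma> \<phi>) \<le> C * B"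
    by meson
  have "norm (tilde_radon \<sigma> \<phi>) \<le> C * (SUP x. norm (\<phi> x))" if \<phi>: "\<phi> \<in> Cc" "{x. \<phi> x \<noteq> 0} \<subseteq> K" for \<phi>
  proof -
    obtain B where B: "0 < B" "\<forall>x. norm (\<phi> x) \<le> B" using Cc_bounded[OF \<phi>(1)] by blast
    have S: "norm (\<phi> x) \<le> (SUP x. norm (\<phi> x))" for x
      using B(2) by (intro cSUP_upper) (auto intro!: bdd_aboveI)
    have "norm (\<sigma> (tilde_fun \<phi>)) \<le> C * (SUP x. norm (\<phi> x))"
    proof (rule C(2)[rule_format])
      show "tilde_fun \<phi> \<in> Cc" using \<phi>(1) by (rule tilde_fun_Cc)
      show "x \<in> uminus ` K" if "tilde_fun \<phi> x \<noteq> 0" for x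
        using that \<phi>(2) by (intro image_eqI[of _ _ "- x"]) (auto simp: tilde_fun_def)
      show "norm (tilde_fun \<phi> x) \<le> (SUP x. norm (\<phi> x))" for x
        unfolding tilde_fun_def complex_mod_cnj by (rule S)
    qed
    then show ?thesis by (simp add: tilde_radon_def)
  qed
  with C(1) show "\<exists>C\<ge>0. \<forall>\<phi>\<in>Cc. {x. \<phi> x \<noteq> 0} \<subseteq> K \<longrightarrow> norm (tilde_radon \<sigma> \<phi>) \<le> C * (SUP x. norm (\<phi> x))"
    by blast
qed

context lc_radon
begin

lemma has_radon_integral_norm_le:
  assumes I: "has_radon_integral \<mu> f c" and S: "S \<in> sets borel" and e: "0 \<le> e" and v: "0 \<le> v"
    and f: "\<And>x. norm (f x) \<le> e" "\<And>x. f x \<noteq> 0 \<Longrightarrow> x \<in> S"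
    and "emeasure (total_variation \<mu>) S \<le> ennreal v"
  shows "norm c \<le> e * v"
proof -
  have "ennreal (norm c) \<le> (\<integral>\<^sup>+x. ennreal (norm (f x)) \<partial>total_variation \<mu>)"
    by (rule has_radon_integral_bound[OF I])
  also have "\<dots> \<le> (\<integral>\<^sup>+x. ennreal e * indicator S x \<partial>total_variation \<mu>)"
  proof (rule nn_integral_mono)
    show "ennreal (norm (f x)) \<le> ennreal e * indicator S x" for x
      using f[of x] by (cases "f x = 0") (auto intro: ennreal_leI)
  qed
  also have "\<dots> = ennreal e * emeasure (total_variation \<mu>) S"
    using S by (simp add: nn_integral_cmult_indicator)
  also have "\<dots> \<le> ennreal e * ennreal v" using assms by (intro mult_left_mono) auto
  also have "\<dots> = ennreal (e * v)" using e v by (simp add: ennreal_mult)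
  finally show ?thesis using e v by simp
qed

end

section \<open>Boundedness and uniform continuity of convolutions\<close>

context tb_radon
begin

text \<open>The integrand lives on \<open>t + L\<close>, whose variation is bounded uniformly in
  \<open>t\<close> by translation boundedness.\<close>

lemma conv_uniform_bound:
  assumes L: "compact L"
  shows "\<exists>C\<ge>0. \<forall>f c e t. has_radon_integral \<mu> f c \<longrightarrow> 0 \<le> e \<longrightarrow> (\<forall>s. norm (f s) \<le> e) \<longrightarrow>
    (\<forall>s. f s \<noteq> 0 \<longrightarrow> s - t \<in> L) \<longrightarrow> norm c \<le> e * C"
proof -
  obtain C where C: "0 \<le> C" "\<forall>t. emeasure (total_variation \<mu>) ((+) t ` L) \<le> ennreal C"
    using TV_translate_bound[OF L] by blast
  have "norm c \<le> e * C" if I: "has_radon_integral \<mu> f c" and e: "0 \<le> e" and f: "\<forall>s. norm (f s) \<le> e"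
    "\<forall>s. f s \<noteq> 0 \<longrightarrow> s - t \<in> L" for f c e t
    by (rule has_radon_integral_norm_le[OF I _ e C(1), of "(+) t ` L"])
      (use C f L compact_translate[OF L, of t] in \<open>auto simp: translate_eq_vimage intro!: borel_closed compact_imp_closed\<close>)
  with C(1) show ?thesis by blast
qed

text \<open>Keeping \<open>u\<close> in a relatively compact neighbourhood \<open>N\<close> confines
  the difference of the two translates of \<phi> to \<open>t + L\<close>, with \<open>L\<close>
  independent of \<open>u\<close> and \<open>t\<close>. The difference is uniformly small by uniform
  continuity of \<phi>, and the mass of \<open>t + L\<close> is uniformly bounded.\<close>

lemma conv_ucont:
  assumes \<phi>: "\<phi> \<in> Cc"
  shows "ucont (\<lambda>t. \<mu> (\<lambda>s. \<phi> (s - t)))"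
  unfolding ucont_def
proof (intro allI impI)
  fix e :: real assume "0 < e"
  obtain N :: "'a set" where N: "open N" "{0} \<subseteq> N" "compact (closure N)" "closure N \<subseteq> UNIV"
    by (rule lc_compact_between[OF lc compact_sing open_UNIV subset_UNIV])
  let ?K = "closure {x. \<phi> x \<noteq> 0}"
  define L where "L = ?K \<union> {a + b | a b. a \<in> ?K \<and> b \<in> closure N}"
  have "compact L" unfolding L_def using N Cc_support[OF \<phi>] by (intro compact_Un compact_sums_group)
  from conv_uniform_bound[OF this] obtain C where C: "0 \<le> C"
    "\<forall>f c e t. has_radon_integral \<mu> f c \<longrightarrow> 0 \<le> e \<longrightarrow> (\<forall>s. norm (f s) \<le> e) \<longrightarrow>
    (\<forall>s. f s \<noteq> 0 \<longrightarrow> s - t \<in> L) \<longrightarrow> norm c \<le> e * C" by blast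
  define e' where "e' = e / (C + 1)"
  have e': "0 < e'" using \<open>0 < e\<close> C(1) by (simp add: e'_def)
  obtain U where U: "open U" "0 \<in> U" "\<forall>s t. \<forall>u\<in>U. norm (\<phi> (s - (t + u)) - \<phi> (s - t)) \<le> e'"
    using ucont_translates[OF Cc_ucont[OF \<phi>] e'] by blast
  show "\<exists>U. open U \<and> 0 \<in> U \<and> (\<forall>t. \<forall>u\<in>U. norm (\<mu> (\<lambda>s. \<phi> (s - (t + u))) - \<mu> (\<lambda>s. \<phi> (s - t))) \<le> e)"
  proof (intro exI[of _ "U \<inter> N"] conjI allI ballI)
    show "open (U \<inter> N)" "0 \<in> U \<inter> N" using U N by auto
    fix t u assume u: "u \<in> U \<inter> N"
    have "norm (\<mu> (\<lambda>s. \<phi> (s - (t + u))) - \<mu> (\<lambda>s. \<phi> (s - t))) \<le> e' * C"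
    proof (rule C(2)[rule_format])
      show "has_radon_integral \<mu> (\<lambda>s. \<phi> (s - (t + u)) - \<phi> (s - t))
          (\<mu> (\<lambda>s. \<phi> (s - (t + u))) - \<mu> (\<lambda>s. \<phi> (s - t)))"
        by (intro has_radon_integral_diff has_radon_integral_Cc Cc_compose_translate \<phi>)
      show "norm (\<phi> (s - (t + u)) - \<phi> (s - t)) \<le> e'" for s using U(3) u by blast
      fix s assume "\<phi> (s - (t + u)) - \<phi> (s - t) \<noteq> 0"
      then consider "\<phi> (s - (t + u)) \<noteq> 0" | "\<phi> (s - t) \<noteq> 0" by fastforce
      then show "s - t \<in> L"
      proof cases
        case 1
        then have "s - (t + u) \<in> ?K" by (rule Cc_in_support)
        moreover have "s - t = (s - (t + u)) + u" by simp
        moreover have "u \<in> closure N" using u closure_subset[of N] by blast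
        ultimately show ?thesis unfolding L_def by blast
      next
        case 2
        then have "s - t \<in> ?K" by (rule Cc_in_support)
        then show ?thesis unfolding L_def by blast
      qed
    qed (use e' in simp)
    also have "\<dots> \<le> e" using C(1) \<open>0 < e\<close> by (simp add: e'_def field_simps)
    finally show "norm (\<mu> (\<lambda>s. \<phi> (s - (t + u))) - \<mu> (\<lambda>s. \<phi> (s - t))) \<le> e" .
  qed
qed

text \<open>Multiplication by an indicator preserves the bound on \<phi> and the support condition,
  so one constant serves \<mu> and all its restrictions. Uniformity over the restrictions is needed
  because \<open>A n\<close> varies.\<close>

lemma conv_bounded:
  assumes \<phi>: "\<phi> \<in> Cc"
  shows "\<exists>C\<ge>0. (\<forall>t. norm (\<mu> (\<lambda>s. \<phi> (s - t))) \<le> C) \<and>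
    (\<forall>A t. open A \<longrightarrow> compact (closure A) \<longrightarrow> norm (restrict_radon \<mu> A (\<lambda>s. \<phi> (s - t))) \<le> C)"
proof -
  obtain b where b: "0 < b" "\<forall>x. norm (\<phi> x) \<le> b" using Cc_bounded[OF \<phi>] by blast
  from conv_uniform_bound[OF Cc_support[OF \<phi>]] obtain C where C: "0 \<le> C"
    "\<forall>f c e t. has_radon_integral \<mu> f c \<longrightarrow> 0 \<le> e \<longrightarrow> (\<forall>s. norm (f s) \<le> e) \<longrightarrow>
    (\<forall>s. f s \<noteq> 0 \<longrightarrow> s - t \<in> closure {x. \<phi> x \<noteq> 0}) \<longrightarrow> norm c \<le> e * C" by blast
  have "norm (\<mu> (\<lambda>s. \<phi> (s - t))) \<le> b * C" for t
    by (rule C(2)[rule_format, OF has_radon_integral_Cc[OF Cc_compose_translate[OF \<phi>]], of b t])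
      (use b in \<open>auto intro: Cc_in_support\<close>)
  moreover have "norm (restrict_radon \<mu> A (\<lambda>s. \<phi> (s - t))) \<le> b * C"
    if "open A" "compact (closure A)" for A t
    unfolding restrict_radon_def
  proof (rule C(2)[rule_format, OF has_radon_integral_open[OF that Cc_continuous[OF Cc_compose_translate[OF \<phi>]]], of b t])
    show "norm (indicator A s * \<phi> (s - t)) \<le> b" for s
      using b by (auto simp: indicator_def)
    show "s - t \<in> closure {x. \<phi> x \<noteq> 0}" if "indicator A s * \<phi> (s - t) \<noteq> 0" for s
      using that by (intro Cc_in_support) auto
  qed (use b in simp)
  ultimately show ?thesis using b C(1) by (intro exI[of _ "b * C"]) auto
qed

text \<open>A nonzero value at \<open>t\<close> forces \<open>t\<close> into the difference of
  \<open>A\<close> and the support of \<phi>; continuity uses that |\<mu>|(A) is finite. Membership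
  in \<open>Cc\<close> reduces the outer integral of \<open>conv_radon\<close> to applying a
  functional.\<close>

lemma restricted_conv_Cc:
  assumes A: "open A" "compact (closure A)" and \<phi>: "\<phi> \<in> Cc"
  shows "(\<lambda>t. restrict_radon \<mu> A (\<lambda>s. \<phi> (s - t))) \<in> Cc"
proof (rule Cc_I)
  note H = has_radon_integral_open[OF A Cc_continuous[OF Cc_compose_translate[OF \<phi>]]]
  let ?F = "\<lambda>t. restrict_radon \<mu> A (\<lambda>s. \<phi> (s - t))"
  show "continuous_on UNIV ?F"
  proof (rule ucont_continuous, unfold ucont_def, intro allI impI)
    fix e :: real assume "0 < e"
    obtain v where v: "0 \<le> v" "emeasure (total_variation \<mu>) A = ennreal v"
      using emeasure_TV_open_finite[OF A] by (cases "emeasure (total_variation \<mu>) A" rule: ennreal_cases) auto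
    define e' where "e' = e / (v + 1)"
    have e': "0 < e'" using \<open>0 < e\<close> v(1) by (simp add: e'_def)
    obtain U where U: "open U" "0 \<in> U" "\<forall>s t. \<forall>u\<in>U. norm (\<phi> (s - (t + u)) - \<phi> (s - t)) \<le> e'"
      using ucont_translates[OF Cc_ucont[OF \<phi>] e'] by blast
    have "norm (?F (t + u) - ?F t) \<le> e" if u: "u \<in> U" for t u
    proof -
      have "norm (?F (t + u) - ?F t) \<le> e' * v"
        unfolding restrict_radon_def
      proof (rule has_radon_integral_norm_le[OF has_radon_integral_diff[OF H H], of A])
        show "norm (indicator A s * \<phi> (s - (t + u)) - indicator A s * \<phi> (s - t)) \<le> e'" for s
          using U(3)[rule_format, OF u, of s t] e' by (auto simp: indicator_def)
      qed (use A v e' in \<open>auto simp: indicator_def\<close>)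
      also have "\<dots> \<le> e" using v(1) \<open>0 < e\<close> by (simp add: e'_def field_simps)
      finally show ?thesis .
    qed
    then show "\<exists>U. open U \<and> 0 \<in> U \<and> (\<forall>t. \<forall>u\<in>U. norm (?F (t + u) - ?F t) \<le> e)" using U by blast
  qed
  show "compact {a - k | a k. a \<in> closure A \<and> k \<in> closure {x. \<phi> x \<noteq> 0}}"
    using A Cc_support[OF \<phi>] by (intro compact_diffs_group)
  fix t assume t: "?F t \<noteq> 0"
  have "\<exists>s\<in>A. \<phi> (s - t) \<noteq> 0"
  proof (rule ccontr)
    assume "\<not> (\<exists>s\<in>A. \<phi> (s - t) \<noteq> 0)"
    then have "(\<lambda>s. indicator A s * \<phi> (s - t)) = (\<lambda>s. 0)" by (auto simp: indicator_def)
    then have "?F t = 0" unfolding restrict_radon_def using radon_integral_Cc[OF Cc_zero] \<mu>_zero by simp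
    with t show False by simp
  qed
  then obtain s where s: "s \<in> A" "\<phi> (s - t) \<noteq> 0" by blast
  then have "s - t \<in> closure {x. \<phi> x \<noteq> 0}" "s \<in> closure A"
    using Cc_in_support[of \<phi> "s - t"] closure_subset[of A] by auto
  moreover have "t = s - (s - t)" by simp
  ultimately show "t \<in> {a - k | a k. a \<in> closure A \<and> k \<in> closure {x. \<phi> x \<noteq> 0}}" by blast
qed

end

section \<open>Reduction of the Eberlein convolution to means against \<nu>\<close>

context vh
begin

text \<open>The inner function is in \<open>Cc\<close>, so its integral is the value of the
  functional. The reflection in \<open>tilde_radon\<close> cancels the one that turns \<phi>(s + t)
  into \<phi>(s - t), leaving the two conjugations.\<close>

lemma conv_radon_restrict:
  assumes "tb_radon haar \<mu>" "tb_radon haar \<nu>" and \<phi>: "\<phi> \<in> Cc"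
  shows "conv_radon (restrict_radon \<mu> (A n)) (tilde_radon (restrict_radon \<nu> (A n))) \<phi> =
    cnj (radon_integral \<nu> (\<lambda>t. indicator (A n) t * cnj (restrict_radon \<mu> (A n) (\<lambda>s. \<phi> (s - t)))))"
proof -
  interpret M: tb_radon haar \<mu> by fact
  interpret N: tb_radon haar \<nu> by fact
  interpret T: lc_radon "tilde_radon (restrict_radon \<nu> (A n))"
    by unfold_locales (use lc radon_measure_tilde[OF N.radon_measure_restrict[OF averaging_sets(1,2)]] in auto)
  let ?F = "\<lambda>t. restrict_radon \<mu> (A n) (\<lambda>s. \<phi> (s - t))"
  have "(\<lambda>t. ?F (- t)) \<in> Cc"
    by (rule Cc_compose_uminus[OF M.restricted_conv_Cc[OF averaging_sets(1,2) \<phi>]])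
  then have "radon_integral (tilde_radon (restrict_radon \<nu> (A n))) (\<lambda>t. ?F (- t)) =
      tilde_radon (restrict_radon \<nu> (A n)) (\<lambda>t. ?F (- t))"
    by (rule T.radon_integral_Cc)
  then show ?thesis
    by (simp add: conv_radon_def tilde_radon_def tilde_fun_def restrict_radon_def)
qed

text \<open>Replacing \<open>\<mu>|\<^bsub>A\<^sub>n\<^esub>\<close> by \<open>\<mu>\<close> only affects points of \<open>A\<^sub>n\<close> close to the boundary.\<close>

lemma eberlein_reduction:
  assumes M: "tb_radon haar \<mu>" and N: "tb_radon haar \<nu>" and \<phi>: "\<phi> \<in> Cc" and \<eta>: "0 < \<eta>"
  shows "\<forall>\<^sub>F n in sequentially.
    norm (conv_radon (restrict_radon \<mu> (A n)) (tilde_radon (restrict_radon \<nu> (A n))) \<phi> -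
      cnj (radon_integral \<nu> (\<lambda>t. indicator (A n) t * cnj (\<mu> (\<lambda>s. \<phi> (s - t)))))) \<le> \<eta> * m n"
proof -
  interpret M: tb_radon haar \<mu> by fact
  interpret N: tb_radon haar \<nu> by fact
  interpret N: vh_radon haar A \<nu> ..
  let ?K = "closure {x. \<phi> x \<noteq> 0}"
  let ?F = "\<lambda>t. \<mu> (\<lambda>s. \<phi> (s - t))"
  let ?FA = "\<lambda>n t. restrict_radon \<mu> (A n) (\<lambda>s. \<phi> (s - t))"
  have K: "compact ?K" using \<phi> by (rule Cc_support)
  obtain C where C: "0 \<le> C" "\<forall>t. norm (?F t) \<le> C"
    "\<forall>A t. open A \<longrightarrow> compact (closure A) \<longrightarrow> norm (restrict_radon \<mu> A (\<lambda>s. \<phi> (s - t))) \<le> C"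
    using M.conv_bounded[OF \<phi>] by blast
  have "0 < \<eta> / (2 * C + 1)" using \<eta> C by simp
  from N.TV_inner_boundary[OF K this] show ?thesis
  proof eventually_elim
    case (elim n)
    have contF: "continuous_on UNIV (\<lambda>t. cnj (?F t))"
      by (intro continuous_intros ucont_continuous M.conv_ucont \<phi>)
    have contFA: "continuous_on UNIV (\<lambda>t. cnj (?FA n t))"
      using Cc_continuous[OF M.restricted_conv_Cc[OF averaging_sets(1,2) \<phi>]] by (intro continuous_intros)
    \<comment> \<open>Off the inner boundary, \<open>t\<close> plus the support of \<phi> stays
      within \<open>A n\<close>, so the indicator changes nothing.\<close>
    have same: "?FA n t = ?F t" if "t \<in> A n" "t \<notin> N.inner_boundary ?K n" for t
    proof -
      have "indicator (A n) s * \<phi> (s - t) = \<phi> (s - t)" for s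
      proof (cases "\<phi> (s - t) = 0")
        case False
        then have "s - t \<in> ?K" by (rule Cc_in_support)
        then have "t + (s - t) \<in> A n" using that unfolding N.inner_boundary_def by blast
        then show ?thesis by simp
      qed simp
      then have "?FA n t = radon_integral \<mu> (\<lambda>s. \<phi> (s - t))" unfolding restrict_radon_def by presburger
      also have "\<dots> = ?F t" by (intro M.radon_integral_Cc Cc_compose_translate \<phi>)
      finally show ?thesis .
    qed
    have "norm (radon_integral \<nu> (\<lambda>t. indicator (A n) t * cnj (?FA n t)) -
        radon_integral \<nu> (\<lambda>t. indicator (A n) t * cnj (?F t))) \<le> (2 * C) * (\<eta> / (2 * C + 1) * m n)"
    proof (rule N.has_radon_integral_norm_le[OF N.has_radon_integral_diff[OF
          N.has_radon_integral_open[OF averaging_sets(1,2) contFA] N.has_radon_integral_open[OF averaging_sets(1,2) contF]],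
          of "N.inner_boundary ?K n"])
      show "N.inner_boundary ?K n \<in> sets borel" using K by (rule N.inner_boundary_sets)
      show "t \<in> N.inner_boundary ?K n" if "indicator (A n) t * cnj (?FA n t) - indicator (A n) t * cnj (?F t) \<noteq> 0" for t
        using that same[of t] by (cases "t \<in> A n") auto
      show "norm (indicator (A n) t * cnj (?FA n t) - indicator (A n) t * cnj (?F t)) \<le> 2 * C" for t
      proof -
        have "norm (indicator (A n) t * cnj (?FA n t) - indicator (A n) t * cnj (?F t)) \<le>
            norm (indicator (A n) t * cnj (?FA n t)) + norm (indicator (A n) t * cnj (?F t))"
          by (rule norm_triangle_ineq4)
        also have "\<dots> \<le> C + C"
          using C(1) C(2)[rule_format, of t] C(3)[rule_format, OF averaging_sets(1,2), of n t]
          by (intro add_mono) (auto simp: indicator_def)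
        finally show ?thesis by simp
      qed
    qed (use C \<eta> averaging_sets(3)[of n] elim in auto)
    also have "\<dots> \<le> \<eta> * m n"
    proof -
      have "2 * C * (\<eta> / (2 * C + 1)) \<le> \<eta>" using C \<eta> by (simp add: field_simps)
      then have "2 * C * (\<eta> / (2 * C + 1)) * m n \<le> \<eta> * m n"
        using averaging_sets(3)[of n] by (intro mult_right_mono) auto
      then show ?thesis by (simp add: mult.assoc)
    qed
    finally show ?case
      unfolding conv_radon_restrict[OF M.tb_radon_axioms N.tb_radon_axioms \<phi>]
        complex_cnj_diff[symmetric] complex_mod_cnj .
  qed
qed

text \<open>By \<open>eberlein_reduction\<close> the two sequences differ by less than any positive
  multiple of \<open>m n\<close> eventually, so either both averages tend to 0 or neither does; the
  outer conjugation does not affect norms.\<close>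

lemma has_eberlein_convolution_0_iff:
  assumes M: "tb_radon haar \<mu>" and N: "tb_radon haar \<nu>"
  shows "has_eberlein_convolution haar A \<mu> \<nu> (\<lambda>\<phi>. 0) \<longleftrightarrow>
    (\<forall>\<phi>\<in>Cc. \<forall>\<epsilon>>0. \<forall>\<^sub>F n in sequentially.
      norm (radon_integral \<nu> (\<lambda>t. indicator (A n) t * cnj (\<mu> (\<lambda>s. \<phi> (s - t))))) \<le> \<epsilon> * m n)"
proof -
  have close: "\<forall>\<epsilon>>0. \<forall>\<^sub>F n in sequentially. norm (y n) \<le> \<epsilon> * m n"
    if x: "\<forall>\<epsilon>>0. \<forall>\<^sub>F n in sequentially. norm (x n) \<le> \<epsilon> * m n"
      and xy: "\<And>\<epsilon>. 0 < \<epsilon> \<Longrightarrow> \<forall>\<^sub>F n in sequentially. norm (x n - y n) \<le> \<epsilon> * m n"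
    for x y :: "nat \<Rightarrow> complex"
  proof (intro allI impI)
    fix \<epsilon> :: real assume "0 < \<epsilon>"
    then have e: "0 < \<epsilon> / 2" by simp
    from x[rule_format, OF e] xy[OF e] show "\<forall>\<^sub>F n in sequentially. norm (y n) \<le> \<epsilon> * m n"
    proof eventually_elim
      case (elim n)
      have "norm (y n) \<le> norm (x n) + norm (x n - y n)"
        using norm_triangle_ineq4[of "x n" "x n - y n"] by simp
      also have "\<dots> \<le> \<epsilon> / 2 * m n + \<epsilon> / 2 * m n" using elim by (intro add_mono) auto
      also have "\<dots> = \<epsilon> * m n" by simp
      finally show ?case .
    qed
  qed
  have "(\<forall>\<epsilon>>0. \<forall>\<^sub>F n in sequentially.
        norm (conv_radon (restrict_radon \<mu> (A n)) (tilde_radon (restrict_radon \<nu> (A n))) \<phi>) \<le> \<epsilon> * m n) \<longleftrightarrow>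
      (\<forall>\<epsilon>>0. \<forall>\<^sub>F n in sequentially.
        norm (radon_integral \<nu> (\<lambda>t. indicator (A n) t * cnj (\<mu> (\<lambda>s. \<phi> (s - t))))) \<le> \<epsilon> * m n)"
    if \<phi>: "\<phi> \<in> Cc" for \<phi>
  proof -
    define x where "x = (\<lambda>n. conv_radon (restrict_radon \<mu> (A n)) (tilde_radon (restrict_radon \<nu> (A n))) \<phi>)"
    define y where "y = (\<lambda>n. cnj (radon_integral \<nu> (\<lambda>t. indicator (A n) t * cnj (\<mu> (\<lambda>s. \<phi> (s - t))))))"
    have xy: "\<forall>\<^sub>F n in sequentially. norm (x n - y n) \<le> \<epsilon> * m n" if "0 < \<epsilon>" for \<epsilon>
      unfolding x_def y_def by (rule eberlein_reduction[OF M N \<phi> that])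
    then have yx: "\<forall>\<^sub>F n in sequentially. norm (y n - x n) \<le> \<epsilon> * m n" if "0 < \<epsilon>" for \<epsilon>
      using that by (simp add: norm_minus_commute)
    have "(\<forall>\<epsilon>>0. \<forall>\<^sub>F n in sequentially. norm (x n) \<le> \<epsilon> * m n) \<longleftrightarrow> (\<forall>\<epsilon>>0. \<forall>\<^sub>F n in sequentially. norm (y n) \<le> \<epsilon> * m n)"
      using close[of x y, OF _ xy] close[of y x, OF _ yx] by blast
    then show ?thesis unfolding x_def y_def complex_mod_cnj .
  qed
  then show ?thesis
    unfolding has_eberlein_convolution_def average_tendsto_0_iff by (intro ball_cong refl)
qed

end

section \<open>Characters as densities\<close>

context lc_haar
begin

lemma borel_measurable_haar: "(f \<in> borel_measurable haar) = (f \<in> borel_measurable borel)"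
  by (simp cong: measurable_cong_sets)

lemma Cc_integrable:
  assumes "\<phi> \<in> Cc"
  shows "integrable haar \<phi>"
proof -
  obtain B where B: "\<forall>x. norm (\<phi> x) \<le> B" using Cc_bounded[OF assms] by blast
  show ?thesis
  proof (rule integrableI_bounded_set[where A="closure {x. \<phi> x \<noteq> 0}" and B=B])
    show "AE x in haar. x \<in> closure {x. \<phi> x \<noteq> 0} \<longrightarrow> norm (\<phi> x) \<le> B" using B by simp
    show "AE x in haar. x \<notin> closure {x. \<phi> x \<noteq> 0} \<longrightarrow> \<phi> x = 0"
      using Cc_in_support[of \<phi>] by (intro AE_I2) blast
    show "\<phi> \<in> borel_measurable haar"
      using Cc_continuous[OF assms] borel_measurable_continuous_onI by (simp add: borel_measurable_haar)
    show "emeasure haar (closure {x. \<phi> x \<noteq> 0}) < \<infinity>" using Cc_support[OF assms] by (rule emeasure_compact)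
  qed simp
qed

lemma dual_groupD:
  assumes "\<xi> \<in> dual_group"
  shows "continuous_on UNIV \<xi>" "norm (\<xi> x) = 1" "\<xi> (x + y) = \<xi> x * \<xi> y"
  using assms by (auto simp: dual_group_def)

definition char_measure :: "('a \<Rightarrow> complex) \<Rightarrow> ('a \<Rightarrow> complex) \<Rightarrow> complex" where
  "char_measure \<xi> \<phi> = (\<integral>x. \<phi> x * \<xi> x \<partial>haar)"

lemma char_measure_bound:
  assumes \<xi>: "\<xi> \<in> dual_group" and \<phi>: "\<phi> \<in> Cc" "\<And>x. norm (\<phi> x) \<le> B" "\<And>x. \<phi> x \<noteq> 0 \<Longrightarrow> x \<in> S" "S \<in> sets borel"
    and B: "0 \<le> B"
  shows "ennreal (norm (char_measure \<xi> \<phi>)) \<le> ennreal B * emeasure haar S"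
proof -
  have "integrable haar (\<lambda>x. \<phi> x * \<xi> x)"
    by (intro Cc_integrable Cc_mult_right \<phi> dual_groupD(1)[OF \<xi>])
  then have "ennreal (norm (char_measure \<xi> \<phi>)) \<le> (\<integral>\<^sup>+x. ennreal (norm (\<phi> x * \<xi> x)) \<partial>haar)"
    unfolding char_measure_def by (rule integral_norm_bound_ennreal)
  also have "\<dots> \<le> (\<integral>\<^sup>+x. ennreal B * indicator S x \<partial>haar)"
  proof (rule nn_integral_mono)
    show "ennreal (norm (\<phi> x * \<xi> x)) \<le> ennreal B * indicator S x" for x
      using \<phi>(2,3)[of x] dual_groupD(2)[OF \<xi>, of x]
      by (cases "\<phi> x = 0") (auto simp: norm_mult intro: ennreal_leI)
  qed
  also have "\<dots> = ennreal B * emeasure haar S"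
    using \<phi>(4) by (simp add: nn_integral_cmult_indicator)
  finally show ?thesis .
qed

text \<open>Since |\<xi>| is 1, the variation of an open set is at most its Haar measure, which does
  not change under translation.\<close>

lemma translation_bounded_char_measure:
  assumes \<xi>: "\<xi> \<in> dual_group"
  shows "translation_bounded (char_measure \<xi>)"
proof -
  note int = Cc_integrable[OF Cc_mult_right[OF _ dual_groupD(1)[OF \<xi>]]]
  have radon: "radon_measure (char_measure \<xi>)"
    unfolding radon_measure_def
  proof (intro conjI ballI allI impI)
    show "char_measure \<xi> (\<lambda>x. \<phi> x + \<psi> x) = char_measure \<xi> \<phi> + char_measure \<xi> \<psi>" if "\<phi> \<in> Cc" "\<psi> \<in> Cc" for \<phi> \<psi>
      unfolding char_measure_def using that
      by (simp add: distrib_right Bochner_Integration.integral_add[OF int int])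
    show "char_measure \<xi> (\<lambda>x. c * \<phi> x) = c * char_measure \<xi> \<phi>" if "\<phi> \<in> Cc" for c \<phi>
      unfolding char_measure_def by (simp add: mult.assoc)
    fix K :: "'a set" assume K: "compact K"
    obtain k where k: "0 \<le> k" "emeasure haar K = ennreal k"
      using emeasure_compact[OF K] by (cases "emeasure haar K" rule: ennreal_cases) auto
    have "norm (char_measure \<xi> \<phi>) \<le> k * (SUP x. norm (\<phi> x))" if \<phi>: "\<phi> \<in> Cc" "{x. \<phi> x \<noteq> 0} \<subseteq> K" for \<phi>
    proof -
      obtain B where B: "0 < B" "\<forall>x. norm (\<phi> x) \<le> B" using Cc_bounded[OF \<phi>(1)] by blast
      define S where "S = (SUP x. norm (\<phi> x))"
      have S: "norm (\<phi> x) \<le> S" for x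
        unfolding S_def using B(2) by (intro cSUP_upper) (auto intro!: bdd_aboveI)
      have S0: "0 \<le> S" using S norm_ge_zero order_trans by blast
      have "ennreal (norm (char_measure \<xi> \<phi>)) \<le> ennreal S * emeasure haar K"
        using \<phi> S S0 K by (intro char_measure_bound \<xi> borel_closed compact_imp_closed) auto
      also have "\<dots> = ennreal (k * S)" using k S0 by (simp add: ennreal_mult[symmetric] mult.commute)
      finally show ?thesis unfolding S_def[symmetric] using k S0 by simp
    qed
    with k(1) show "\<exists>C\<ge>0. \<forall>\<phi>\<in>Cc. {x. \<phi> x \<noteq> 0} \<subseteq> K \<longrightarrow> norm (char_measure \<xi> \<phi>) \<le> C * (SUP x. norm (\<phi> x))"
      by blast
  qed
  interpret R: lc_radon "char_measure \<xi>" using lc radon by unfold_locales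
  obtain N :: "'a set" where N: "open N" "0 \<in> N" "compact (closure N)" using ex_nbhd by blast
  have "emeasure (total_variation (char_measure \<xi>)) ((+) t ` N) \<le> emeasure haar N" for t
  proof -
    have "emeasure (total_variation (char_measure \<xi>)) ((+) t ` N) = variation_open (char_measure \<xi>) ((+) t ` N)"
      using N by (intro R.emeasure_total_variation_open) simp
    also have "\<dots> \<le> emeasure haar ((+) t ` N)"
      unfolding variation_open_def
    proof (rule SUP_least)
      fix \<psi> assume "\<psi> \<in> {\<psi> \<in> Cc. closure {x. \<psi> x \<noteq> 0} \<subseteq> (+) t ` N \<and> (\<forall>x. norm (\<psi> x) \<le> 1)}"
      then have "ennreal (norm (char_measure \<xi> \<psi>)) \<le> ennreal 1 * emeasure haar ((+) t ` N)"
        using N Cc_in_support[of \<psi>] by (intro char_measure_bound \<xi>) auto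
      then show "ennreal (norm (char_measure \<xi> \<psi>)) \<le> emeasure haar ((+) t ` N)" by simp
    qed
    also have "\<dots> = emeasure haar N" using N by (simp add: emeasure_translate)
    finally show ?thesis .
  qed
  then have "(SUP t. emeasure (total_variation (char_measure \<xi>)) ((+) t ` N)) \<le> emeasure haar N"
    by (intro SUP_least)
  also have "\<dots> < \<infinity>" using N by (intro emeasure_rel_compact)
  finally show ?thesis
    unfolding translation_bounded_def using radon N by blast
qed

lemma char_measure_translate:
  assumes \<xi>: "\<xi> \<in> dual_group" and \<phi>: "\<phi> \<in> Cc"
  shows "char_measure \<xi> (\<lambda>s. \<phi> (s - t)) = \<xi> t * char_measure \<xi> \<phi>"
proof -
  let ?f = "\<lambda>s. \<phi> (s - t) * \<xi> s"
  have "?f \<in> Cc" by (intro Cc_mult_right Cc_compose_translate \<phi> dual_groupD(1)[OF \<xi>])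
  then have "?f \<in> borel_measurable borel"
    using Cc_continuous borel_measurable_continuous_onI by blast
  then have "(\<integral>s. ?f s \<partial>haar) = (\<integral>s. ?f (t + s) \<partial>haar)" by (rule integral_translate[symmetric])
  also have "\<dots> = (\<integral>s. \<xi> t * (\<phi> s * \<xi> s) \<partial>haar)"
    by (simp add: dual_groupD(3)[OF \<xi>] mult_ac)
  finally show ?thesis unfolding char_measure_def by simp
qed

lemma conv_fun_char_measure:
  assumes \<xi>: "\<xi> \<in> dual_group" and \<phi>: "\<phi> \<in> Cc"
  shows "conv_fun (char_measure \<xi>) \<phi> t = char_measure \<xi> (\<lambda>s. \<phi> (- s)) * \<xi> t"
  using char_measure_translate[OF \<xi> Cc_compose_uminus[OF \<phi>], of t]
  by (simp add: conv_fun_def mult.commute)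

text \<open>For \<phi> equal to a bump function times the conjugate of \<xi>, the integral is that
  of the bump function, which is 1 on a nonempty open set and therefore has positive Haar
  integral.\<close>

lemma ex_char_measure_nonzero:
  assumes \<xi>: "\<xi> \<in> dual_group"
  shows "\<exists>\<phi>\<in>Cc. char_measure \<xi> \<phi> \<noteq> 0"
proof -
  obtain h :: "'a \<Rightarrow> real" and W where h: "continuous_on UNIV h" "\<And>x. 0 \<le> h x" "\<And>x. h x \<le> 1"
    "open W" "{0} \<subseteq> W" "\<And>x. x \<in> W \<Longrightarrow> h x = 1" "compact (closure {x. h x \<noteq> 0})" "closure {x. h x \<noteq> 0} \<subseteq> UNIV"
    by (rule lc_bump[OF lc compact_sing open_UNIV subset_UNIV]) blast
  let ?\<phi> = "\<lambda>x. complex_of_real (h x) * cnj (\<xi> x)"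
  have hC: "(\<lambda>x. complex_of_real (h x)) \<in> Cc" using h by (auto simp: Cc_def intro: continuous_intros)
  have \<phi>: "?\<phi> \<in> Cc" by (intro Cc_mult_right hC continuous_intros dual_groupD(1)[OF \<xi>])
  have int: "integrable haar h"
    using Cc_integrable[OF hC] by (simp only: complex_of_real_integrable_eq)
  have "?\<phi> x * \<xi> x = complex_of_real (h x)" for x
  proof -
    have "cnj (\<xi> x) * \<xi> x = 1"
      using dual_groupD(2)[OF \<xi>, of x] complex_norm_square[of "\<xi> x"] by (simp add: mult.commute)
    then show ?thesis by (simp add: mult.assoc)
  qed
  then have "char_measure \<xi> ?\<phi> = complex_of_real (\<integral>x. h x \<partial>haar)"
    unfolding char_measure_def by (simp only: integral_complex_of_real)
  moreover have "(\<integral>x. h x \<partial>haar) \<noteq> 0"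
  proof
    assume "(\<integral>x. h x \<partial>haar) = 0"
    then have "AE x in haar. h x = 0"
      using integral_nonneg_eq_0_iff_AE[OF int] h(2) by simp
    then have "AE x in haar. x \<notin> W" using h(6) by (auto elim!: eventually_mono)
    then have "emeasure haar W = 0"
      using h(4) AE_iff_measurable[of W haar "\<lambda>x. x \<notin> W"] by simp
    then show False using emeasure_open_pos[OF h(4)] h(5) by blast
  qed
  ultimately show ?thesis using \<phi> by (intro bexI[of _ ?\<phi>]) auto
qed

end

section \<open>Smoothing\<close>

context lc_haar
begin

lemma integrable_on_rel_compact:
  fixes f :: "'a \<Rightarrow> 'b::{banach, second_countable_topology}"
  assumes U: "open U" "compact (closure U)" and f: "continuous_on UNIV f" "\<forall>x. norm (f x) \<le> B"
  shows "integrable haar (\<lambda>x. indicator U x *\<^sub>R f x)"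
proof (rule integrableI_bounded_set_indicator)
  show "f \<in> borel_measurable haar"
    unfolding borel_measurable_haar by (rule borel_measurable_continuous_onI[OF f(1)])
qed (use U f emeasure_rel_compact in auto)

text \<open>If \<open>F\<close> varies by at most \<open>\<delta>\<close> over translates of \<open>U\<close>, then \<open>F\<close> is within \<open>\<delta>\<close> of its \<open>U\<close>-average,
  and the averages of \<open>F\<close> and \<open>P\<close> differ by at most the average of \<open>|F - P|\<close>.\<close>

lemma smoothing_bound:
  fixes F P :: "'a \<Rightarrow> complex"
  assumes U: "open U" "compact (closure U)" and u: "u = measure haar U" "0 < u"
    and F: "continuous_on UNIV F" "\<forall>x. norm (F x) \<le> S" "\<forall>x. \<forall>v\<in>U. norm (F (x + v) - F x) \<le> \<delta>"
    and P: "continuous_on UNIV P" "\<forall>x. norm (P x) \<le> T"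
  shows "ennreal (max 0 (norm (F t - (1/u) *\<^sub>R (\<integral>v. indicator U v *\<^sub>R P (t + v) \<partial>haar)) - \<delta>)) \<le>
    (\<integral>\<^sup>+x. ennreal (norm (F x - P x) / u) * indicator ((+) t ` U) x \<partial>haar)"
proof -
  have tr: "continuous_on UNIV (\<lambda>v. g (t + v))" if "continuous_on UNIV g" for g :: "'a \<Rightarrow> 'b::topological_space"
    by (rule continuous_on_compose2[OF that]) (auto intro!: continuous_intros)
  define H where "H = (\<lambda>x. norm (F x - P x))"
  have contH: "continuous_on UNIV H" unfolding H_def by (intro continuous_intros F P)
  have boundH: "norm (H x) \<le> S + T" for x
    unfolding H_def using norm_triangle_ineq4[of "F x" "P x"] F(2)[rule_format, of x] P(2)[rule_format, of x] by simp
  \<comment> \<open>The \<open>U\<close>-average of \<open>P\<close> at \<open>t\<close>. Writing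
    \<open>F t\<close> as the \<open>U\<close>-average of a constant turns \<open>F t - Q\<close>
    into a single integral over \<open>U\<close>.\<close>
  define Q where "Q = (1/u) *\<^sub>R (\<integral>v. indicator U v *\<^sub>R P (t + v) \<partial>haar)"
  have iU: "integrable haar (indicator U :: 'a \<Rightarrow> real)"
    using U emeasure_rel_compact[of U] by (intro integrable_real_indicator) auto
  have intU: "(\<integral>v. indicator U v \<partial>haar) = u" by (simp add: u)
  have iP: "integrable haar (\<lambda>v. indicator U v *\<^sub>R P (t + v))"
    using P(2) by (intro integrable_on_rel_compact[where B=T] U tr P) auto
  have iH: "integrable haar (\<lambda>v. indicator U v *\<^sub>R H (t + v))"
    using boundH by (intro integrable_on_rel_compact[where B="S + T"] U tr contH) auto
  have iF: "integrable haar (\<lambda>v. indicator U v *\<^sub>R F t)"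
    using iU by (intro integrable_scaleR_left) auto
  have "u *\<^sub>R (F t - Q) = u *\<^sub>R F t - (\<integral>v. indicator U v *\<^sub>R P (t + v) \<partial>haar)"
    unfolding Q_def using u(2) by (simp add: scaleR_diff_right)
  also have "u *\<^sub>R F t = (\<integral>v. indicator U v *\<^sub>R F t \<partial>haar)"
    using iU intU by simp
  also have "\<dots> - (\<integral>v. indicator U v *\<^sub>R P (t + v) \<partial>haar) = (\<integral>v. indicator U v *\<^sub>R F t - indicator U v *\<^sub>R P (t + v) \<partial>haar)"
    by (rule Bochner_Integration.integral_diff[symmetric, OF iF iP])
  finally have eq: "u *\<^sub>R (F t - Q) = (\<integral>v. indicator U v *\<^sub>R F t - indicator U v *\<^sub>R P (t + v) \<partial>haar)" .
  have "u * norm (F t - Q) = norm (u *\<^sub>R (F t - Q))" using u(2) by simp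
  also have "\<dots> \<le> (\<integral>v. norm (indicator U v *\<^sub>R F t - indicator U v *\<^sub>R P (t + v)) \<partial>haar)"
    unfolding eq by (rule integral_norm_bound)
  also have "\<dots> \<le> (\<integral>v. indicator U v *\<^sub>R \<delta> + indicator U v *\<^sub>R H (t + v) \<partial>haar)"
  proof (rule integral_mono)
    show "integrable haar (\<lambda>v. norm (indicator U v *\<^sub>R F t - indicator U v *\<^sub>R P (t + v)))"
      by (intro integrable_norm Bochner_Integration.integrable_diff iF iP)
    show "integrable haar (\<lambda>v. indicator U v *\<^sub>R \<delta> + indicator U v *\<^sub>R H (t + v))"
      using iU by (intro Bochner_Integration.integrable_add iH integrable_scaleR_left) auto
    show "norm (indicator U v *\<^sub>R F t - indicator U v *\<^sub>R P (t + v)) \<le> indicator U v *\<^sub>R \<delta> + indicator U v *\<^sub>R H (t + v)" for v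
    proof (cases "v \<in> U")
      case True
      have "norm (F t - P (t + v)) \<le> norm (F (t + v) - F t) + norm (F (t + v) - P (t + v))"
        using norm_triangle_ineq4[of "F (t + v) - P (t + v)" "F (t + v) - F t"] by simp
      then show ?thesis using F(3)[rule_format, OF True, of t] True by (simp add: H_def)
    qed simp
  qed
  also have "\<dots> = u * \<delta> + (\<integral>v. indicator U v *\<^sub>R H (t + v) \<partial>haar)"
    using iU intU iH by (subst Bochner_Integration.integral_add) (auto intro!: integrable_scaleR_left)
  finally have main: "norm (F t - Q) - \<delta> \<le> (\<integral>v. indicator U v *\<^sub>R H (t + v) \<partial>haar) / u"
    using u(2) by (simp add: field_simps)
  have pos: "0 \<le> (\<integral>v. indicator U v *\<^sub>R H (t + v) \<partial>haar) / u"
    using u(2) by (intro divide_nonneg_pos integral_nonneg) (auto simp: H_def)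
  have "ennreal (max 0 (norm (F t - Q) - \<delta>)) \<le> ennreal ((\<integral>v. indicator U v *\<^sub>R H (t + v) \<partial>haar) / u)"
    using main pos by (intro ennreal_leI) simp
  also have "\<dots> = ennreal (\<integral>v. indicator U v *\<^sub>R H (t + v) / u \<partial>haar)" by simp
  also have "\<dots> = (\<integral>\<^sup>+v. ennreal (indicator U v *\<^sub>R H (t + v) / u) \<partial>haar)"
    using iH u(2) by (intro nn_integral_eq_integral[symmetric]) (auto simp: H_def)
  also have "\<dots> = (\<integral>\<^sup>+v. ennreal (H (t + v) / u) * indicator ((+) t ` U) (t + v) \<partial>haar)"
    by (intro nn_integral_cong) (simp add: indicator_def translate_eq_vimage)
  also have "\<dots> = (\<integral>\<^sup>+x. ennreal (H x / u) * indicator ((+) t ` U) x \<partial>haar)"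
  proof (rule nn_integral_translate)
    have "H \<in> borel_measurable borel" using contH by (rule borel_measurable_continuous_onI)
    then show "(\<lambda>x. ennreal (H x / u) * indicator ((+) t ` U) x) \<in> borel_measurable borel"
      using U by (intro borel_measurable_times_ennreal borel_measurable_indicator) auto
  qed
  finally show ?thesis unfolding Q_def H_def .
qed

text \<open>Multiplicativity of \<xi> separates \<open>t\<close> from \<open>v\<close>: averaging
  over \<open>U\<close> keeps the frequencies and multiplies each coefficient by the integral of
  \<xi> over \<open>U\<close>.\<close>

lemma trigonometric_average:
  assumes \<Xi>: "finite \<Xi>" "\<Xi> \<subseteq> dual_group" and U: "open U" "compact (closure U)"
  shows "(\<integral>v. indicator U v *\<^sub>R (\<Sum>\<xi>\<in>\<Xi>. c \<xi> * \<xi> (t + v)) \<partial>haar) =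
    (\<Sum>\<xi>\<in>\<Xi>. c \<xi> * (\<integral>v. indicator U v *\<^sub>R \<xi> v \<partial>haar) * \<xi> t)"
proof -
  have int: "integrable haar (\<lambda>v. indicator U v *\<^sub>R \<xi> v)" if "\<xi> \<in> \<Xi>" for \<xi>
  proof (rule integrable_on_rel_compact[OF U])
    show "continuous_on UNIV \<xi>" "\<forall>x. norm (\<xi> x) \<le> 1"
      using that \<Xi> dual_groupD[of \<xi>] by auto
  qed
  have "(\<integral>v. indicator U v *\<^sub>R (\<Sum>\<xi>\<in>\<Xi>. c \<xi> * \<xi> (t + v)) \<partial>haar) =
      (\<integral>v. (\<Sum>\<xi>\<in>\<Xi>. (c \<xi> * \<xi> t) * (indicator U v *\<^sub>R \<xi> v)) \<partial>haar)"
  proof (rule Bochner_Integration.integral_cong[OF refl])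
    fix v
    have "indicator U v *\<^sub>R (\<Sum>\<xi>\<in>\<Xi>. c \<xi> * \<xi> (t + v)) = (\<Sum>\<xi>\<in>\<Xi>. indicator U v *\<^sub>R (c \<xi> * \<xi> (t + v)))"
      by (rule scaleR_sum_right)
    also have "\<dots> = (\<Sum>\<xi>\<in>\<Xi>. (c \<xi> * \<xi> t) * (indicator U v *\<^sub>R \<xi> v))"
      using \<Xi>(2) by (intro sum.cong refl) (auto simp: dual_groupD(3) mult.assoc)
    finally show "indicator U v *\<^sub>R (\<Sum>\<xi>\<in>\<Xi>. c \<xi> * \<xi> (t + v)) = (\<Sum>\<xi>\<in>\<Xi>. (c \<xi> * \<xi> t) * (indicator U v *\<^sub>R \<xi> v))" .
  qed
  also have "\<dots> = (\<Sum>\<xi>\<in>\<Xi>. (\<integral>v. (c \<xi> * \<xi> t) * (indicator U v *\<^sub>R \<xi> v) \<partial>haar))"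
    using int by (intro Bochner_Integration.integral_sum integrable_mult_right) auto
  also have "\<dots> = (\<Sum>\<xi>\<in>\<Xi>. c \<xi> * (\<integral>v. indicator U v *\<^sub>R \<xi> v \<partial>haar) * \<xi> t)"
    by (simp only: integral_mult_right_zero) (simp add: mult_ac)
  finally show ?thesis .
qed

end

section \<open>From quadratic Haar means to means against \<nu>\<close>

context vh
begin

text \<open>The pointwise inequality |f| \<le> |f|^2 / (2 \<kappa>) + \<kappa> / 2 is integrated
  over \<open>A n\<close>; both terms contribute at most half of \<open>\<kappa> * m n\<close>. It
  plays the part of the Cauchy-Schwarz inequality.\<close>

lemma set_average_le:
  assumes f: "continuous_on UNIV f" "\<forall>x. norm (f x) \<le> S" and \<kappa>: "0 < \<kappa>"
    and le: "1 / m n * (LINT t:A n|haar. (norm (f t :: complex))\<^sup>2) \<le> \<kappa>\<^sup>2"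
  shows "(\<integral>\<^sup>+x. ennreal (norm (f x)) * indicator (A n) x \<partial>haar) \<le> ennreal (\<kappa> * m n)"
proof -
  have int1: "integrable haar (\<lambda>x. indicator (A n) x *\<^sub>R norm (f x))"
    using f by (intro integrable_on_rel_compact[where B=S] averaging_sets continuous_intros) auto
  have int2: "integrable haar (\<lambda>x. indicator (A n) x *\<^sub>R (norm (f x))\<^sup>2)"
    using f by (intro integrable_on_rel_compact[where B="S\<^sup>2"] averaging_sets continuous_intros) (auto intro: power_mono)
  have iA: "integrable haar (indicator (A n) :: 'a \<Rightarrow> real)"
    using averaging_sets emeasure_rel_compact[of "A n"] by (intro integrable_real_indicator) auto
  have "(\<integral>x. indicator (A n) x *\<^sub>R norm (f x) \<partial>haar) \<le>
      (\<integral>x. (1 / (2 * \<kappa>)) * (indicator (A n) x *\<^sub>R (norm (f x))\<^sup>2) + (\<kappa> / 2) * indicator (A n) x \<partial>haar)"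
  proof (rule integral_mono[OF int1])
    show "integrable haar (\<lambda>x. (1 / (2 * \<kappa>)) * (indicator (A n) x *\<^sub>R (norm (f x))\<^sup>2) + (\<kappa> / 2) * indicator (A n) x)"
      using int2 iA by (intro Bochner_Integration.integrable_add integrable_mult_right) auto
    show "indicator (A n) x *\<^sub>R norm (f x) \<le>
        (1 / (2 * \<kappa>)) * (indicator (A n) x *\<^sub>R (norm (f x))\<^sup>2) + (\<kappa> / 2) * indicator (A n) x" for x
    proof -
      have "norm (f x) * (2 * \<kappa>) \<le> (norm (f x))\<^sup>2 + \<kappa>\<^sup>2"
        using sum_squares_bound[of "norm (f x)" \<kappa>] by (simp add: mult_ac)
      then have "norm (f x) \<le> (1 / (2 * \<kappa>)) * (norm (f x))\<^sup>2 + \<kappa> / 2"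
        using \<kappa> by (simp add: field_simps power2_eq_square)
      then show ?thesis by (simp add: indicator_def)
    qed
  qed
  also have "\<dots> = (1 / (2 * \<kappa>)) * (LINT t:A n|haar. (norm (f t))\<^sup>2) + (\<kappa> / 2) * m n"
    using int2 iA by (subst Bochner_Integration.integral_add) (auto simp: set_lebesgue_integral_def)
  also have "\<dots> \<le> (1 / (2 * \<kappa>)) * (\<kappa>\<^sup>2 * m n) + (\<kappa> / 2) * m n"
    using le \<kappa> averaging_sets(3)[of n] by (intro add_right_mono mult_left_mono) (auto simp: field_simps)
  also have "\<dots> = \<kappa> * m n" using \<kappa> by (simp add: power2_eq_square)
  finally have real: "(\<integral>x. indicator (A n) x *\<^sub>R norm (f x) \<partial>haar) \<le> \<kappa> * m n" .
  have "(\<integral>\<^sup>+x. ennreal (norm (f x)) * indicator (A n) x \<partial>haar) = (\<integral>\<^sup>+x. ennreal (indicator (A n) x *\<^sub>R norm (f x)) \<partial>haar)"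
    by (intro nn_integral_cong) (simp add: indicator_def)
  also have "\<dots> = ennreal (\<integral>x. indicator (A n) x *\<^sub>R norm (f x) \<partial>haar)"
    using int1 by (intro nn_integral_eq_integral) auto
  finally show ?thesis using real by (simp add: ennreal_leI)
qed

lemma trigonometric_average_vanishes:
  assumes N: "tb_radon haar \<nu>" and FB: "\<forall>\<xi>\<in>dual_group. has_fourier_bohr_coeff haar A \<nu> \<xi> 0"
    and \<Xi>: "finite \<Xi>" "\<Xi> \<subseteq> dual_group" and "0 < \<epsilon>"
  shows "\<forall>\<^sub>F n in sequentially.
    norm (radon_integral \<nu> (\<lambda>t. indicator (A n) t * cnj (\<Sum>\<xi>\<in>\<Xi>. d \<xi> * \<xi> t))) \<le> \<epsilon> * m n"
proof -
  interpret N: tb_radon haar \<nu> by fact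
  let ?I = "\<lambda>\<xi> n. radon_integral \<nu> (\<lambda>t. indicator (A n) t * cnj (\<xi> t))"
  have eq: "radon_integral \<nu> (\<lambda>t. indicator (A n) t * cnj (\<Sum>\<xi>\<in>\<Xi>. d \<xi> * \<xi> t)) = (\<Sum>\<xi>\<in>\<Xi>. cnj (d \<xi>) * ?I \<xi> n)" for n
  proof (rule N.radon_integral_eqI, rule N.has_radon_integral_cong[OF N.has_radon_integral_sum[OF N.has_radon_integral_scale]])
    show "has_radon_integral \<nu> (\<lambda>t. indicator (A n) t * cnj (\<xi> t)) (?I \<xi> n)" if "\<xi> \<in> \<Xi>" for \<xi>
      using that \<Xi> dual_groupD(1)[of \<xi>] by (intro N.has_radon_integral_open averaging_sets continuous_intros) auto
    show "(\<Sum>\<xi>\<in>\<Xi>. cnj (d \<xi>) * (indicator (A n) t * cnj (\<xi> t))) = indicator (A n) t * cnj (\<Sum>\<xi>\<in>\<Xi>. d \<xi> * \<xi> t)" for t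
      by (simp add: sum_distrib_left mult_ac)
  qed
  have "(\<lambda>n. \<Sum>\<xi>\<in>\<Xi>. cnj (d \<xi>) * (complex_of_real (1 / m n) * ?I \<xi> n)) \<longlonglongrightarrow> (\<Sum>\<xi>\<in>\<Xi>. cnj (d \<xi>) * 0)"
    using FB \<Xi>(2) unfolding has_fourier_bohr_coeff_def by (intro tendsto_sum tendsto_mult_left) blast
  moreover have "(\<Sum>\<xi>\<in>\<Xi>. cnj (d \<xi>) * (complex_of_real (1 / m n) * ?I \<xi> n)) =
      complex_of_real (1 / m n) * (\<Sum>\<xi>\<in>\<Xi>. cnj (d \<xi>) * ?I \<xi> n)" for n
    by (simp add: sum_distrib_left mult_ac)
  ultimately have "(\<lambda>n. complex_of_real (1 / m n) * (\<Sum>\<xi>\<in>\<Xi>. cnj (d \<xi>) * ?I \<xi> n)) \<longlonglongrightarrow> 0" by simp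
  then show ?thesis unfolding average_tendsto_0_iff eq using \<open>0 < \<epsilon>\<close> by blast
qed

text \<open>The neighbourhood \<open>U\<close> has to be chosen before the trigonometric polynomial \<open>P\<close>, since the
  comparison constant depends on \<open>U\<close>; \<open>P\<close> is therefore replaced by its \<open>U\<close>-average rather than
  controlled through its own modulus of continuity.\<close>

lemma besicovitch_average_vanishes:
  assumes N: "tb_radon haar \<nu>" and FB: "\<forall>\<xi>\<in>dual_group. has_fourier_bohr_coeff haar A \<nu> \<xi> 0"
    and F: "ucont F" "\<forall>t. norm (F t) \<le> S" and ap: "besicovitch_2_ap_fun haar A F" and \<epsilon>: "0 < \<epsilon>"
  shows "\<forall>\<^sub>F n in sequentially. norm (radon_integral \<nu> (\<lambda>t. indicator (A n) t * cnj (F t))) \<le> \<epsilon> * m n"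
proof -
  interpret N: tb_radon haar \<nu> by fact
  interpret N: vh_radon haar A \<nu> ..
  have contF: "continuous_on UNIV F" using F(1) by (rule ucont_continuous)
  obtain C0 where C0: "0 \<le> C0"
    "\<forall>\<^sub>F n in sequentially. emeasure (total_variation \<nu>) (A n) \<le> ennreal (C0 * m n)"
    using N.TV_A_le by blast
  \<comment> \<open>One of three errors of size \<open>\<epsilon> / 3 * m n\<close>: \<delta> times
    the |\<nu>|-mass of \<open>A n\<close>, the smoothed difference controlled by \<kappa>, and the
    mean of \<open>Q\<close>. Adding 1 to \<open>C0\<close> avoids division by zero.\<close>
  define \<delta> where "\<delta> = \<epsilon> / (3 * (C0 + 1))"
  have \<delta>: "0 < \<delta>" using \<epsilon> C0(1) by (simp add: \<delta>_def)
  obtain U0 where U0: "open U0" "0 \<in> U0" "\<forall>x. \<forall>v\<in>U0. norm (F (x + v) - F x) \<le> \<delta>"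
    using F(1) \<delta> unfolding ucont_def by blast
  obtain N :: "'a set" where N': "open N" "0 \<in> N" "compact (closure N)" using ex_nbhd by blast
  \<comment> \<open>Intersecting with \<open>N\<close> makes the closure compact, as the comparison
    with Haar measure requires.\<close>
  define U where "U = U0 \<inter> N"
  have "U \<subseteq> closure N" using closure_subset[of N] by (auto simp: U_def)
  then have U: "open U" "0 \<in> U" "compact (closure U)"
    using U0 N' closure_subset_compact by (auto simp: U_def)
  have FU: "\<forall>x. \<forall>v\<in>U. norm (F (x + v) - F x) \<le> \<delta>" using U0(3) by (simp add: U_def)
  define u where "u = measure haar U"
  have u: "0 < u"
    using emeasure_open_pos[of U] U emeasure_rel_compact[of U] unfolding u_def
    by (auto simp: emeasure_eq_ennreal_measure less_top zero_less_measure_iff)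
  obtain C where C: "0 \<le> C" "\<forall>h H S \<kappa>. h \<in> borel_measurable borel \<longrightarrow> H \<in> borel_measurable borel \<longrightarrow>
    (\<forall>x. 0 \<le> H x \<and> H x \<le> S) \<longrightarrow> 0 < \<kappa> \<longrightarrow>
    (\<forall>t. ennreal (h t) \<le> (\<integral>\<^sup>+x. ennreal (H x) * indicator ((+) t ` U) x \<partial>haar)) \<longrightarrow>
    (\<forall>\<^sub>F n in sequentially. (\<integral>\<^sup>+x. ennreal (H x) * indicator (A n) x \<partial>haar) \<le> ennreal (\<kappa> * m n)) \<longrightarrow>
    (\<forall>\<^sub>F n in sequentially. (\<integral>\<^sup>+t. ennreal (h t) * indicator (A n) t \<partial>total_variation \<nu>) \<le> ennreal (C * \<kappa> * m n))"
    using N.TV_smoothed_average[OF U] by blast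
  define \<kappa> where "\<kappa> = \<epsilon> / (3 * (C + 1))"
  have \<kappa>: "0 < \<kappa>" using \<epsilon> C(1) by (simp add: \<kappa>_def)
  \<comment> \<open>The factor \<open>u\<close> compensates the normalisation of the
    \<open>U\<close>-average: a quadratic mean below the square of \<open>\<kappa> * u\<close> makes
    the mean of |F - P| / u at most \<kappa>.\<close>
  have "0 < (\<kappa> * u)\<^sup>2" using \<kappa> u by simp
  then obtain \<Xi> c where \<Xi>: "finite \<Xi>" "\<Xi> \<subseteq> dual_group" and
    ls: "limsup (\<lambda>n. ereal (1 / m n * (LINT t:A n|haar. (norm (F t - (\<Sum>\<xi>\<in>\<Xi>. c \<xi> * \<xi> t)))\<^sup>2))) < ereal ((\<kappa> * u)\<^sup>2)"
    using ap unfolding besicovitch_2_ap_fun_def by meson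
  define P where "P = (\<lambda>t. \<Sum>\<xi>\<in>\<Xi>. c \<xi> * \<xi> t)"
  have contP: "continuous_on UNIV P"
    unfolding P_def using \<Xi>(2) by (intro continuous_intros dual_groupD(1)) auto
  define T where "T = (\<Sum>\<xi>\<in>\<Xi>. norm (c \<xi>))"
  have boundP: "norm (P x) \<le> T" for x
    unfolding P_def T_def using \<Xi>(2) by (intro sum_norm_le) (auto simp: norm_mult dual_groupD(2))
  have contFP: "continuous_on UNIV (\<lambda>x. F x - P x)" by (intro continuous_intros contF contP)
  have boundFP: "norm (F x - P x) \<le> S + T" for x
    using norm_triangle_ineq4[of "F x" "P x"] F(2)[rule_format, of x] boundP[of x] by simp
  \<comment> \<open>The coefficients of the normalised \<open>U\<close>-average of \<open>P\<close>,
    as computed in \<open>trigonometric_average\<close>.\<close>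
  define d where "d = (\<lambda>\<xi>. (1/u) *\<^sub>R (c \<xi> * (\<integral>v. indicator U v *\<^sub>R \<xi> v \<partial>haar)))"
  define Q where "Q = (\<lambda>t. \<Sum>\<xi>\<in>\<Xi>. d \<xi> * \<xi> t)"
  have contQ: "continuous_on UNIV Q"
    unfolding Q_def using \<Xi>(2) by (intro continuous_intros dual_groupD(1)) auto
  have Q: "Q t = (1/u) *\<^sub>R (\<integral>v. indicator U v *\<^sub>R P (t + v) \<partial>haar)" for t
    unfolding P_def Q_def d_def trigonometric_average[OF \<Xi> U(1,3)] by (simp add: scaleR_sum_right)
  \<comment> \<open>The excess of |F - Q| over \<delta>. Subtracting the oscillation of
    \<open>F\<close> leaves a quantity dominated by the \<open>U\<close>-average of |F - P|, and
    truncation at 0 still gives |F - Q| \<le> \<delta> + h.\<close>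
  define h where "h = (\<lambda>t. max 0 (norm (F t - Q t) - \<delta>))"
  have "continuous_on UNIV h" unfolding h_def by (intro continuous_intros contF contQ)
  then have hm: "h \<in> borel_measurable borel" by (rule borel_measurable_continuous_onI)
  have "\<forall>\<^sub>F n in sequentially. 1 / m n * (LINT t:A n|haar. (norm (F t - P t))\<^sup>2) < (\<kappa> * u)\<^sup>2"
    using Limsup_lessD[OF ls] unfolding P_def by simp
  then have avg: "\<forall>\<^sub>F n in sequentially. (\<integral>\<^sup>+x. ennreal (norm (F x - P x) / u) * indicator (A n) x \<partial>haar) \<le> ennreal (\<kappa> * m n)"
  proof eventually_elim
    case (elim n)
    have "(\<integral>\<^sup>+x. ennreal (norm (F x - P x) / u) * indicator (A n) x \<partial>haar) =
        (\<integral>\<^sup>+x. ennreal (1/u) * (ennreal (norm (F x - P x)) * indicator (A n) x) \<partial>haar)"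
    proof (intro nn_integral_cong)
      fix x
      have "ennreal (norm (F x - P x) / u) = ennreal (1/u) * ennreal (norm (F x - P x))"
        using u by (simp add: ennreal_mult[symmetric])
      then show "ennreal (norm (F x - P x) / u) * indicator (A n) x =
          ennreal (1/u) * (ennreal (norm (F x - P x)) * indicator (A n) x)" by (simp add: mult.assoc)
    qed
    also have "\<dots> = ennreal (1/u) * (\<integral>\<^sup>+x. ennreal (norm (F x - P x)) * indicator (A n) x \<partial>haar)"
      using averaging_sets(1)[of n] borel_measurable_continuous_onI[OF contFP]
      by (intro nn_integral_cmult) (auto simp: borel_measurable_haar)
    also have "\<dots> \<le> ennreal (1/u) * ennreal ((\<kappa> * u) * m n)"
      using elim \<kappa> u boundFP by (intro mult_left_mono set_average_le[OF contFP, of "S + T"]) auto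
    also have "\<dots> = ennreal (\<kappa> * m n)" using u \<kappa> averaging_sets(3)[of n] by (simp add: ennreal_mult[symmetric])
    finally show ?case .
  qed
  have small: "\<forall>\<^sub>F n in sequentially. (\<integral>\<^sup>+t. ennreal (h t) * indicator (A n) t \<partial>total_variation \<nu>) \<le> ennreal (C * \<kappa> * m n)"
  proof (rule C(2)[rule_format, of h "\<lambda>x. norm (F x - P x) / u" "(S + T) / u"])
    show "(\<lambda>x. norm (F x - P x) / u) \<in> borel_measurable borel"
      using u by (intro borel_measurable_continuous_onI continuous_intros contF contP) auto
    show "0 \<le> norm (F x - P x) / u \<and> norm (F x - P x) / u \<le> (S + T) / u" for x
      using u boundFP[of x] by (auto intro: divide_right_mono)
    show "ennreal (h t) \<le> (\<integral>\<^sup>+x. ennreal (norm (F x - P x) / u) * indicator ((+) t ` U) x \<partial>haar)" for t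
      unfolding h_def Q
      by (rule smoothing_bound[OF U(1,3) u_def u contF F(2) FU contP, of T]) (use boundP in simp)
  qed (use hm \<kappa> avg in auto)
  have "0 < \<epsilon> / 3" using \<epsilon> by simp
  from C0(2) small trigonometric_average_vanishes[OF N FB \<Xi> this, of d]
  show ?thesis
  proof eventually_elim
    case (elim n)
    let ?I = "\<lambda>g. radon_integral \<nu> (\<lambda>t. indicator (A n) t * cnj (g t))"
    have HF: "has_radon_integral \<nu> (\<lambda>t. indicator (A n) t * cnj (g t)) (?I g)" if "continuous_on UNIV g" for g
      using that by (intro N.has_radon_integral_open averaging_sets continuous_intros)
    have "ennreal (norm (?I F - ?I Q)) \<le>
        (\<integral>\<^sup>+t. ennreal (norm (indicator (A n) t * cnj (F t) - indicator (A n) t * cnj (Q t))) \<partial>total_variation \<nu>)"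
      by (rule N.has_radon_integral_bound[OF N.has_radon_integral_diff[OF HF[OF contF] HF[OF contQ]]])
    also have "\<dots> \<le> (\<integral>\<^sup>+t. ennreal \<delta> * indicator (A n) t + ennreal (h t) * indicator (A n) t \<partial>total_variation \<nu>)"
    proof (rule nn_integral_mono)
      fix t
      show "ennreal (norm (indicator (A n) t * cnj (F t) - indicator (A n) t * cnj (Q t))) \<le>
          ennreal \<delta> * indicator (A n) t + ennreal (h t) * indicator (A n) t"
      proof (cases "t \<in> A n")
        case True
        have "norm (cnj (F t) - cnj (Q t)) = norm (F t - Q t)"
          by (metis complex_cnj_diff complex_mod_cnj)
        also have "\<dots> \<le> \<delta> + h t" by (simp add: h_def)
        finally show ?thesis
          using True \<delta> by (simp add: ennreal_plus[symmetric] ennreal_leI h_def del: ennreal_plus)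
      qed simp
    qed
    also have "\<dots> = ennreal \<delta> * emeasure (total_variation \<nu>) (A n) +
        (\<integral>\<^sup>+t. ennreal (h t) * indicator (A n) t \<partial>total_variation \<nu>)"
      using averaging_sets(1)[of n] hm
      by (subst nn_integral_add) (auto simp: nn_integral_cmult_indicator N.borel_measurable_TV)
    also have "\<dots> \<le> ennreal \<delta> * ennreal (C0 * m n) + ennreal (C * \<kappa> * m n)"
      using elim by (intro add_mono mult_left_mono) auto
    also have "\<dots> = ennreal (\<delta> * (C0 * m n) + C * \<kappa> * m n)"
      using \<delta> \<kappa> C(1) C0(1) averaging_sets(3)[of n]
      by (subst ennreal_mult[symmetric], simp, simp, subst ennreal_plus) simp_all
    finally have "norm (?I F - ?I Q) \<le> \<delta> * (C0 * m n) + C * \<kappa> * m n"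
      using \<delta> \<kappa> C(1) C0(1) averaging_sets(3)[of n] by (subst (asm) ennreal_le_iff) auto
    also have "\<dots> \<le> \<epsilon> / 3 * m n + \<epsilon> / 3 * m n"
    proof -
      have "\<delta> * C0 \<le> \<epsilon> / 3" "C * \<kappa> \<le> \<epsilon> / 3"
        using \<epsilon> C(1) C0(1) by (simp_all add: \<delta>_def \<kappa>_def field_simps)
      then have "\<delta> * C0 * m n \<le> \<epsilon> / 3 * m n" "C * \<kappa> * m n \<le> \<epsilon> / 3 * m n"
        using averaging_sets(3)[of n] by (auto intro!: mult_right_mono simp del: times_divide_eq_left)
      then show ?thesis by (simp add: mult.assoc)
    qed
    finally have "norm (?I F - ?I Q) \<le> \<epsilon> / 3 * m n + \<epsilon> / 3 * m n" .
    moreover have "norm (?I Q) \<le> \<epsilon> / 3 * m n" using elim(3) unfolding Q_def .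
    moreover have "norm (?I F) \<le> norm (?I F - ?I Q) + norm (?I Q)"
      using norm_triangle_ineq[of "?I F - ?I Q" "?I Q"] by simp
    ultimately show ?case by simp
  qed
qed

section \<open>Characters as test measures\<close>

lemma char_measure_besicovitch:
  assumes \<xi>: "\<xi> \<in> dual_group"
  shows "besicovitch_ap_measure haar A (char_measure \<xi>)"
  unfolding besicovitch_ap_measure_def besicovitch_2_ap_fun_def
proof (intro conjI translation_bounded_char_measure \<xi> ballI allI impI)
  fix \<phi> :: "'a \<Rightarrow> complex" and \<epsilon> :: real assume \<phi>: "\<phi> \<in> Cc" and \<epsilon>: "0 < \<epsilon>"
  \<comment> \<open>The convolution is itself a multiple of \<xi> and serves as its own approximant,
    so the upper limit is 0. The coefficient contains the reflected \<phi> because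
    \<open>conv_fun\<close> integrates \<phi>(t - s).\<close>
  show "\<exists>\<Xi> c. finite \<Xi> \<and> \<Xi> \<subseteq> dual_group \<and> limsup (\<lambda>n. ereal (1 / m n *
      (LINT t:A n|haar. (norm (conv_fun (char_measure \<xi>) \<phi> t - (\<Sum>\<xi>\<in>\<Xi>. c \<xi> * \<xi> t)))\<^sup>2))) < ereal \<epsilon>"
    by (rule exI[of _ "{\<xi>}"], rule exI[of _ "\<lambda>_. char_measure \<xi> (\<lambda>s. \<phi> (- s))"])
      (use \<xi> \<epsilon> in \<open>simp add: conv_fun_char_measure[OF \<xi> \<phi>] zero_ereal_def Limsup_const\<close>)
qed

text \<open>For a \<phi> whose integral \<open>c\<close> against \<xi> times Haar measure is
  nonzero, the mean in \<open>has_eberlein_convolution_0_iff\<close> is \<open>cnj c\<close> times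
  the Fourier-Bohr mean, and the factor can be divided out.\<close>

lemma fourier_bohr_coeff_0:
  assumes N: "tb_radon haar \<nu>" and \<xi>: "\<xi> \<in> dual_group"
    and E: "has_eberlein_convolution haar A (char_measure \<xi>) \<nu> (\<lambda>\<phi>. 0)"
  shows "has_fourier_bohr_coeff haar A \<nu> \<xi> 0"
proof -
  interpret N: tb_radon haar \<nu> by fact
  obtain \<phi> where \<phi>: "\<phi> \<in> Cc" "char_measure \<xi> \<phi> \<noteq> 0" using ex_char_measure_nonzero[OF \<xi>] by blast
  define c where "c = char_measure \<xi> \<phi>"
  let ?I = "\<lambda>n. radon_integral \<nu> (\<lambda>t. indicator (A n) t * cnj (\<xi> t))"
  have c: "c \<noteq> 0" using \<phi> by (simp add: c_def)
  have eq: "radon_integral \<nu> (\<lambda>t. indicator (A n) t * cnj (char_measure \<xi> (\<lambda>s. \<phi> (s - t)))) = cnj c * ?I n" for n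
  proof (rule N.radon_integral_eqI, rule N.has_radon_integral_cong[OF N.has_radon_integral_scale])
    show "has_radon_integral \<nu> (\<lambda>t. indicator (A n) t * cnj (\<xi> t)) (?I n)"
      using dual_groupD(1)[OF \<xi>] by (intro N.has_radon_integral_open averaging_sets continuous_intros)
    show "cnj c * (indicator (A n) t * cnj (\<xi> t)) = indicator (A n) t * cnj (char_measure \<xi> (\<lambda>s. \<phi> (s - t)))" for t
      by (simp add: char_measure_translate[OF \<xi> \<phi>(1)] c_def mult_ac)
  qed
  have *: "\<forall>\<epsilon>>0. \<forall>\<^sub>F n in sequentially. norm (cnj c * ?I n) \<le> \<epsilon> * m n"
    using bspec[OF has_eberlein_convolution_0_iff[OF tb_radonI[OF translation_bounded_char_measure[OF \<xi>]] N, THEN iffD1, OF E] \<phi>(1)]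
    unfolding eq .
  show ?thesis
    unfolding has_fourier_bohr_coeff_def average_tendsto_0_iff
  proof (intro allI impI)
    fix \<epsilon> :: real assume "0 < \<epsilon>"
    then have "0 < norm c * \<epsilon>" using c by simp
    with * have "\<forall>\<^sub>F n in sequentially. norm (cnj c * ?I n) \<le> norm c * \<epsilon> * m n" by blast
    then show "\<forall>\<^sub>F n in sequentially. norm (?I n) \<le> \<epsilon> * m n"
    proof eventually_elim
      case (elim n)
      then have "norm c * norm (?I n) \<le> norm c * (\<epsilon> * m n)" by (simp add: norm_mult mult.assoc)
      then show ?case using c by simp
    qed
  qed
qed

end

theorem corollary10p2:
  fixes haar :: "'a::{t2_space, topological_ab_group_add} measure"
    and A :: "nat \<Rightarrow> 'a set"
    and \<nu> :: "('a \<Rightarrow> complex) \<Rightarrow> complex"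
  assumes "sigma_compact_lca TYPE('a)"
    and "haar_measure haar"
    and "van_Hove haar A"
    and "translation_bounded \<nu>"
  shows "(\<forall>\<mu>. besicovitch_ap_measure haar A \<mu> \<longrightarrow>
              has_eberlein_convolution haar A \<mu> \<nu> (\<lambda>\<phi>. 0)) \<longleftrightarrow>
         (\<forall>\<xi>\<in>dual_group. has_fourier_bohr_coeff haar A \<nu> \<xi> 0)"
proof -
  interpret vh haar A
    using assms by unfold_locales (auto simp: sigma_compact_lca_def)
  have N: "tb_radon haar \<nu>" using assms(4) by (rule tb_radonI)
  show ?thesis
  proof (intro iffI ballI allI impI)
    fix \<xi> :: "'a \<Rightarrow> complex"
    assume "\<forall>\<mu>. besicovitch_ap_measure haar A \<mu> \<longrightarrow> has_eberlein_convolution haar A \<mu> \<nu> (\<lambda>\<phi>. 0)"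
      and \<xi>: "\<xi> \<in> dual_group"
    then have "has_eberlein_convolution haar A (char_measure \<xi>) \<nu> (\<lambda>\<phi>. 0)"
      using char_measure_besicovitch by blast
    then show "has_fourier_bohr_coeff haar A \<nu> \<xi> 0"
      by (rule fourier_bohr_coeff_0[OF N \<xi>])
  next
    fix \<mu> :: "('a \<Rightarrow> complex) \<Rightarrow> complex"
    assume FB: "\<forall>\<xi>\<in>dual_group. has_fourier_bohr_coeff haar A \<nu> \<xi> 0"
      and ap: "besicovitch_ap_measure haar A \<mu>"
    then have M: "tb_radon haar \<mu>" by (intro tb_radonI) (simp add: besicovitch_ap_measure_def)
    then interpret M: tb_radon haar \<mu> .
    show "has_eberlein_convolution haar A \<mu> \<nu> (\<lambda>\<phi>. 0)"
      unfolding has_eberlein_convolution_0_iff[OF M N]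
    proof (intro ballI allI impI)
      fix \<phi> :: "'a \<Rightarrow> complex" and \<epsilon> :: real assume \<phi>: "\<phi> \<in> Cc" and \<epsilon>: "0 < \<epsilon>"
      obtain S where S: "\<forall>t. norm (\<mu> (\<lambda>s. \<phi> (s - t))) \<le> S" using M.conv_bounded[OF \<phi>] by blast
      \<comment> \<open>Almost periodicity is applied to the reflection of \<phi>, since
        \<open>conv_fun\<close> uses \<phi>(t - s) while the reduced convolution contains \<phi>(s -
        t).\<close>
      have "besicovitch_2_ap_fun haar A (conv_fun \<mu> (\<lambda>s. \<phi> (- s)))"
        using ap Cc_compose_uminus[OF \<phi>] unfolding besicovitch_ap_measure_def by blast
      then have "besicovitch_2_ap_fun haar A (\<lambda>t. \<mu> (\<lambda>s. \<phi> (s - t)))"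
        by (simp add: conv_fun_def)
      then show "\<forall>\<^sub>F n in sequentially.
          norm (radon_integral \<nu> (\<lambda>t. indicator (A n) t * cnj (\<mu> (\<lambda>s. \<phi> (s - t))))) \<le> \<epsilon> * m n"
        by (rule besicovitch_average_vanishes[OF N FB M.conv_ucont[OF \<phi>] S _ \<epsilon>])
    qed
  qed
qed

end
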